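(* Let $G$ be a countable infinite amenable group and let $P$ be a polyhedron with $0<\dim P<\infty$. Then for every real number $r$ with $0\le r<\dim P$ there exists a minimal subshift $X\subset P^G$ (a nonempty closed $G$-invariant subset of $P^G$ such that $(X,G)$ is a minimal $G$-system) with ${\rm mdim}(X,G)=r$.
   Context: A polyhedron is the geometric realization of a finite simplicial complex; $\dim P$ is its topological (covering) dimension. A countable group $G$ is amenable if it has a Følner sequence, i.e. a sequence $\{F_n\}$ of nonempty finite subsets of $G$ with $\lim_n |F_n\vartriangle gF_n|/|F_n|=0$ for all $g\in G$. A $G$-system $(X,G)$ is a continuous action of $G$ on a (nonempty) compact metrizable space $X$; it is minimal if every orbit $\{gx:g\in G\}$ is dense in $X$. The group $G$ acts on $P^G$ (product topology) by $g'(x_g)_{g\in G}=(x_{gg'})_{g\in G}$; a subshift of $P^G$ is a closed $G$-invariant subset. Mean topological dimension: for a finite open cover $\alpha=\{U_1,\dots,U_k\}$ of $X$ put ${\rm ord}(\alpha)=\max_{x\in X}\sum_{i=1}^k 1_{U_i}(x)-1$ and ${\rm D}(\alpha)=\min_\beta {\rm ord}(\beta)$, where $\beta$ runs over all finite open covers of $X$ refining $\alpha$. For a nonempty finite $F\subset G$ put $\alpha_F=\bigvee_{g\in F}g^{-1}\alpha$. Then ${\rm D}(\alpha,G)=\lim_{n\to\infty}{\rm D}(\alpha_{F_n})/|F_n|$ for a Følner sequence $\{F_n\}$ (the limit exists and does not depend on the Følner sequence), and ${\rm mdim}(X,G)=\sup_\alpha {\rm D}(\alpha,G)$, the supremum being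 over all finite open covers $\alpha$ of $X$. *)

theory Defs
  imports "HOL-Analysis.Analysis" "HOL-Algebra.Group_Action"
begin

section \<open>Polyhedra\<close>

text \<open>
  The library constant \<open>polyhedron\<close> means a finite intersection of half-spaces. Here a polyhedron
  is the union of the (closed) simplices of a finite geometric simplicial complex.
  The predicate \<open>simplicial_complex\<close> of HOL-Analysis includes finiteness.
\<close>

definition simplicial_polyhedron :: "'a::euclidean_space set \<Rightarrow> bool" where
  "simplicial_polyhedron P \<longleftrightarrow> (\<exists>\<C>. simplicial_complex \<C> \<and> P = \<Union>\<C>)"

section \<open>Finite open covers and covering dimension\<close>

definition finite_open_cover :: "'x topology \<Rightarrow> 'x set set \<Rightarrow> bool" where
  "finite_open_cover X \<alpha> \<longleftrightarrow> finite \<alpha> \<and> (\<forall>U\<in>\<alpha>. openin X U) \<and> \<Union>\<alpha> = topspace X"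

definition refines_cover :: "'x set set \<Rightarrow> 'x set set \<Rightarrow> bool" where
  "refines_cover \<beta> \<alpha> \<longleftrightarrow> (\<forall>V\<in>\<beta>. \<exists>U\<in>\<alpha>. V \<subseteq> U)"

text \<open>
  For finite \<open>\<alpha>\<close> and nonempty \<open>X\<close> the supremum below is a maximum.
  As \<open>Sup {} = 0\<close> on \<^typ>\<open>nat\<close>, covers of the empty space have order \<open>-1\<close>.
\<close>

definition cover_ord :: "'x topology \<Rightarrow> 'x set set \<Rightarrow> int" where
  "cover_ord X \<alpha> = int (SUP x\<in>topspace X. card {U \<in> \<alpha>. x \<in> U}) - 1"

text \<open>The infimum is a minimum: it is over a nonempty set of integers bounded below by \<open>-1\<close>.\<close>

definition cover_D :: "'x topology \<Rightarrow> 'x set set \<Rightarrow> int" where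
  "cover_D X \<alpha> = (INF \<beta>\<in>{\<beta>. finite_open_cover X \<beta> \<and> refines_cover \<beta> \<alpha>}. cover_ord X \<beta>)"

text \<open>
  The topological (Lebesgue covering) dimension: the least \<open>n\<close> such that every finite open cover
  has a finite open refinement of order at most \<open>n\<close>. (The library's \<open>dimension_le\<close> is the small
  inductive dimension.)
\<close>

definition covering_dim :: "'x topology \<Rightarrow> ereal" where
  "covering_dim X = (SUP \<alpha>\<in>{\<alpha>. finite_open_cover X \<alpha>}. ereal (of_int (cover_D X \<alpha>)))"

section \<open>Amenable groups\<close>

definition folner_sequence :: "('g, 'm) monoid_scheme \<Rightarrow> (nat \<Rightarrow> 'g set) \<Rightarrow> bool" where
  "folner_sequence G F \<longleftrightarrow>
     (\<forall>n. finite (F n) \<and> F n \<noteq> {} \<and> F n \<subseteq> carrier G) \<and>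
     (\<forall>g\<in>carrier G.
        (\<lambda>n. real (card (sym_diff (F n) (g <#\<^bsub>G\<^esub> F n))) / real (card (F n))) \<longlonglongrightarrow> 0)"

definition amenable_group :: "('g, 'm) monoid_scheme \<Rightarrow> bool" where
  "amenable_group G \<longleftrightarrow> group G \<and> countable (carrier G) \<and> (\<exists>F. folner_sequence G F)"

section \<open>Systems and subshifts\<close>

definition G_system ::
  "('g, 'm) monoid_scheme \<Rightarrow> 'x topology \<Rightarrow> ('g \<Rightarrow> 'x \<Rightarrow> 'x) \<Rightarrow> bool" where
  "G_system G X \<phi> \<longleftrightarrow>
     group_action G (topspace X) \<phi> \<and>
     compact_space X \<and> metrizable_space X \<and> topspace X \<noteq> {} \<and>
     (\<forall>g\<in>carrier G. continuous_map X X (\<phi> g))"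

definition minimal_system ::
  "('g, 'm) monoid_scheme \<Rightarrow> 'x topology \<Rightarrow> ('g \<Rightarrow> 'x \<Rightarrow> 'x) \<Rightarrow> bool" where
  "minimal_system G X \<phi> \<longleftrightarrow>
     G_system G X \<phi> \<and> (\<forall>x\<in>topspace X. X closure_of (orbit G \<phi> x) = topspace X)"

definition full_shift :: "('g, 'm) monoid_scheme \<Rightarrow> 'p topology \<Rightarrow> ('g \<Rightarrow> 'p) topology" where
  "full_shift G P = product_topology (\<lambda>_. P) (carrier G)"

definition shift_map :: "('g, 'm) monoid_scheme \<Rightarrow> 'g \<Rightarrow> ('g \<Rightarrow> 'p) \<Rightarrow> ('g \<Rightarrow> 'p)" where
  "shift_map G g' x = (\<lambda>g\<in>carrier G. x (g \<otimes>\<^bsub>G\<^esub> g'))"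

definition subshift :: "('g, 'm) monoid_scheme \<Rightarrow> 'p topology \<Rightarrow> ('g \<Rightarrow> 'p) set \<Rightarrow> bool" where
  "subshift G P X \<longleftrightarrow>
     closedin (full_shift G P) X \<and> (\<forall>g\<in>carrier G. shift_map G g ` X \<subseteq> X)"

text \<open>
  The shift action on \<open>X\<close>. The restriction is needed because \<^locale>\<open>group_action\<close> works with
  extensional bijections of the acted-on set.
\<close>

definition shift_action ::
  "('g, 'm) monoid_scheme \<Rightarrow> ('g \<Rightarrow> 'p) set \<Rightarrow> 'g \<Rightarrow> ('g \<Rightarrow> 'p) \<Rightarrow> ('g \<Rightarrow> 'p)" where
  "shift_action G X g = restrict (shift_map G g) X"

section \<open>Mean topological dimension\<close>

definition preimage_cover :: "'x topology \<Rightarrow> ('x \<Rightarrow> 'x) \<Rightarrow> 'x set set \<Rightarrow> 'x set set" where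
  "preimage_cover X f \<alpha> = (\<lambda>U. {x \<in> topspace X. f x \<in> U}) ` \<alpha>"

definition join_covers :: "'x topology \<Rightarrow> 'i set \<Rightarrow> ('i \<Rightarrow> 'x set set) \<Rightarrow> 'x set set" where
  "join_covers X I A = {topspace X \<inter> (\<Inter>i\<in>I. c i) | c. \<forall>i\<in>I. c i \<in> A i}"

definition cover_join_over ::
  "'x topology \<Rightarrow> ('g \<Rightarrow> 'x \<Rightarrow> 'x) \<Rightarrow> 'x set set \<Rightarrow> 'g set \<Rightarrow> 'x set set" where
  "cover_join_over X \<phi> \<alpha> F = join_covers X F (\<lambda>g. preimage_cover X (\<phi> g) \<alpha>)"

text \<open>
  The common limit along all Folner sequences; for a \<open>G\<close>-system of an amenable group it exists
  and is unique (Ornstein-Weiss).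
\<close>

definition mean_cover_D ::
  "('g, 'm) monoid_scheme \<Rightarrow> 'x topology \<Rightarrow> ('g \<Rightarrow> 'x \<Rightarrow> 'x) \<Rightarrow> 'x set set \<Rightarrow> real" where
  "mean_cover_D G X \<phi> \<alpha> =
     (THE L. \<forall>F. folner_sequence G F \<longrightarrow>
        (\<lambda>n. of_int (cover_D X (cover_join_over X \<phi> \<alpha> (F n))) / real (card (F n)))
          \<longlonglongrightarrow> L)"

definition mdim ::
  "('g, 'm) monoid_scheme \<Rightarrow> 'x topology \<Rightarrow> ('g \<Rightarrow> 'x \<Rightarrow> 'x) \<Rightarrow> ereal" where
  "mdim G X \<phi> = (SUP \<alpha>\<in>{\<alpha>. finite_open_cover X \<alpha>}. ereal (mean_cover_D G X \<phi> \<alpha>))"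

end

theory Submission
  imports Defs
begin

text \<open>
  Let \<open>d = dim P\<close> and \<open>c = r / d\<close>. We work with symbolic minimal subshifts \<open>W\<close> whose letters are either a
  point of \<open>P\<close> or the symbol \<open>None\<close>, which marks a free coordinate. The points of \<open>P\<^sup>G\<close> compatible with some
  \<open>w \<in> W\<close> form a subshift whose mean dimension is \<open>d\<close> times the maximal density of free coordinates.
  Starting from the system in which every coordinate is free, one writes a prescribed finite pattern at
  a sparse, maximal separated set of places where it fits and passes to a minimal subset of the resulting
  symbolic system. Every pattern is treated once, which makes the intersection \<open>X\<close> of the compatible
  subshifts minimal; filling in further sparse sets makes the densities decrease to \<open>c\<close>.

  Upper bound: a cover of \<open>P\<close> of order \<open>d\<close> partitions \<open>P\<close> into cells indexed by the set of members to
  which a point belongs; products of such cells stratify \<open>X\<close>, and any stratification yields a refinement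
  whose order is the maximal rank. Free coordinates contribute at most \<open>d\<close> to the rank, the others \<open>0\<close>.
  Lower bound: by compactness \<open>X\<close> contains, over each finite window, a cube of dimension at least
  \<open>d c\<close> times the size of the window, and Lebesgue's covering theorem applies. The limits defining mean
  dimension exist by the Ornstein--Weiss lemma, since \<open>cover_D\<close> of joins is subadditive.
\<close>

section \<open>Covers and stratified refinements\<close>

text \<open>A pattern has to enter every word and yet cost little density. Separation keeps it
  cheap: the translates \<open>T s\<close> of a large window \<open>T\<close> are disjoint, so
  writing \<open>\<mu>\<close> loses at most a proportion \<open>card (dom \<mu>) / card T\<close>,
  and an infinite group offers arbitrarily large \<open>T\<close>. Maximality gives the converse:
  when single free coordinates are filled, each free coordinate lies near a filled one, so the
  density drops by a definite factor and can be brought as near to \<open>c\<close> as desired. The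
  places are chosen, hence not a function of the word; they are recorded as extra letters, and a
  minimal subset of the enlarged system turns the filling into a block code. Letters come from a
  countable dense set \<open>D\<close>, which leaves countably many patterns, and each stage uses
  finitely many of them, so that one cover of \<open>P\<close> gives all letters rank 0. The density
  stays strictly above \<open>c\<close>, which leaves enough free coordinates in each finite window.
  They change from stage to stage; the pigeonhole principle selects a set \<open>J\<close> in the
  window that recurs at infinitely many stages, and both minimality and the cubes rest on
  it.\<close>

lemma int_Inf_mem:
  fixes S :: "int set"
  assumes "S \<noteq> {}" "bdd_below S"
  shows "Inf S \<in> S"
proof -
  obtain s where "s \<in> S" "s < Inf S + 1"
    using cInf_lessD[OF assms(1), of "Inf S + 1"] by auto
  moreover have "Inf S \<le> s" using assms \<open>s \<in> S\<close> by (simp add: cInf_lower)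
  ultimately show ?thesis by (metis antisym zle_add1_eq_le)
qed

lemma cover_ord_le_iff:
  assumes "finite \<beta>"
  shows "cover_ord X \<beta> \<le> int N \<longleftrightarrow> (\<forall>x\<in>topspace X. card {U\<in>\<beta>. x \<in> U} \<le> Suc N)"
proof (cases "topspace X = {}")
  case True
  then show ?thesis by (simp add: cover_ord_def)
next
  case False
  have "bdd_above ((\<lambda>x. card {U\<in>\<beta>. x \<in> U}) ` topspace X)"
    using assms by (intro bdd_aboveI2[where M="card \<beta>"]) (auto intro: card_mono)
  moreover have "cover_ord X \<beta> \<le> int N \<longleftrightarrow> (SUP x\<in>topspace X. card {U\<in>\<beta>. x \<in> U}) \<le> Suc N"
    unfolding cover_ord_def by linarith
  ultimately show ?thesis using cSUP_le_iff[OF False, of "\<lambda>x. card {U\<in>\<beta>. x \<in> U}" "Suc N"] by blast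
qed

lemma cover_ord_ge: "- 1 \<le> cover_ord X \<beta>"
  by (simp add: cover_ord_def)

lemma refines_cover_refl: "refines_cover \<alpha> \<alpha>"
  by (auto simp: refines_cover_def)

lemma refines_cover_trans: "refines_cover \<alpha> \<beta> \<Longrightarrow> refines_cover \<beta> \<gamma> \<Longrightarrow> refines_cover \<alpha> \<gamma>"
  unfolding refines_cover_def by (meson order.trans)

lemma cover_D_attained:
  assumes "finite_open_cover X \<alpha>"
  obtains \<beta> where "finite_open_cover X \<beta>" "refines_cover \<beta> \<alpha>" "cover_ord X \<beta> = cover_D X \<alpha>"
proof -
  let ?S = "cover_ord X ` {\<beta>. finite_open_cover X \<beta> \<and> refines_cover \<beta> \<alpha>}"
  have "Inf ?S \<in> ?S"
  proof (rule int_Inf_mem)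
    show "?S \<noteq> {}" using assms refines_cover_refl by blast
    show "bdd_below ?S" using cover_ord_ge by (intro bdd_belowI[where m="-1"]) auto
  qed
  then show ?thesis using that by (auto simp: cover_D_def)
qed

lemma cover_D_lower:
  assumes "finite_open_cover X \<beta>" "refines_cover \<beta> \<alpha>"
  shows "cover_D X \<alpha> \<le> cover_ord X \<beta>"
  unfolding cover_D_def using assms cover_ord_ge
  by (intro cINF_lower bdd_belowI[where m="-1"]) auto

lemma cover_D_le_iff:
  assumes "finite_open_cover X \<alpha>"
  shows "cover_D X \<alpha> \<le> int N \<longleftrightarrow>
    (\<exists>\<beta>. finite_open_cover X \<beta> \<and> refines_cover \<beta> \<alpha> \<and> (\<forall>x\<in>topspace X. card {U\<in>\<beta>. x \<in> U} \<le> Suc N))"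
    (is "?L \<longleftrightarrow> ?R")
proof
  assume ?L
  obtain \<beta> where \<beta>: "finite_open_cover X \<beta>" "refines_cover \<beta> \<alpha>" "cover_ord X \<beta> = cover_D X \<alpha>"
    using cover_D_attained[OF assms] .
  then show ?R using \<open>?L\<close> cover_ord_le_iff[of \<beta> X N] by (auto simp: finite_open_cover_def)
next
  assume ?R
  then show ?L using cover_D_lower cover_ord_le_iff
    by (metis finite_open_cover_def order.trans)
qed

lemma cover_D_nonneg:
  assumes "finite_open_cover X \<alpha>" "topspace X \<noteq> {}"
  shows "0 \<le> cover_D X \<alpha>"
proof -
  obtain \<beta> where \<beta>: "finite_open_cover X \<beta>" "refines_cover \<beta> \<alpha>" "cover_ord X \<beta> = cover_D X \<alpha>"
    using cover_D_attained[OF assms(1)] .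
  obtain x where x: "x \<in> topspace X" using assms(2) by blast
  then have "{U\<in>\<beta>. x \<in> U} \<noteq> {}" "finite \<beta>" using \<beta>(1) by (auto simp: finite_open_cover_def)
  then have "1 \<le> card {U\<in>\<beta>. x \<in> U}" by (simp add: Suc_leI card_gt_0_iff)
  also have "\<dots> \<le> (SUP x\<in>topspace X. card {U\<in>\<beta>. x \<in> U})"
    using x \<open>finite \<beta>\<close> by (intro cSUP_upper bdd_aboveI2[where M="card \<beta>"]) (auto intro: card_mono)
  finally show ?thesis using \<beta>(3) by (simp add: cover_ord_def)
qed

text \<open>Normality gives each \<open>K c\<close> a neighbourhood \<open>W c\<close> whose closure
  misses the other closed sets. Removing the closures of the other neighbourhoods makes them
  disjoint and takes nothing from \<open>K c\<close>.\<close>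

lemma normal_space_expand_disjoint:
  assumes "normal_space X" "finite J"
    and cl: "\<And>c. c \<in> J \<Longrightarrow> closedin X (K c)"
    and op: "\<And>c. c \<in> J \<Longrightarrow> openin X (U c) \<and> K c \<subseteq> U c"
    and dis: "\<And>c c'. c \<in> J \<Longrightarrow> c' \<in> J \<Longrightarrow> c \<noteq> c' \<Longrightarrow> K c \<inter> K c' = {}"
  obtains V where "\<And>c. c \<in> J \<Longrightarrow> openin X (V c) \<and> K c \<subseteq> V c \<and> V c \<subseteq> U c"
    and "\<And>c c'. c \<in> J \<Longrightarrow> c' \<in> J \<Longrightarrow> c \<noteq> c' \<Longrightarrow> V c \<inter> V c' = {}"
proof -
  have "\<exists>W. openin X W \<and> K c \<subseteq> W \<and> X closure_of W \<subseteq> U c - (\<Union>c'\<in>J-{c}. K c')" if c: "c \<in> J" for c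
  proof -
    have "openin X (U c - (\<Union>c'\<in>J-{c}. K c'))"
      using op[OF c] cl assms(2) by (intro openin_diff closedin_Union) auto
    moreover have "K c \<subseteq> U c - (\<Union>c'\<in>J-{c}. K c')" using op[OF c] dis[OF c] by fastforce
    ultimately show ?thesis using assms(1) cl[OF c] unfolding normal_space_alt by blast
  qed
  then obtain W where W: "\<And>c. c \<in> J \<Longrightarrow> openin X (W c) \<and> K c \<subseteq> W c \<and>
      X closure_of (W c) \<subseteq> U c - (\<Union>c'\<in>J-{c}. K c')" by metis
  define V where "V c = W c - (\<Union>c'\<in>J-{c}. X closure_of (W c'))" for c
  show ?thesis
  proof (rule that[of V])
    fix c assume c: "c \<in> J"
    have "W c \<subseteq> X closure_of (W c)" using W[OF c] by (simp add: closure_of_subset openin_subset)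
    then have "V c \<subseteq> U c" using W[OF c] by (auto simp: V_def)
    moreover have "K c \<subseteq> V c" using W c unfolding V_def by fastforce
    moreover have "openin X (V c)"
      unfolding V_def using W[OF c] assms(2) by (intro openin_diff closedin_Union) auto
    ultimately show "openin X (V c) \<and> K c \<subseteq> V c \<and> V c \<subseteq> U c" by blast
  next
    fix c c' assume c: "c \<in> J" "c' \<in> J" "c \<noteq> c'"
    have "W c \<subseteq> X closure_of (W c)" using W[OF c(1)] by (simp add: closure_of_subset openin_subset)
    then show "V c \<inter> V c' = {}" using c by (auto simp: V_def)
  qed
qed

text \<open>The strata are the fibres of \<open>f\<close>, and a stratum can accumulate only on
  strata of smaller rank. Once the ranks below \<open>j\<close> are covered by an open set, what
  remains of the strata of rank \<open>j\<close> is closed and pairwise disjoint, and expands to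
  disjoint open sets. One disjoint family for each rank from 0 to \<open>N\<close> gives
  multiplicity at most \<open>N + 1\<close>.\<close>

lemma cover_D_le_stratified:
  assumes X: "normal_space X" and \<alpha>: "finite_open_cover X \<alpha>"
    and fin: "finite (f ` topspace X)"
    and rank: "\<And>x. x \<in> topspace X \<Longrightarrow> \<rho> (f x) \<le> N"
    and strat: "\<And>c. X closure_of {x\<in>topspace X. f x = c} \<subseteq> {x. f x = c \<or> \<rho> (f x) < \<rho> c}"
    and sub: "\<And>x. x \<in> topspace X \<Longrightarrow> \<exists>U\<in>\<alpha>. {y\<in>topspace X. f y = f x} \<subseteq> U"
  shows "cover_D X \<alpha> \<le> int N"
proof -
  define K where "K = f ` topspace X"
  define C where "C c = {x\<in>topspace X. f x = c}" for c
  have "\<forall>c\<in>K. \<exists>U\<in>\<alpha>. C c \<subseteq> U" using sub by (auto simp: K_def C_def)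
  then obtain Q where Q: "\<And>c. c \<in> K \<Longrightarrow> Q c \<in> \<alpha> \<and> C c \<subseteq> Q c" by metis
  have Oo: "openin X (Q c)" if "c \<in> K" for c using Q[OF that] \<alpha> by (auto simp: finite_open_cover_def)
  have step: "\<exists>V. (\<forall>c\<in>K. \<rho> c < j \<longrightarrow> openin X (V c) \<and> V c \<subseteq> Q c) \<and>
     (\<forall>c\<in>K. \<forall>c'\<in>K. \<rho> c < j \<longrightarrow> \<rho> c = \<rho> c' \<longrightarrow> c \<noteq> c' \<longrightarrow> V c \<inter> V c' = {}) \<and>
     (\<forall>x\<in>topspace X. \<rho> (f x) < j \<longrightarrow> (\<exists>c\<in>K. \<rho> c < j \<and> x \<in> V c))" for j
  proof (induction j)
    case 0
    then show ?case by auto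
  next
    case (Suc j)
    then obtain V where V: "\<forall>c\<in>K. \<rho> c < j \<longrightarrow> openin X (V c) \<and> V c \<subseteq> Q c"
      "\<forall>c\<in>K. \<forall>c'\<in>K. \<rho> c < j \<longrightarrow> \<rho> c = \<rho> c' \<longrightarrow> c \<noteq> c' \<longrightarrow> V c \<inter> V c' = {}"
      "\<forall>x\<in>topspace X. \<rho> (f x) < j \<longrightarrow> (\<exists>c\<in>K. \<rho> c < j \<and> x \<in> V c)" by (elim exE conjE)
    have V1: "openin X (V c) \<and> V c \<subseteq> Q c" if "c \<in> K" "\<rho> c < j" for c using V(1) that by blast
    have V2: "V c \<inter> V c' = {}" if "c \<in> K" "c' \<in> K" "\<rho> c < j" "\<rho> c = \<rho> c'" "c \<noteq> c'" for c c'
      using V(2) that by blast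
    have V3: "\<exists>c\<in>K. \<rho> c < j \<and> x \<in> V c" if "x \<in> topspace X" "\<rho> (f x) < j" for x
      using V(3) that by blast
    define R where "R = (\<Union>c\<in>{c\<in>K. \<rho> c < j}. V c)"
    have R: "openin X R" unfolding R_def using V1 by (intro openin_Union) auto
    define J where "J = {c\<in>K. \<rho> c = j}"
    have "finite J" using fin by (simp add: J_def K_def)
    \<comment> \<open>Limit points that leave the stratum have rank below \<open>j\<close>, so
      \<open>R\<close> already contains them.\<close>
    have eq: "C c - R = X closure_of (C c) - R" if "c \<in> J" for c
    proof -
      have "C c \<subseteq> X closure_of (C c)" by (intro closure_of_subset) (auto simp: C_def)
      moreover have "X closure_of (C c) - R \<subseteq> C c"
      proof
        fix x assume x: "x \<in> X closure_of (C c) - R"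
        then have "x \<in> topspace X" by (simp add: in_closure_of)
        moreover have "f x = c \<or> \<rho> (f x) < j" using strat[of c] x that by (auto simp: C_def J_def)
        ultimately show "x \<in> C c" using V3[of x] x by (auto simp: C_def R_def)
      qed
      ultimately show ?thesis by blast
    qed
    have cl: "closedin X (C c - R)" if "c \<in> J" for c
      unfolding eq[OF that] using R by (intro closedin_diff) auto
    obtain W where W: "\<And>c. c \<in> J \<Longrightarrow> openin X (W c) \<and> C c - R \<subseteq> W c \<and> W c \<subseteq> Q c"
      and Wd: "\<And>c c'. c \<in> J \<Longrightarrow> c' \<in> J \<Longrightarrow> c \<noteq> c' \<Longrightarrow> W c \<inter> W c' = {}"
    proof (rule normal_space_expand_disjoint[OF X \<open>finite J\<close> cl, where U=Q])
      show "openin X (Q c) \<and> C c - R \<subseteq> Q c" if "c \<in> J" for c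
        using that Q[of c] Oo[of c] by (auto simp: J_def)
      show "(C c - R) \<inter> (C c' - R) = {}" if "c \<noteq> c'" for c c' using that by (auto simp: C_def)
    qed (use that in auto)
    show ?case
    proof (rule exI[of _ "\<lambda>c. if \<rho> c = j then W c else V c"], intro conjI ballI impI)
      fix c assume "c \<in> K" "\<rho> c < Suc j"
      then show "openin X (if \<rho> c = j then W c else V c)" "(if \<rho> c = j then W c else V c) \<subseteq> Q c"
        using W[of c] V1[of c] by (auto simp: J_def)
    next
      fix c c' assume "c \<in> K" "c' \<in> K" "\<rho> c < Suc j" "\<rho> c = \<rho> c'" "c \<noteq> c'"
      then show "(if \<rho> c = j then W c else V c) \<inter> (if \<rho> c' = j then W c' else V c') = {}"
        using Wd[of c c'] V2[of c c'] by (auto simp: J_def)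
    next
      fix x assume x: "x \<in> topspace X" "\<rho> (f x) < Suc j"
      show "\<exists>c\<in>K. \<rho> c < Suc j \<and> x \<in> (if \<rho> c = j then W c else V c)"
      proof (cases "x \<in> R")
        case True
        then obtain c where "c \<in> K" "\<rho> c < j" "x \<in> V c" by (auto simp: R_def)
        then show ?thesis by (intro bexI[of _ c]) auto
      next
        case False
        then have "\<rho> (f x) = j" using V3[of x] x by (fastforce simp: R_def)
        moreover have "f x \<in> J" "x \<in> C (f x)" using x calculation by (auto simp: J_def K_def C_def)
        ultimately show ?thesis using W[of "f x"] False by (intro bexI[of _ "f x"]) (auto simp: J_def)
      qed
    qed
  qed
  have rk: "\<rho> c < Suc N" if "c \<in> K" for c using rank that by (auto simp: K_def less_Suc_eq_le)
  obtain V where V: "\<forall>c\<in>K. \<rho> c < Suc N \<longrightarrow> openin X (V c) \<and> V c \<subseteq> Q c"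
      "\<forall>c\<in>K. \<forall>c'\<in>K. \<rho> c < Suc N \<longrightarrow> \<rho> c = \<rho> c' \<longrightarrow> c \<noteq> c' \<longrightarrow> V c \<inter> V c' = {}"
      "\<forall>x\<in>topspace X. \<rho> (f x) < Suc N \<longrightarrow> (\<exists>c\<in>K. \<rho> c < Suc N \<and> x \<in> V c)"
    using step[of "Suc N"] by (elim exE conjE)
  have V1: "openin X (V c)" "V c \<subseteq> Q c" if "c \<in> K" for c using V(1) rk that by auto
  have V2: "V c \<inter> V c' = {}" if "c \<in> K" "c' \<in> K" "\<rho> c = \<rho> c'" "c \<noteq> c'" for c c'
    using V(2) rk that by blast
  have V3: "\<exists>c\<in>K. x \<in> V c" if "x \<in> topspace X" for x
    using V(3) rk that by (auto simp: K_def)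
  have finK: "finite K" using fin by (simp add: K_def)
  have "card {U \<in> V ` K. x \<in> U} \<le> Suc N" for x
  proof -
    have "{U \<in> V ` K. x \<in> U} = V ` {c\<in>K. x \<in> V c}" by auto
    then have "card {U \<in> V ` K. x \<in> U} \<le> card {c\<in>K. x \<in> V c}" using finK by (simp add: card_image_le)
    \<comment> \<open>Sets \<open>V c\<close> of equal rank are disjoint, so the rank is injective
      on the indices whose set contains \<open>x\<close>.\<close>
    also have "\<dots> = card (\<rho> ` {c\<in>K. x \<in> V c})"
      using V2 by (intro card_image[symmetric] inj_onI) blast
    also have "\<dots> \<le> card {..N}" using rk by (intro card_mono) (auto simp: less_Suc_eq_le)
    finally show ?thesis by simp
  qed
  moreover have "refines_cover (V ` K) \<alpha>" using V1(2) Q unfolding refines_cover_def by blast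
  moreover have "finite_open_cover X (V ` K)"
    unfolding finite_open_cover_def
  proof (intro conjI ballI)
    show "\<Union> (V ` K) = topspace X" using V1(1) V3 by (auto dest: openin_subset)
  qed (use finK V1 in auto)
  ultimately show ?thesis using cover_D_le_iff[OF \<alpha>] by blast
qed

text \<open>Membership in an open set persists nearby, so a limit of points with membership set
  \<open>c\<close> can lose members of the cover but gain none. This makes membership sets a
  stratification.\<close>

lemma closure_of_membership_cell:
  assumes \<beta>: "\<And>U. U \<in> \<beta> \<Longrightarrow> openin Y U"
    and y: "y \<in> Y closure_of {y\<in>topspace Y. {U\<in>\<beta>. y \<in> U} = c}"
  shows "{U\<in>\<beta>. y \<in> U} \<subseteq> c"
proof
  fix U assume "U \<in> {U\<in>\<beta>. y \<in> U}"
  then have "openin Y U" "y \<in> U" "U \<in> \<beta>" using \<beta> by auto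
  then obtain z where "z \<in> U" "{U\<in>\<beta>. z \<in> U} = c" using y by (auto simp: in_closure_of)
  then show "U \<in> c" using \<open>U \<in> \<beta>\<close> by auto
qed

text \<open>Stratify \<open>X\<close> by recording, for each \<open>i\<close>, which members of
  \<open>\<beta> i\<close> contain \<open>\<phi> i x\<close>; the rank adds up these numbers minus
  one. At a limit point of a stratum the record is unchanged or the rank drops. The upper bounds for
  simplices, for joins and for subshifts all come from this lemma.\<close>

lemma cover_D_le_sum:
  assumes X: "normal_space X" and \<alpha>: "finite_open_cover X \<alpha>" and I: "finite (I::'i set)"
    and \<phi>: "\<And>i. i \<in> I \<Longrightarrow> continuous_map X (Y::'b topology) (\<phi> i)"
    and \<beta>: "\<And>i. i \<in> I \<Longrightarrow> finite_open_cover Y (\<beta> i)"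
    and sub: "\<And>U. (\<And>i. i \<in> I \<Longrightarrow> U i \<in> \<beta> i) \<Longrightarrow> \<exists>A\<in>\<alpha>. {x\<in>topspace X. \<forall>i\<in>I. \<phi> i x \<in> U i} \<subseteq> A"
    and N: "\<And>x. x \<in> topspace X \<Longrightarrow> (\<Sum>i\<in>I. card {U\<in>\<beta> i. \<phi> i x \<in> U} - 1) \<le> N"
  shows "cover_D X \<alpha> \<le> int N"
proof -
  define cell where "cell i y = {U\<in>\<beta> i. y \<in> U}" for i y
  define f where "f x = (\<lambda>i\<in>I. cell i (\<phi> i x))" for x
  define \<rho> where "\<rho> c = (\<Sum>i\<in>I. card (c i) - 1)" for c :: "'i \<Rightarrow> 'b set set"
  have fc: "finite (cell i y)" if "i \<in> I" for i y
    using \<beta>[OF that] by (auto simp: cell_def finite_open_cover_def)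
  have ne: "cell i (\<phi> i x) \<noteq> {}" if "i \<in> I" "x \<in> topspace X" for i x
  proof -
    have "\<phi> i x \<in> topspace Y" using continuous_map_image_subset_topspace[OF \<phi>[OF that(1)]] that(2) by blast
    then have "\<phi> i x \<in> \<Union> (\<beta> i)" using \<beta>[OF that(1)] by (simp add: finite_open_cover_def)
    then show ?thesis by (auto simp: cell_def)
  qed
  show ?thesis
  proof (rule cover_D_le_stratified[OF X \<alpha>, where f=f and \<rho>=\<rho>])
    have "f ` topspace X \<subseteq> (\<Pi>\<^sub>E i\<in>I. Pow (\<beta> i))" by (auto simp: f_def cell_def)
    then show "finite (f ` topspace X)"
      by (rule finite_subset) (use I \<beta> in \<open>auto intro!: finite_PiE simp: finite_open_cover_def\<close>)
    show "\<rho> (f x) \<le> N" if "x \<in> topspace X" for x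
      using N[OF that] by (simp add: \<rho>_def f_def cell_def)
    show "\<exists>U\<in>\<alpha>. {y \<in> topspace X. f y = f x} \<subseteq> U" if x: "x \<in> topspace X" for x
    proof -
      have "\<forall>i\<in>I. \<exists>U. U \<in> cell i (\<phi> i x)" using ne[OF _ x] by blast
      then obtain U where U: "\<And>i. i \<in> I \<Longrightarrow> U i \<in> cell i (\<phi> i x)" by metis
      then obtain A where A: "A \<in> \<alpha>" "{x\<in>topspace X. \<forall>i\<in>I. \<phi> i x \<in> U i} \<subseteq> A"
        using sub[of U] by (auto simp: cell_def)
      have "\<phi> i y \<in> U i" if "i \<in> I" "f y = f x" for i y
      proof -
        have "cell i (\<phi> i y) = cell i (\<phi> i x)" using that(1) fun_cong[OF that(2), of i] unfolding f_def by simp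
        then show ?thesis using U[OF that(1)] by (auto simp: cell_def)
      qed
      then show ?thesis using A by blast
    qed
    show "X closure_of {x \<in> topspace X. f x = c} \<subseteq> {x. f x = c \<or> \<rho> (f x) < \<rho> c}" for c
    proof
      fix x assume x: "x \<in> X closure_of {x \<in> topspace X. f x = c}"
      then have xX: "x \<in> topspace X" by (simp add: in_closure_of)
      have "{x \<in> topspace X. f x = c} \<noteq> {}" using x by (metis closure_of_empty empty_iff)
      then obtain z where z: "z \<in> topspace X" "f z = c" by auto
      have sub: "cell i (\<phi> i x) \<subseteq> c i" if i: "i \<in> I" for i
      proof -
        have "{x \<in> topspace X. f x = c} \<subseteq> {x \<in> topspace X. \<phi> i x \<in> {y\<in>topspace Y. cell i y = c i}}"
          using i continuous_map_image_subset_topspace[OF \<phi>[OF i]] by (auto simp: f_def)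
        then have "x \<in> X closure_of {x \<in> topspace X. \<phi> i x \<in> {y\<in>topspace Y. cell i y = c i}}"
          using x closure_of_mono by blast
        then have "\<phi> i x \<in> Y closure_of {y\<in>topspace Y. cell i y = c i}"
          using continuous_map_closure_preimage_subset[OF \<phi>[OF i]] by blast
        then show ?thesis unfolding cell_def
          using closure_of_membership_cell[of "\<beta> i" Y] \<beta>[OF i] by (auto simp: finite_open_cover_def)
      qed
      have fci: "finite (c i)" if "i \<in> I" for i using z that fc by (auto simp: f_def)
      show "x \<in> {x. f x = c \<or> \<rho> (f x) < \<rho> c}"
      proof (cases "\<forall>i\<in>I. cell i (\<phi> i x) = c i")
        case True
        have "f x i = c i" for i
        proof (cases "i \<in> I")
          case True
          then show ?thesis using \<open>\<forall>i\<in>I. cell i (\<phi> i x) = c i\<close> by (simp add: f_def)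
        next
          case False
          then show ?thesis unfolding z(2)[symmetric] by (simp add: f_def)
        qed
        then have "f x = c" by blast
        then show ?thesis by simp
      next
        case False
        then obtain j where j: "j \<in> I" "cell j (\<phi> j x) \<subset> c j" using sub by blast
        have "\<rho> (f x) = (\<Sum>i\<in>I. card (cell i (\<phi> i x)) - 1)" by (simp add: \<rho>_def f_def)
        also have "\<dots> < \<rho> c" unfolding \<rho>_def
        proof (rule sum_strict_mono_ex1[OF I])
          show "\<forall>i\<in>I. card (cell i (\<phi> i x)) - 1 \<le> card (c i) - 1"
            using sub fci by (auto intro!: diff_le_mono card_mono)
          have "card (cell j (\<phi> j x)) < card (c j)" using j fci by (intro psubset_card_mono) auto
          \<comment> \<open>Without this, truncated subtraction could hide the decrease from one
            member to none.\<close>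
          moreover have "0 < card (cell j (\<phi> j x))" using ne[OF j(1) xX] fc[OF j(1)] by (simp add: card_gt_0_iff)
          ultimately show "\<exists>a\<in>I. card (cell a (\<phi> a x)) - 1 < card (c a) - 1" using j(1) by (intro bexI[of _ j]) auto
        qed
        finally show ?thesis by simp
      qed
    qed
  qed
qed

section \<open>Covering dimension of cubes and polyhedra\<close>

text \<open>A basic neighbourhood in a product restricts finitely many coordinates; finitely many
  neighbourhoods of half the radius cover \<open>X\<close>, which makes coordinates and radius
  uniform. This is the link between open covers of a subshift and finite windows.\<close>

lemma product_Lebesgue_number:
  fixes Y :: "'p::metric_space set"
  assumes X: "compactin (product_topology (\<lambda>_. top_of_set Y) I) X"
    and op: "\<And>V. V \<in> \<beta> \<Longrightarrow> openin (subtopology (product_topology (\<lambda>_. top_of_set Y) I) X) V"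
    and cov: "X \<subseteq> \<Union>\<beta>"
  obtains E e where "finite E" "E \<subseteq> I" "0 < e"
    "\<And>x. x \<in> X \<Longrightarrow> \<exists>V\<in>\<beta>. \<forall>y\<in>X. (\<forall>i\<in>E. dist (x i) (y i) < e) \<longrightarrow> y \<in> V"
proof -
  let ?T = "product_topology (\<lambda>_. top_of_set Y) I"
  have XT: "X \<subseteq> topspace ?T" using X by (rule compactin_subset_topspace)
  have "\<exists>E e. finite E \<and> E \<subseteq> I \<and> 0 < e \<and> (\<exists>V\<in>\<beta>. \<forall>y\<in>X. (\<forall>i\<in>E. dist (x i) (y i) < e) \<longrightarrow> y \<in> V)"
    if x: "x \<in> X" for x
  proof -
    obtain V where V: "V \<in> \<beta>" "x \<in> V" using cov x by auto
    then obtain O' where O: "openin ?T O'" "V = O' \<inter> X" using op by (auto simp: openin_subtopology)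
    then obtain U where U: "finite {i\<in>I. U i \<noteq> Y}" "\<And>i. i \<in> I \<Longrightarrow> openin (top_of_set Y) (U i)"
      "x \<in> Pi\<^sub>E I U" "Pi\<^sub>E I U \<subseteq> O'"
      using V unfolding openin_product_topology_alt by auto
    define E where "E = {i\<in>I. U i \<noteq> Y}"
    have "\<exists>e>0. \<forall>y\<in>Y. dist (x i) y < e \<longrightarrow> y \<in> U i" if "i \<in> E" for i
    proof -
      have "x i \<in> U i" "openin (top_of_set Y) (U i)" using U that by (auto simp: E_def)
      then obtain e where "0 < e" "ball (x i) e \<inter> Y \<subseteq> U i" unfolding openin_contains_ball by blast
      then show ?thesis by (intro exI[of _ e]) auto
    qed
    then obtain d where d: "\<And>i. i \<in> E \<Longrightarrow> 0 < d i \<and> (\<forall>y\<in>Y. dist (x i) y < d i \<longrightarrow> y \<in> U i)" by metis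
    define e where "e = Min (insert 1 (d ` E))"
    have fE: "finite E" using U(1) by (simp add: E_def)
    then have e: "0 < e" "\<And>i. i \<in> E \<Longrightarrow> e \<le> d i" using d by (auto simp: e_def)
    have "y \<in> V" if y: "y \<in> X" "\<forall>i\<in>E. dist (x i) (y i) < e" for y
    proof -
      have yT: "y \<in> (\<Pi>\<^sub>E i\<in>I. Y)" using y XT by auto
      have "y i \<in> U i" if "i \<in> I" for i
      proof (cases "i \<in> E")
        case True
        then show ?thesis using d[OF True] e(2)[OF True] y(2) yT that by (force simp: PiE_iff)
      next
        case False
        then have "U i = Y" using that by (auto simp: E_def)
        then show ?thesis using yT that by auto
      qed
      then have "y \<in> Pi\<^sub>E I U" using yT by (auto simp: PiE_iff)
      then show ?thesis using U(4) O(2) y by auto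
    qed
    then show ?thesis using fE e(1) V(1) by (intro exI[of _ E] exI[of _ e]) (auto simp: E_def)
  qed
  then obtain E e where Ee: "\<And>x. x \<in> X \<Longrightarrow> finite (E x) \<and> E x \<subseteq> I \<and> 0 < e x \<and>
    (\<exists>V\<in>\<beta>. \<forall>y\<in>X. (\<forall>i\<in>E x. dist (x i) (y i) < e x) \<longrightarrow> y \<in> V)" by metis
  define B where "B x = {y\<in>topspace ?T. \<forall>i\<in>E x. dist (x i) (y i) < e x / 2}" for x
  have Bop: "openin ?T (B x)" if x: "x \<in> X" for x
  proof -
    have "B x = topspace ?T \<inter> (\<Inter>i\<in>E x. {y\<in>topspace ?T. y i \<in> ball (x i) (e x / 2) \<inter> Y})"
    proof -
      have "y i \<in> Y" if "y \<in> topspace ?T" "i \<in> E x" for y i using that Ee[OF x] by (auto simp: PiE_iff)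
      then show ?thesis by (auto simp: B_def)
    qed
    moreover have "openin ?T {y\<in>topspace ?T. y i \<in> ball (x i) (e x / 2) \<inter> Y}" if "i \<in> E x" for i
    proof (rule openin_continuous_map_preimage[OF continuous_map_product_projection])
      show "i \<in> I" using that Ee[OF x] by auto
      show "openin (top_of_set Y) (ball (x i) (e x / 2) \<inter> Y)" by (metis inf_commute open_ball openin_open_Int)
    qed
    then have "openin ?T ((\<Inter>i\<in>E x. {y\<in>topspace ?T. y i \<in> ball (x i) (e x / 2) \<inter> Y}) \<inter> topspace ?T)"
      using Ee[OF x] by (intro openin_INT) auto
    ultimately show ?thesis by (simp only: Int_commute)
  qed
  have "X \<subseteq> \<Union>(B ` X)"
  proof
    fix x assume x: "x \<in> X"
    then have "x \<in> B x" using XT Ee[OF x] by (auto simp: B_def)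
    then show "x \<in> \<Union>(B ` X)" using x by blast
  qed
  then obtain \<F> where \<F>: "finite \<F>" "\<F> \<subseteq> B ` X" "X \<subseteq> \<Union>\<F>"
    using compactinD[OF X, of "B ` X"] Bop by auto
  then obtain C where C: "C \<subseteq> X" "finite C" "\<F> = B ` C" by (meson finite_subset_image)
  define E0 where "E0 = (\<Union>x\<in>C. E x)"
  define e0 where "e0 = Min (insert 1 ((\<lambda>x. e x / 2) ` C))"
  have e0: "0 < e0" using C Ee by (auto simp: e0_def)
  have e02: "e0 \<le> e x / 2" if "x \<in> C" for x unfolding e0_def using C that by (intro Min_le) auto
  show ?thesis
  proof (rule that[of E0 e0])
    show "finite E0" "E0 \<subseteq> I" "0 < e0" using C Ee e0 by (auto simp: E0_def)
    fix x assume x: "x \<in> X"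
    then obtain c where c: "c \<in> C" "x \<in> B c" using \<F>(3) C(3) by auto
    then obtain V where V: "V \<in> \<beta>" "\<And>y. y \<in> X \<Longrightarrow> (\<forall>i\<in>E c. dist (c i) (y i) < e c) \<Longrightarrow> y \<in> V"
      using Ee[of c] C(1) by blast
    have "y \<in> V" if y: "y \<in> X" "\<forall>i\<in>E0. dist (x i) (y i) < e0" for y
    proof (rule V(2)[OF y(1)], intro ballI)
      fix i assume i: "i \<in> E c"
      then have "dist (x i) (y i) < e c / 2" using y(2) c e02[of c] by (force simp: E0_def)
      moreover have "dist (c i) (x i) < e c / 2" using c(2) i by (auto simp: B_def)
      ultimately show "dist (c i) (y i) < e c" using dist_triangle[of "c i" "y i" "x i"] by linarith
    qed
    then show "\<exists>V\<in>\<beta>. \<forall>y\<in>X. (\<forall>i\<in>E0. dist (x i) (y i) < e0) \<longrightarrow> y \<in> V" using V(1) by blast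
  qed
qed

section \<open>Lebesgue's covering theorem for the cube\<close>

definition unit_cube :: "nat \<Rightarrow> (nat \<Rightarrow> real) topology" where
  "unit_cube n = product_topology (\<lambda>_. top_of_set {0..1}) {..<n}"

lemma topspace_unit_cube: "topspace (unit_cube n) = (\<Pi>\<^sub>E i\<in>{..<n}. {0..1})"
  by (simp add: unit_cube_def)

lemma compact_space_unit_cube: "compact_space (unit_cube n)"
  unfolding unit_cube_def compact_space_product_topology by (simp add: compact_space_subtopology)

text \<open>
  A member of the cover gets the label of the first face \<open>t i = 1\<close> that
  it meets; Kuhn's combinatorial lemma yields a small simplex carrying all \<open>n + 1\<close> labels.
\<close>

theorem Lebesgue_covering:
  assumes fin: "finite \<beta>" and op: "\<And>V. V \<in> \<beta> \<Longrightarrow> openin (unit_cube n) V"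
    and cov: "topspace (unit_cube n) \<subseteq> \<Union>\<beta>"
    and faces: "\<And>V i s t. V \<in> \<beta> \<Longrightarrow> i < n \<Longrightarrow> s \<in> V \<Longrightarrow> t \<in> V \<Longrightarrow> s i = 0 \<Longrightarrow> t i \<noteq> 1"
  obtains t where "t \<in> topspace (unit_cube n)" "Suc n \<le> card {V\<in>\<beta>. t \<in> V}"
proof -
  let ?Q = "topspace (unit_cube n)"
  have "compactin (unit_cube n) ?Q" using compact_space_unit_cube by (simp add: compact_space_def)
  then obtain E e where E: "finite E" "E \<subseteq> {..<n}" "0 < e"
    "\<And>x. x \<in> ?Q \<Longrightarrow> \<exists>V\<in>\<beta>. \<forall>y\<in>?Q. (\<forall>i\<in>E. dist (x i) (y i) < e) \<longrightarrow> y \<in> V"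
    using product_Lebesgue_number[of "{0..1::real}" "{..<n}" ?Q \<beta>] op cov
    unfolding unit_cube_def by (auto simp: subtopology_topspace simp del: topspace_product_topology)
  obtain p :: nat where p: "1 / e < p" using reals_Archimedean2 by blast
  then have p0: "0 < p" using E(3) by (metis less_trans of_nat_0_less_iff zero_less_divide_1_iff)
  have pe: "1 / p < e" using p p0 E(3) by (simp add: field_simps)
  define g where "g x = (\<lambda>i\<in>{..<n}. real (x i) / real p)" for x :: "nat \<Rightarrow> nat"
  have gQ: "g x \<in> ?Q" if "\<forall>i. x i \<le> p" for x
    using that p0 by (auto simp: g_def topspace_unit_cube)
  obtain V where V: "\<And>x. x \<in> ?Q \<Longrightarrow> V x \<in> \<beta> \<and> (\<forall>y\<in>?Q. (\<forall>i\<in>E. dist (x i) (y i) < e) \<longrightarrow> y \<in> V x)"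
    using E(4) by metis
  have Vself: "x \<in> V x" if "x \<in> ?Q" for x using V[OF that] that E(3) by auto
  define cls where "cls U = (LEAST i. i = n \<or> (\<exists>t\<in>U. t i = 1))" for U :: "(nat \<Rightarrow> real) set"
  have cls_le: "cls U \<le> i" if "i = n \<or> (\<exists>t\<in>U. t i = 1)" for U i unfolding cls_def using that by (rule Least_le)
  have cls: "cls U = n \<or> (\<exists>t\<in>U. t (cls U) = 1)" for U unfolding cls_def by (rule LeastI[of _ n]) simp
  define lam where "lam x = cls (V (g x))" for x
  have lam_n: "lam x \<le> n" for x unfolding lam_def by (rule cls_le) simp
  \<comment> \<open>A member containing a grid point with \<open>x j = 0\<close> meets the face at
    0, hence not the opposite one, so its label is not \<open>j\<close>.\<close>
  have lam0: "lam x \<noteq> j" if x: "\<forall>i. x i \<le> p" "j < n" "x j = 0" for x j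
  proof
    assume l: "lam x = j"
    then obtain t where t: "t \<in> V (g x)" "t j = 1" using cls[of "V (g x)"] x by (auto simp: lam_def)
    have "g x j = 0" using x by (simp add: g_def)
    then show False using faces[of "V (g x)" j "g x" t] V[OF gQ[OF x(1)]] Vself[OF gQ[OF x(1)]] t x by auto
  qed
  have lam1: "lam x \<le> j" if x: "\<forall>i. x i \<le> p" "j < n" "x j = p" for x j
  proof -
    have "g x j = 1" using x p0 by (simp add: g_def)
    then show ?thesis unfolding lam_def using Vself[OF gQ[OF x(1)]] by (intro cls_le) auto
  qed
  \<comment> \<open>\<open>reduced\<close> reads off the first nonzero entry below \<open>n\<close>,
    which is entry \<open>lam x\<close> (none if \<open>lam x = n\<close>). The entries after it are
    free and are set to meet Kuhn's two boundary conditions.\<close>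
  define lab where "lab x j = (if j < lam x then 0 else if j = lam x then 1 else if x j = 0 then 0 else (1::nat))" for x j
  have red: "reduced n (lab x) = lam x" for x
    by (rule reduced_labelling_unique) (use lam_n in \<open>auto simp: lab_def\<close>)
  have "odd (card {s. ksimplex p n s \<and> (reduced n \<circ> lab) ` s = {..n}})"
  proof (rule kuhn_combinatorial[OF p0])
    show "\<forall>x j. (\<forall>j. x j \<le> p) \<and> j < n \<and> x j = 0 \<longrightarrow> lab x j = 0" using lam0 by (auto simp: lab_def)
    show "\<forall>x j. (\<forall>j. x j \<le> p) \<and> j < n \<and> x j = p \<longrightarrow> lab x j = 1" 
    proof (intro allI impI)
      fix x j assume x: "(\<forall>j. x j \<le> p) \<and> j < n \<and> x j = p"
      then have "lam x \<le> j" using lam1[of x j] by simp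
      then show "lab x j = 1" using x p0 by (auto simp: lab_def)
    qed
  qed
  then have "{s. ksimplex p n s \<and> (reduced n \<circ> lab) ` s = {..n}} \<noteq> {}" by (rule odd_card_imp_not_empty)
  then obtain s b u where "kuhn_simplex p n b u s" and rl: "(reduced n \<circ> lab) ` s = {..n}"
    by (auto elim: ksimplex.cases)
  interpret kuhn_simplex p n b u s by fact
  have lp: "\<forall>i. x i \<le> p" if "x \<in> s" for x
    using that s_space out_eq_p[OF that] by (metis PiE_mem Pi_mem atMost_iff leI le_refl lessThan_iff subsetD)
  have bQ: "g b \<in> ?Q" using gQ lp base_in_s by blast
  \<comment> \<open>Every vertex of the small simplex is within one grid step of \<open>b\<close> in
    each coordinate, so \<open>g b\<close> lies in the members chosen for all vertices, and their
    labels exhaust \<open>{..n}\<close>.\<close>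
  have in_V: "g b \<in> V (g x)" if x: "x \<in> s" for x
  proof -
    have "dist (g x i) (g b i) < e" if "i \<in> E" for i
    proof -
      have i: "i < n" using that E(2) by auto
      have "b i \<le> x i" "x i \<le> Suc (b i)" using base_le[OF x] le_Suc_base[OF x] by auto
      then have "\<bar>real (x i) - real (b i)\<bar> \<le> 1" by auto
      then have "\<bar>real (x i) / p - real (b i) / p\<bar> \<le> 1 / p"
        using p0 by (simp add: diff_divide_distrib[symmetric] abs_divide divide_right_mono)
      then show ?thesis using pe i by (simp add: g_def dist_real_def)
    qed
    then show ?thesis using V[OF gQ[OF lp[OF x]]] bQ by blast
  qed
  have "{..n} \<subseteq> cls ` {U\<in>\<beta>. g b \<in> U}"
  proof
    fix j assume "j \<in> {..n}"
    then have "j \<in> (reduced n \<circ> lab) ` s" using rl by simp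
    then obtain x where x: "x \<in> s" "lam x = j" by (auto simp: red)
    then show "j \<in> cls ` {U\<in>\<beta>. g b \<in> U}" using in_V[OF x(1)] V[OF gQ[OF lp[OF x(1)]]] by (auto simp: lam_def)
  qed
  then have "card {..n} \<le> card (cls ` {U\<in>\<beta>. g b \<in> U})" using fin by (intro card_mono) auto
  also have "\<dots> \<le> card {U\<in>\<beta>. g b \<in> U}" using fin by (intro card_image_le) auto
  finally show ?thesis using that[OF bQ] by simp
qed

section \<open>The sum theorem and upper bounds for the covering dimension\<close>

definition covering_dim_le :: "'x topology \<Rightarrow> nat \<Rightarrow> bool" where
  "covering_dim_le X N \<longleftrightarrow> (\<forall>\<alpha>. finite_open_cover X \<alpha> \<longrightarrow> cover_D X \<alpha> \<le> int N)"

text \<open>Inside \<open>C\<close> each \<open>U\<close> is cut down to the union of the members of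
  a refinement of order \<open>N\<close> that are assigned to it; outside \<open>C\<close> it is
  kept. The result is open, being \<open>U\<close> minus the closed set \<open>C - W U\<close>.
  Indexing by \<open>\<alpha>\<close> prevents multiplicities elsewhere from growing.\<close>

lemma shrink_cover_on_closed:
  assumes C: "closedin X C" "covering_dim_le (subtopology X C) N" and \<alpha>: "finite_open_cover X \<alpha>"
  obtains \<beta> h where "finite_open_cover X \<beta>" "\<beta> = h ` \<alpha>" "\<And>U. U \<in> \<alpha> \<Longrightarrow> h U \<subseteq> U"
    "\<And>x. x \<in> C \<Longrightarrow> card {V\<in>\<beta>. x \<in> V} \<le> Suc N"
proof -
  have CX: "C \<subseteq> topspace X" using C(1) by (rule closedin_subset)
  let ?Y = "subtopology X C"
  have fc: "finite_open_cover ?Y ((\<lambda>U. U \<inter> C) ` \<alpha>)"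
    using \<alpha> CX by (auto simp: finite_open_cover_def openin_subtopology)
  then have "cover_D ?Y ((\<lambda>U. U \<inter> C) ` \<alpha>) \<le> int N" using C(2) unfolding covering_dim_le_def by blast
  then obtain \<gamma> where \<gamma>: "finite_open_cover ?Y \<gamma>" "refines_cover \<gamma> ((\<lambda>U. U \<inter> C) ` \<alpha>)"
    "\<forall>x\<in>topspace ?Y. card {U\<in>\<gamma>. x \<in> U} \<le> Suc N"
    unfolding cover_D_le_iff[OF fc, of N] by blast
  have "\<forall>V\<in>\<gamma>. \<exists>U\<in>\<alpha>. V \<subseteq> U \<inter> C" using \<gamma>(2) by (auto simp: refines_cover_def)
  then obtain \<psi> where \<psi>: "\<And>V. V \<in> \<gamma> \<Longrightarrow> \<psi> V \<in> \<alpha> \<and> V \<subseteq> \<psi> V \<inter> C" by metis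
  define W where "W U = \<Union>{V\<in>\<gamma>. \<psi> V = U}" for U
  define h where "h U = (U - C) \<union> W U" for U
  have WU: "W U \<subseteq> U \<inter> C" for U using \<psi> by (fastforce simp: W_def)
  show ?thesis
  proof (rule that[of "h ` \<alpha>" h])
    show "h U \<subseteq> U" for U using WU by (auto simp: h_def)
    show "finite_open_cover X (h ` \<alpha>)" unfolding finite_open_cover_def
    proof (intro conjI ballI)
      show "finite (h ` \<alpha>)" using \<alpha> by (simp add: finite_open_cover_def)
      fix A assume "A \<in> h ` \<alpha>"
      then obtain U where U: "U \<in> \<alpha>" "A = h U" by auto
      have "openin ?Y (W U)" unfolding W_def using \<gamma>(1) by (intro openin_Union) (auto simp: finite_open_cover_def)
      then have "closedin ?Y (C - W U)" using CX by (metis closedin_topspace openin_closedin_eq topspace_subtopology_subset)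
      then have "closedin X (C - W U)" using C(1) by (rule closedin_trans_full)
      moreover have "h U = U - (C - W U)" using WU by (auto simp: h_def)
      moreover have "openin X U" using \<alpha> U by (auto simp: finite_open_cover_def)
      ultimately show "openin X A" using U by (simp add: openin_diff)
    next
      have "x \<in> \<Union>(h ` \<alpha>)" if x: "x \<in> topspace X" for x
      proof (cases "x \<in> C")
        case True
        then have "x \<in> topspace ?Y" using x by simp
        then obtain V where "V \<in> \<gamma>" "x \<in> V" using \<gamma>(1) by (auto simp: finite_open_cover_def)
        then have "x \<in> h (\<psi> V)" "\<psi> V \<in> \<alpha>" using \<psi> by (auto simp: h_def W_def)
        then show ?thesis by blast
      next
        case False
        then obtain U where "U \<in> \<alpha>" "x \<in> U" using \<alpha> x by (auto simp: finite_open_cover_def)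
        then show ?thesis using False by (auto simp: h_def)
      qed
      moreover have "\<Union>(h ` \<alpha>) \<subseteq> \<Union>\<alpha>" using WU by (fastforce simp: h_def)
      ultimately show "\<Union>(h ` \<alpha>) = topspace X" using \<alpha> by (auto simp: finite_open_cover_def)
    qed
    fix x assume x: "x \<in> C"
    have f\<gamma>: "finite \<gamma>" using \<gamma>(1) by (simp add: finite_open_cover_def)
    have "{V \<in> h ` \<alpha>. x \<in> V} \<subseteq> (\<lambda>V. h (\<psi> V)) ` {V\<in>\<gamma>. x \<in> V}"
      using x by (auto simp: h_def W_def)
    then have "card {V \<in> h ` \<alpha>. x \<in> V} \<le> card ((\<lambda>V. h (\<psi> V)) ` {V\<in>\<gamma>. x \<in> V})"
      using f\<gamma> by (intro card_mono) auto
    also have "\<dots> \<le> card {V\<in>\<gamma>. x \<in> V}" using f\<gamma> by (intro card_image_le) auto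
    also have "\<dots> \<le> Suc N" using \<gamma>(3) x CX by auto
    finally show "card {V \<in> h ` \<alpha>. x \<in> V} \<le> Suc N" .
  qed simp
qed

text \<open>The finite sum theorem: shrink the cover over one closed piece after another. Shrinking
  never raises a multiplicity, so the bounds over earlier pieces survive.\<close>

lemma covering_dim_le_finite_closed_Union:
  assumes fin: "finite \<C>" and C: "\<And>C. C \<in> \<C> \<Longrightarrow> closedin X C \<and> covering_dim_le (subtopology X C) N"
    and U: "\<Union>\<C> = topspace X"
  shows "covering_dim_le X N"
  unfolding covering_dim_le_def
proof (intro allI impI)
  fix \<alpha> assume \<alpha>: "finite_open_cover X \<alpha>"
  have "\<exists>\<beta>. finite_open_cover X \<beta> \<and> refines_cover \<beta> \<alpha> \<and> (\<forall>x\<in>\<Union>\<C>. card {V\<in>\<beta>. x \<in> V} \<le> Suc N)"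
    using fin C
  proof (induction \<C>)
    case empty
    then show ?case using \<alpha> refines_cover_refl by auto
  next
    case (insert C \<C>)
    then obtain \<beta> where \<beta>: "finite_open_cover X \<beta>" "refines_cover \<beta> \<alpha>" "\<forall>x\<in>\<Union>\<C>. card {V\<in>\<beta>. x \<in> V} \<le> Suc N"
      by auto
    have "closedin X C" "covering_dim_le (subtopology X C) N" using insert.prems by auto
    then obtain \<beta>' h where \<beta>': "finite_open_cover X \<beta>'" "\<beta>' = h ` \<beta>" "\<And>U. U \<in> \<beta> \<Longrightarrow> h U \<subseteq> U"
      "\<And>x. x \<in> C \<Longrightarrow> card {V\<in>\<beta>'. x \<in> V} \<le> Suc N"
      by (rule shrink_cover_on_closed[OF _ _ \<beta>(1)]) (assumption | rule that)+
    have f: "finite \<beta>" using \<beta>(1) by (simp add: finite_open_cover_def)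
    have "refines_cover \<beta>' \<beta>" using \<beta>'(2,3) by (auto simp: refines_cover_def)
    then have "refines_cover \<beta>' \<alpha>" using \<beta>(2) by (rule refines_cover_trans)
    moreover have "card {V\<in>\<beta>'. x \<in> V} \<le> card {V\<in>\<beta>. x \<in> V}" for x
    proof -
      have "{V\<in>\<beta>'. x \<in> V} \<subseteq> h ` {V\<in>\<beta>. x \<in> V}" using \<beta>'(2,3) by auto
      then have "card {V\<in>\<beta>'. x \<in> V} \<le> card (h ` {V\<in>\<beta>. x \<in> V})" using f by (intro card_mono) auto
      also have "\<dots> \<le> card {V\<in>\<beta>. x \<in> V}" using f by (intro card_image_le) auto
      finally show ?thesis .
    qed
    then have "\<forall>x\<in>\<Union>\<C>. card {V\<in>\<beta>'. x \<in> V} \<le> Suc N" using \<beta>(3) order.trans by blast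
    ultimately show ?case using \<beta>'(1,4) by (intro exI[of _ \<beta>']) auto
  qed
  then show "cover_D X \<alpha> \<le> int N" using cover_D_le_iff[OF \<alpha>] U by auto
qed

text \<open>Open intervals of length \<open>2 * \<eta>\<close> that start at the multiples of
  \<open>\<eta>\<close> overlap at most in pairs.\<close>

lemma interval_cover:
  fixes \<eta> M :: real
  assumes "0 < \<eta>"
  obtains \<beta> where "finite_open_cover (top_of_set {-M..M}) \<beta>"
    "\<And>x. card {U\<in>\<beta>. x \<in> U} \<le> 2" "\<And>U x y. U \<in> \<beta> \<Longrightarrow> x \<in> U \<Longrightarrow> y \<in> U \<Longrightarrow> \<bar>x - y\<bar> < 2 * \<eta>"
proof -
  define I where "I k = {-M..M} \<inter> {real_of_int k * \<eta> <..< (real_of_int k + 2) * \<eta>}" for k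
  obtain L :: nat where L: "\<bar>M\<bar> / \<eta> < L" using reals_Archimedean2 by blast
  define K where "K = {- int L - 2 .. int L + 2}"
  show ?thesis
  proof (rule that[of "I ` K"])
    show "finite_open_cover (top_of_set {-M..M}) (I ` K)" unfolding finite_open_cover_def
    proof (intro conjI ballI)
      show "finite (I ` K)" by (simp add: K_def)
      show "openin (top_of_set {-M..M}) U" if "U \<in> I ` K" for U
        using that by (auto simp: I_def intro: openin_open_Int)
      have "x \<in> \<Union>(I ` K)" if x: "x \<in> {-M..M}" for x
      proof -
        define k where "k = \<lceil>x / \<eta>\<rceil> - 1"
        have k: "real_of_int k < x / \<eta>" "x / \<eta> \<le> real_of_int k + 1" unfolding k_def by linarith+
        have "\<bar>x / \<eta>\<bar> < L"
        proof -
          have "\<bar>x / \<eta>\<bar> = \<bar>x\<bar> / \<eta>" using assms by (simp add: abs_divide)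
          also have "\<dots> \<le> \<bar>M\<bar> / \<eta>" using x assms by (intro divide_right_mono) auto
          finally show ?thesis using L by simp
        qed
        then have "real_of_int k < real_of_int (int L)" "real_of_int (- int L - 1) < real_of_int k + 1"
          using k by (simp_all, linarith+)
        then have "k < int L" "- int L - 1 < k + 1" by linarith+
        then have "k \<in> K" unfolding K_def by auto
        moreover have "x \<in> I k" using k x assms by (auto simp: I_def field_simps)
        ultimately show ?thesis by blast
      qed
      then show "\<Union>(I ` K) = topspace (top_of_set {-M..M})" by (auto simp: I_def)
    qed
    show "\<bar>x - y\<bar> < 2 * \<eta>" if "U \<in> I ` K" "x \<in> U" "y \<in> U" for U x y
      using that by (auto simp: I_def algebra_simps abs_less_iff)
    fix x
    have "{U\<in>I ` K. x \<in> U} \<subseteq> I ` {\<lceil>x / \<eta>\<rceil> - 2, \<lceil>x / \<eta>\<rceil> - 1}"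
    proof
      fix U assume "U \<in> {U\<in>I ` K. x \<in> U}"
      then obtain k where k: "U = I k" "x \<in> I k" by auto
      then have "real_of_int k < x / \<eta>" "x / \<eta> < real_of_int k + 2" using assms by (auto simp: I_def field_simps)
      then have "k = \<lceil>x / \<eta>\<rceil> - 2 \<or> k = \<lceil>x / \<eta>\<rceil> - 1" by linarith
      then show "U \<in> I ` {\<lceil>x / \<eta>\<rceil> - 2, \<lceil>x / \<eta>\<rceil> - 1}" using k(1) by auto
    qed
    then have "card {U\<in>I ` K. x \<in> U} \<le> card (I ` {\<lceil>x / \<eta>\<rceil> - 2, \<lceil>x / \<eta>\<rceil> - 1})" by (intro card_mono) auto
    also have "\<dots> \<le> card {\<lceil>x / \<eta>\<rceil> - 2, \<lceil>x / \<eta>\<rceil> - 1}" by (intro card_image_le) auto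
    also have "\<dots> \<le> 2" by (simp add: card_insert_if)
    finally show "card {U\<in>I ` K. x \<in> U} \<le> 2" .
  qed
qed

text \<open>In orthonormal coordinates of the direction space of \<open>S\<close>, a cover by
  intervals that overlap in pairs contributes at most 1 to the rank per coordinate, and there are
  \<open>aff_dim S\<close> coordinates. Short intervals make the product cells smaller than a
  Lebesgue number of the cover.\<close>

lemma covering_dim_le_aff_dim:
  fixes S :: "'a::euclidean_space set"
  assumes S: "compact S" "aff_dim S \<le> int N"
  shows "covering_dim_le (top_of_set S) N"
  unfolding covering_dim_le_def
proof (intro allI impI)
  fix \<alpha> assume \<alpha>: "finite_open_cover (top_of_set S) \<alpha>"
  show "cover_D (top_of_set S) \<alpha> \<le> int N"
  proof (cases "S = {}")
    case True
    then show ?thesis using \<alpha> cover_D_le_iff[OF \<alpha>, of N] refines_cover_refl by auto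
  next
    case False
    then obtain a where a: "a \<in> S" by auto
    obtain B where B: "pairwise orthogonal B" "\<And>x. x \<in> B \<Longrightarrow> norm x = 1" "independent B"
      "card B = dim (span ((\<lambda>x. - a + x) ` S))" "span B = span ((\<lambda>x. - a + x) ` S)"
      using orthonormal_basis_subspace[OF subspace_span] by metis
    have fB: "finite B" using B(3) by (rule independent_imp_finite)
    have "aff_dim S = int (card B)" using aff_dim_eq_dim[of a S] a B(4) by (simp add: hull_inc dim_span)
    then have cB: "card B \<le> N" using S(2) by simp
    define \<O> where "\<O> = {U. open U \<and> S \<inter> U \<in> \<alpha>}"
    have cov: "S \<subseteq> \<Union>\<O>"
    proof
      fix x assume "x \<in> S"
      then obtain A where "A \<in> \<alpha>" "x \<in> A" "openin (top_of_set S) A" using \<alpha> by (auto simp: finite_open_cover_def)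
      then show "x \<in> \<Union>\<O>" by (auto simp: \<O>_def openin_open)
    qed
    then have ne: "\<O> \<noteq> {}" using a by auto
    have op: "open U" if "U \<in> \<O>" for U using that by (simp add: \<O>_def)
    obtain \<epsilon> where \<epsilon>: "0 < \<epsilon>" "\<And>T. T \<subseteq> S \<Longrightarrow> diameter T < \<epsilon> \<Longrightarrow> \<exists>U\<in>\<O>. T \<subseteq> U"
      by (rule Lebesgue_number_lemma[OF S(1) ne cov op]) (assumption | rule that)+
    \<comment> \<open>Differences within a product cell have norm at most
      \<open>card B * (2 * \<eta>)\<close>, which this keeps within \<open>\<epsilon> / 2\<close>;
      the summand 1 covers \<open>card B = 0\<close>.\<close>
    define \<eta> where "\<eta> = \<epsilon> / (4 * (real (card B) + 1))"
    have \<eta>: "0 < \<eta>" using \<epsilon>(1) by (simp add: \<eta>_def)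
    obtain M0 where M0: "\<And>x. x \<in> S \<Longrightarrow> norm x \<le> M0"
      using compact_imp_bounded[OF S(1)] unfolding bounded_iff by blast
    define M where "M = M0 + norm a"
    have M: "norm (x - a) \<le> M" if "x \<in> S" for x
      using norm_triangle_ineq4[of x a] M0[OF that] by (simp add: M_def)
    obtain \<beta> where \<beta>: "finite_open_cover (top_of_set {-M..M}) \<beta>"
      "\<And>x. card {U\<in>\<beta>. x \<in> U} \<le> 2" "\<And>U x y. U \<in> \<beta> \<Longrightarrow> x \<in> U \<Longrightarrow> y \<in> U \<Longrightarrow> \<bar>x - y\<bar> < 2 * \<eta>"
      using interval_cover[OF \<eta>, of M] by metis
    show ?thesis
    proof (rule cover_D_le_sum[where I=B and Y="top_of_set {-M..M}" and \<phi>="\<lambda>b x. (x - a) \<bullet> b" and \<beta>="\<lambda>_. \<beta>"])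
      show "normal_space (top_of_set S)" by (simp add: metrizable_imp_normal_space metrizable_space_subtopology metrizable_space_euclidean)
      show "finite_open_cover (top_of_set S) \<alpha>" "finite B" by fact+
      show "finite_open_cover (top_of_set {-M..M}) \<beta>" by fact
      show "continuous_map (top_of_set S) (top_of_set {-M..M}) (\<lambda>x. (x - a) \<bullet> b)" if b: "b \<in> B" for b
      proof -
        have "\<bar>(x - a) \<bullet> b\<bar> \<le> M" if "x \<in> S" for x
          using Cauchy_Schwarz_ineq2[of "x - a" b] M[OF that] B(2)[OF b] by simp
        then have "(\<lambda>x. (x - a) \<bullet> b) \<in> S \<rightarrow> {-M..M}" by (fastforce simp: abs_le_iff)
        moreover have "continuous_on S (\<lambda>x. (x - a) \<bullet> b)" by (intro continuous_intros)
        ultimately show ?thesis by (simp add: continuous_map_in_subtopology image_subset_iff_funcset)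
      qed
      show "(\<Sum>b\<in>B. card {U \<in> \<beta>. (x - a) \<bullet> b \<in> U} - 1) \<le> N" for x
      proof -
        have "(\<Sum>b\<in>B. card {U \<in> \<beta>. (x - a) \<bullet> b \<in> U} - 1) \<le> (\<Sum>b\<in>B. 1)"
        proof (rule sum_mono)
          fix b show "card {U \<in> \<beta>. (x - a) \<bullet> b \<in> U} - 1 \<le> 1" using \<beta>(2)[of "(x - a) \<bullet> b"] by linarith
        qed
        then show ?thesis using cB by simp
      qed
      fix U assume U: "\<And>b. b \<in> B \<Longrightarrow> U b \<in> \<beta>"
      define T where "T = {x \<in> topspace (top_of_set S). \<forall>b\<in>B. (x - a) \<bullet> b \<in> U b}"
      have "norm (x - y) \<le> \<epsilon> / 2" if xy: "x \<in> T" "y \<in> T" for x y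
      proof -
        have "x \<in> S" "y \<in> S" using xy by (auto simp: T_def)
        then have "- a + x \<in> span B" "- a + y \<in> span B" unfolding B(5) by (auto intro: span_base)
        then have "(- a + x) - (- a + y) \<in> span B" by (rule span_diff)
        then have "x - y \<in> span B" by simp
        then have "x - y = (\<Sum>b\<in>B. ((x - y) \<bullet> b) *\<^sub>R b)" using orthonormal_basis_expand[OF B(1,2) _ fB] by simp
        then have "norm (x - y) \<le> (\<Sum>b\<in>B. norm (((x - y) \<bullet> b) *\<^sub>R b))" by (metis norm_sum)
        also have "\<dots> \<le> (\<Sum>b\<in>B. 2 * \<eta>)"
        proof (rule sum_mono)
          fix b assume b: "b \<in> B"
          have "\<bar>(x - a) \<bullet> b - (y - a) \<bullet> b\<bar> < 2 * \<eta>"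
            using xy b U[OF b] by (intro \<beta>(3)[of "U b"]) (auto simp: T_def)
          moreover have "(x - a) \<bullet> b - (y - a) \<bullet> b = (x - y) \<bullet> b" by (simp add: inner_diff_left)
          ultimately show "norm (((x - y) \<bullet> b) *\<^sub>R b) \<le> 2 * \<eta>" using B(2)[OF b] by simp
        qed
        also have "\<dots> = \<epsilon> / 2 * (real (card B) / (real (card B) + 1))" by (simp add: \<eta>_def field_simps)
        also have "\<dots> \<le> \<epsilon> / 2" using \<epsilon>(1) by (intro mult_left_le) auto
        finally show ?thesis .
      qed
      then have "diameter T \<le> \<epsilon> / 2" using \<epsilon>(1) by (intro diameter_le) auto
      then have "diameter T < \<epsilon>" using \<epsilon>(1) by linarith
      moreover have TS: "T \<subseteq> S" by (auto simp: T_def)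
      ultimately obtain O' where "O' \<in> \<O>" "T \<subseteq> O'" using \<epsilon>(2) by blast
      then have "S \<inter> O' \<in> \<alpha>" "T \<subseteq> S \<inter> O'" using TS by (auto simp: \<O>_def)
      then show "\<exists>A\<in>\<alpha>. {x \<in> topspace (top_of_set S). \<forall>b\<in>B. (x - a) \<bullet> b \<in> U b} \<subseteq> A"
        by (intro bexI[of _ "S \<inter> O'"]) (auto simp: T_def)
    qed
  qed
qed

lemma covering_dim_le_imp_le:
  assumes "covering_dim_le X N"
  shows "covering_dim X \<le> ereal (real N)"
  unfolding covering_dim_def
proof (rule SUP_least)
  fix \<alpha> assume "\<alpha> \<in> {\<alpha>. finite_open_cover X \<alpha>}"
  then have "cover_D X \<alpha> \<le> int N" using assms by (simp add: covering_dim_le_def)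
  then show "ereal (real_of_int (cover_D X \<alpha>)) \<le> ereal (real N)" by simp
qed

lemma covering_dim_natE:
  assumes pos: "0 < covering_dim X" and fin: "covering_dim X < \<infinity>"
  obtains d where "0 < d" "covering_dim X = ereal (real d)" "covering_dim_le X d"
proof -
  obtain n :: nat where n: "covering_dim X < ereal (real n)" using fin less_PInf_Ex_of_nat by auto
  have "covering_dim_le X n" unfolding covering_dim_le_def
  proof (intro allI impI)
    fix \<alpha> assume "finite_open_cover X \<alpha>"
    then have "ereal (real_of_int (cover_D X \<alpha>)) \<le> covering_dim X" unfolding covering_dim_def by (intro SUP_upper) auto
    then have "ereal (real_of_int (cover_D X \<alpha>)) < ereal (real n)" using n by (rule le_less_trans)
    then show "cover_D X \<alpha> \<le> int n" by simp
  qed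
  define d where "d = (LEAST n. covering_dim_le X n)"
  have d: "covering_dim_le X d" unfolding d_def using \<open>covering_dim_le X n\<close> by (rule LeastI)
  have le: "covering_dim X \<le> ereal (real d)" using d by (rule covering_dim_le_imp_le)
  then have "0 < ereal (real d)" using pos by (rule less_le_trans[rotated])
  then have d0: "0 < d" by simp
  have "d - 1 < (LEAST n. covering_dim_le X n)" using d0 unfolding d_def by simp
  then have "\<not> covering_dim_le X (d - 1)" by (rule not_less_Least)
  then obtain \<alpha> where \<alpha>: "finite_open_cover X \<alpha>" "int (d - 1) < cover_D X \<alpha>" by (auto simp: covering_dim_le_def not_le)
  then have "real d \<le> real_of_int (cover_D X \<alpha>)" using d0 by linarith
  also have "ereal (real_of_int (cover_D X \<alpha>)) \<le> covering_dim X" unfolding covering_dim_def using \<alpha> by (intro SUP_upper) auto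
  finally have "ereal (real d) \<le> covering_dim X" by simp
  then show ?thesis using le d d0 by (intro that) auto
qed

text \<open>The point \<open>e t\<close> is the average of points on the \<open>d\<close> edges from
  a vertex \<open>v0\<close> to other vertices. Affine independence makes the edge directions
  linearly independent, so \<open>t\<close> can be read off.\<close>

lemma simplex_cube_embedding:
  fixes V :: "'a::euclidean_space set"
  assumes V: "finite V" "\<not> affine_dependent V" and d: "0 < d" "d < card V"
  obtains e where "continuous_map (unit_cube d) (top_of_set (convex hull V)) e" "inj_on e (topspace (unit_cube d))"
proof -
  obtain v0 where v0: "v0 \<in> V" using d by fastforce
  have "d \<le> card (V - {v0})" using d v0 V(1) by simp
  moreover obtain h where h: "bij_betw h {0..<card (V - {v0})} (V - {v0})"
    using ex_bij_betw_nat_finite[of "V - {v0}"] V(1) by auto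
  ultimately have hd: "inj_on h {..<d}" "h ` {..<d} \<subseteq> V - {v0}"
    by (auto simp: bij_betw_def inj_on_def)
  define e where "e t = (\<Sum>i<d. (1 / real d) *\<^sub>R ((1 - t i) *\<^sub>R v0 + t i *\<^sub>R h i))" for t :: "nat \<Rightarrow> real"
  have "continuous_map (unit_cube d) euclidean e" unfolding e_def
  proof (rule continuous_map_sum)
    fix i assume i: "i \<in> {..<d}"
    have "continuous_map (unit_cube d) (top_of_set {0..1::real}) (\<lambda>t. t i)"
      unfolding unit_cube_def using i by (intro continuous_map_product_projection) auto
    then have "continuous_map (unit_cube d) euclidean (\<lambda>t. t i)" by (rule continuous_map_into_fulltopology)
    moreover have "continuous_map euclidean euclidean (\<lambda>x::real. (1 / real d) *\<^sub>R ((1 - x) *\<^sub>R v0 + x *\<^sub>R h i))"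
      by (simp, intro continuous_intros)
    ultimately show "continuous_map (unit_cube d) euclidean (\<lambda>t. (1 / real d) *\<^sub>R ((1 - t i) *\<^sub>R v0 + t i *\<^sub>R h i))"
      using continuous_map_compose[of "unit_cube d" euclidean "\<lambda>t. t i" euclidean "\<lambda>x. (1 / real d) *\<^sub>R ((1 - x) *\<^sub>R v0 + x *\<^sub>R h i)"]
      by (simp add: o_def)
  qed simp
  moreover have "e t \<in> convex hull V" if t: "t \<in> topspace (unit_cube d)" for t
    unfolding e_def
  proof (rule convex_sum)
    show "(1 - t i) *\<^sub>R v0 + t i *\<^sub>R h i \<in> convex hull V" if "i \<in> {..<d}" for i
    proof (rule convexD_alt[OF convex_convex_hull])
      show "v0 \<in> convex hull V" "h i \<in> convex hull V" using v0 hd that by (auto intro: hull_inc)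
      show "0 \<le> t i" "t i \<le> 1" using t that by (auto simp: topspace_unit_cube PiE_iff)
    qed
  qed (use d in auto)
  ultimately have "continuous_map (unit_cube d) (top_of_set (convex hull V)) e"
    by (auto simp: continuous_map_in_subtopology)
  moreover have "inj_on e (topspace (unit_cube d))"
  proof (rule inj_onI)
    fix s t assume st: "s \<in> topspace (unit_cube d)" "t \<in> topspace (unit_cube d)" "e s = e t"
    define u where "u i = - v0 + h i" for i
    have inju: "inj_on u {..<d}" using hd(1) by (auto simp: inj_on_def u_def)
    have ind: "independent ((\<lambda>x. - v0 + x) ` (V - {v0}))"
      using affine_dependent_iff_dependent2[OF v0] V(2) by simp
    define c where "c x = (s (the_inv_into {..<d} u x) - t (the_inv_into {..<d} u x)) / real d" for x
    have "0 = e s - e t" using st by simp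
    also have "\<dots> = (\<Sum>i<d. ((s i - t i) / real d) *\<^sub>R u i)"
      unfolding e_def u_def sum_subtractf[symmetric] by (intro sum.cong refl) (simp add: algebra_simps diff_divide_distrib)
    also have "\<dots> = (\<Sum>i<d. c (u i) *\<^sub>R u i)"
      using inju by (intro sum.cong refl) (simp add: c_def the_inv_into_f_f)
    also have "\<dots> = (\<Sum>x\<in>u ` {..<d}. c x *\<^sub>R x)" using inju by (simp add: sum.reindex)
    finally have z: "(\<Sum>x\<in>u ` {..<d}. c x *\<^sub>R x) = 0" by simp
    have "u ` {..<d} \<subseteq> (\<lambda>x. - v0 + x) ` (V - {v0})" using hd(2) by (auto simp: u_def)
    then have "c (u i) = 0" if "i < d" for i using independentD[OF ind _ _ z] that by auto
    then have *: "s i = t i" if "i < d" for i using that inju d(1) by (simp add: c_def the_inv_into_f_f)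
    show "s = t"
      by (rule PiE_ext[of _ "{..<d}" "\<lambda>_. {0..1}"]) (use st * in \<open>auto simp: topspace_unit_cube\<close>)
  qed
  ultimately show ?thesis by (rule that)
qed

text \<open>If all simplices had dimension below \<open>d\<close>, the sum theorem would bound the
  covering dimension of \<open>P\<close> by \<open>d - 1\<close>; so some simplex has room for a
  \<open>d\<close>-cube.\<close>

lemma polyhedron_cube_embedding:
  fixes P :: "'a::euclidean_space set"
  assumes P: "simplicial_polyhedron P" and d: "0 < d" "covering_dim (top_of_set P) = ereal (real d)"
  obtains e where "continuous_map (unit_cube d) (top_of_set P) e" "inj_on e (topspace (unit_cube d))"
proof -
  obtain \<C> where \<C>: "simplicial_complex \<C>" "P = \<Union>\<C>" using P by (auto simp: simplicial_polyhedron_def)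
  have fin: "finite \<C>" "\<And>C. C \<in> \<C> \<Longrightarrow> \<exists>n. n simplex C" using \<C>(1) by (auto simp: simplicial_complex_def)
  have "\<exists>C\<in>\<C>. int d \<le> aff_dim C"
  proof (rule ccontr)
    assume "\<not> ?thesis"
    then have low: "aff_dim C \<le> int (d - 1)" if "C \<in> \<C>" for C using that d by force
    have "covering_dim_le (top_of_set P) (d - 1)"
    proof (rule covering_dim_le_finite_closed_Union[OF fin(1)])
      show "\<Union>\<C> = topspace (top_of_set P)" using \<C>(2) by simp
      fix C assume C: "C \<in> \<C>"
      have "compact C" using fin(2)[OF C] by (auto simp: simplex intro: finite_imp_compact_convex_hull)
      moreover have "C \<subseteq> P" using C \<C>(2) by auto
      moreover have "subtopology (top_of_set P) C = top_of_set C"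
        using \<open>C \<subseteq> P\<close> by (simp add: subtopology_subtopology Int_absorb1)
      ultimately show "closedin (top_of_set P) C \<and> covering_dim_le (subtopology (top_of_set P) C) (d - 1)"
        using covering_dim_le_aff_dim[OF _ low[OF C]] by (simp add: closed_subset compact_imp_closed)
    qed
    from covering_dim_le_imp_le[OF this] show False using d by simp
  qed
  then obtain C where C: "C \<in> \<C>" "int d \<le> aff_dim C" by blast
  then obtain V where V: "finite V" "\<not> affine_dependent V" "C = convex hull V"
    using fin(2)[OF C(1)] by (auto simp: simplex)
  have "d < card V" using C(2) V(3) aff_dim_affine_independent[OF V(2)] by (simp add: aff_dim_convex_hull)
  then obtain e where e: "continuous_map (unit_cube d) (top_of_set C) e" "inj_on e (topspace (unit_cube d))"
    using simplex_cube_embedding[OF V(1,2) d(1)] V(3) by metis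
  have "C \<subseteq> P" using C \<C>(2) by auto
  then have "continuous_map (unit_cube d) (top_of_set P) e" using e(1) by (auto simp: continuous_map_in_subtopology)
  then show ?thesis using e(2) by (rule that)
qed

text \<open>A member arises by choosing one face from each pair of opposite faces and removing its
  image, so it never meets both. Since \<open>e\<close> is injective, opposite faces have disjoint
  images, and each point survives some choice. This cover will witness the lower bound for mean
  dimension.\<close>

lemma face_separating_cover:
  assumes H: "Hausdorff_space X" and e: "continuous_map (unit_cube d) X e" "inj_on e (topspace (unit_cube d))"
  obtains \<U> where "finite_open_cover X \<U>"
    "\<And>U i s t. U \<in> \<U> \<Longrightarrow> i < d \<Longrightarrow> s \<in> topspace (unit_cube d) \<Longrightarrow> t \<in> topspace (unit_cube d) \<Longrightarrow>
       e s \<in> U \<Longrightarrow> e t \<in> U \<Longrightarrow> s i = 0 \<Longrightarrow> t i \<noteq> 1"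
proof -
  define Fc where "Fc i a = e ` {t\<in>topspace (unit_cube d). t i = a}" for i and a :: real
  have Fcl: "closedin X (Fc i a)" if "i < d" for i a
  proof -
    have "continuous_map (unit_cube d) (top_of_set {0..1::real}) (\<lambda>t. t i)"
      unfolding unit_cube_def using that by (intro continuous_map_product_projection) auto
    then have "continuous_map (unit_cube d) euclidean (\<lambda>t. t i)" by (rule continuous_map_into_fulltopology)
    then have "closedin (unit_cube d) {t\<in>topspace (unit_cube d). t i \<in> {a}}"
      by (rule closedin_continuous_map_preimage) simp
    then have "compactin (unit_cube d) {t\<in>topspace (unit_cube d). t i = a}"
      using closedin_compact_space[OF compact_space_unit_cube] by simp
    then show ?thesis unfolding Fc_def using image_compactin[OF _ e(1)] compactin_imp_closedin[OF H] by blast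
  qed
  define U where "U s = topspace X - (\<Union>i<d. Fc i (if i \<in> s then 0 else 1))" for s
  show ?thesis
  proof (rule that[of "U ` Pow {..<d}"])
    show "finite_open_cover X (U ` Pow {..<d})" unfolding finite_open_cover_def
    proof (intro conjI ballI)
      show "openin X A" if "A \<in> U ` Pow {..<d}" for A
        using that Fcl by (auto simp: U_def intro!: openin_diff closedin_Union)
      have "x \<in> U {i\<in>{..<d}. x \<notin> Fc i 0}" if "x \<in> topspace X" for x
      proof -
        have "x \<notin> Fc i 1" if "x \<in> Fc i 0" for i
        proof
          assume "x \<in> Fc i 1"
          then obtain s t where "s \<in> topspace (unit_cube d)" "t \<in> topspace (unit_cube d)" "e s = e t" "s i = 0" "t i = 1"
            using \<open>x \<in> Fc i 0\<close> by (auto simp: Fc_def)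
          then have "s = t" using e(2) by (auto dest: inj_onD)
          then show False using \<open>s i = 0\<close> \<open>t i = 1\<close> by simp
        qed
        then show ?thesis using that by (auto simp: U_def)
      qed
      moreover have "{i\<in>{..<d}. x \<notin> Fc i 0} \<in> Pow {..<d}" for x by auto
      ultimately have "topspace X \<subseteq> \<Union>(U ` Pow {..<d})" by (meson UN_I subsetI)
      moreover have "\<Union>(U ` Pow {..<d}) \<subseteq> topspace X" by (auto simp: U_def)
      ultimately show "\<Union>(U ` Pow {..<d}) = topspace X" by (rule equalityI[rotated])
    qed simp
    show "t i \<noteq> 1" if a: "A \<in> U ` Pow {..<d}" "i < d" "s \<in> topspace (unit_cube d)" "t \<in> topspace (unit_cube d)"
       "e s \<in> A" "e t \<in> A" "s i = 0" for A i s t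
    proof
      assume t: "t i = 1"
      obtain S where S: "A = U S" using a(1) by auto
      have "e s \<in> Fc i 0" "e t \<in> Fc i 1" using a t by (auto simp: Fc_def)
      moreover have "e s \<notin> Fc i (if i \<in> S then 0 else 1)" "e t \<notin> Fc i (if i \<in> S then 0 else 1)"
        using a(2,5,6) unfolding S U_def by blast+
      ultimately show False by (cases "i \<in> S") auto
    qed
  qed
qed

section \<open>The Ornstein--Weiss lemma\<close>

text \<open>Only the part of \<open>K F\<close> outside \<open>F\<close> is measured. For
  \<open>k\<close> in \<open>K\<close> this also controls \<open>F - k F\<close>, because
  \<open>F\<close> and \<open>k F\<close> have equal size.\<close>

definition invariant_set :: "('g, 'm) monoid_scheme \<Rightarrow> 'g set \<Rightarrow> real \<Rightarrow> 'g set \<Rightarrow> bool" where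
  "invariant_set G K \<delta> F \<longleftrightarrow> finite F \<and> F \<noteq> {} \<and> F \<subseteq> carrier G \<and>
     real (card ((K <#>\<^bsub>G\<^esub> F) - F)) \<le> \<delta> * real (card F)"

lemma real_le_sum: "a \<le> (\<Sum>i\<in>I. f i) \<Longrightarrow> real a \<le> (\<Sum>i\<in>I. real (f i))"
  by (simp flip: of_nat_sum)

lemma finite_set_mult: "finite K \<Longrightarrow> finite F \<Longrightarrow> finite (K <#>\<^bsub>G\<^esub> F)"
  by (auto simp: set_mult_def)

lemma set_mult_mono: "K \<subseteq> K' \<Longrightarrow> F \<subseteq> F' \<Longrightarrow> K <#>\<^bsub>G\<^esub> F \<subseteq> K' <#>\<^bsub>G\<^esub> F'"
  by (auto simp: set_mult_def)

lemma set_multI: "k \<in> K \<Longrightarrow> f \<in> F \<Longrightarrow> k \<otimes>\<^bsub>G\<^esub> f \<in> K <#>\<^bsub>G\<^esub> F"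
  by (auto simp: set_mult_def)

lemma invariant_set_mono:
  assumes "invariant_set G K' \<delta>' F" "K \<subseteq> K'" "\<delta>' \<le> \<delta>" "finite K'"
  shows "invariant_set G K \<delta> F"
proof -
  have "card ((K <#>\<^bsub>G\<^esub> F) - F) \<le> card ((K' <#>\<^bsub>G\<^esub> F) - F)"
    using assms set_mult_mono[OF assms(2) subset_refl, of G F]
    by (intro card_mono) (auto simp: invariant_set_def finite_set_mult)
  moreover have "\<delta>' * real (card F) \<le> \<delta> * real (card F)" using assms(3) by (simp add: mult_right_mono)
  ultimately show ?thesis using assms(1) unfolding invariant_set_def by linarith
qed

lemma invariant_set_card_mult:
  assumes "invariant_set G K \<delta> F" "finite K"
  shows "real (card (K <#>\<^bsub>G\<^esub> F)) \<le> (1 + \<delta>) * real (card F)"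
proof -
  have "finite F" using assms(1) by (simp add: invariant_set_def)
  have "card (K <#>\<^bsub>G\<^esub> F) \<le> card (F \<union> ((K <#>\<^bsub>G\<^esub> F) - F))"
    using \<open>finite F\<close> assms(2) finite_set_mult by (intro card_mono) auto
  also have "\<dots> \<le> card F + card ((K <#>\<^bsub>G\<^esub> F) - F)" by (rule card_Un_le)
  finally show ?thesis using assms(1) by (simp add: invariant_set_def algebra_simps)
qed

lemma folner_eventually_invariant:
  assumes "folner_sequence G F" "finite K" "K \<subseteq> carrier G" "0 < \<delta>"
  shows "\<forall>\<^sub>F n in sequentially. invariant_set G K \<delta> (F n)"
proof -
  have fin: "finite (F n)" "F n \<noteq> {}" "F n \<subseteq> carrier G" for n
    using assms(1) by (auto simp: folner_sequence_def)
  let ?d = "\<delta> / (real (card K) + 1)"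
  have "\<forall>\<^sub>F n in sequentially. \<forall>g\<in>K. real (card (sym_diff (F n) (g <#\<^bsub>G\<^esub> F n))) / real (card (F n)) < ?d"
  proof (rule eventually_ball_finite[OF assms(2)], rule ballI)
    fix g assume "g \<in> K"
    then have "(\<lambda>n. real (card (sym_diff (F n) (g <#\<^bsub>G\<^esub> F n))) / real (card (F n))) \<longlonglongrightarrow> 0"
      using assms(1,3) by (auto simp: folner_sequence_def)
    then show "\<forall>\<^sub>F n in sequentially. real (card (sym_diff (F n) (g <#\<^bsub>G\<^esub> F n))) / real (card (F n)) < ?d"
      using assms(4) by (intro order_tendstoD(2)) (auto intro!: divide_pos_pos)
  qed
  then show ?thesis
  proof (rule eventually_mono)
    fix n assume *: "\<forall>g\<in>K. real (card (sym_diff (F n) (g <#\<^bsub>G\<^esub> F n))) / real (card (F n)) < ?d"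
    have pos: "0 < card (F n)" using fin by (simp add: card_gt_0_iff)
    have fl: "finite (g <#\<^bsub>G\<^esub> F n)" for g using fin(1) by (auto simp: l_coset_def)
    have "(K <#>\<^bsub>G\<^esub> F n) - F n \<subseteq> (\<Union>g\<in>K. sym_diff (F n) (g <#\<^bsub>G\<^esub> F n))"
      by (auto simp: set_mult_def l_coset_def)
    then have "card ((K <#>\<^bsub>G\<^esub> F n) - F n) \<le> card (\<Union>g\<in>K. sym_diff (F n) (g <#\<^bsub>G\<^esub> F n))"
      using assms(2) fin fl by (intro card_mono) auto
    also have "\<dots> \<le> (\<Sum>g\<in>K. card (sym_diff (F n) (g <#\<^bsub>G\<^esub> F n)))" by (rule card_UN_le[OF assms(2)])
    finally have "real (card ((K <#>\<^bsub>G\<^esub> F n) - F n)) \<le> (\<Sum>g\<in>K. real (card (sym_diff (F n) (g <#\<^bsub>G\<^esub> F n))))"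
      by (rule real_le_sum)
    also have "\<dots> \<le> (\<Sum>g\<in>K. ?d * real (card (F n)))"
      using * pos by (intro sum_mono) (auto simp: field_simps intro: less_imp_le)
    also have "\<dots> = real (card K) * ?d * real (card (F n))" by simp
    also have "\<dots> \<le> \<delta> * real (card (F n))"
      using assms(4) by (intro mult_right_mono) (auto simp: field_simps)
    finally show "invariant_set G K \<delta> (F n)" using fin by (simp add: invariant_set_def)
  qed
qed

section \<open>Quasi-tilings of invariant sets\<close>

context group begin

lemma card_left_translate_inter:
  assumes "t \<in> carrier G" "B \<subseteq> carrier G" "finite A"
  shows "card {c\<in>B. t \<otimes> c \<in> A} \<le> card A"
proof (rule card_inj_on_le[where f="\<lambda>c. t \<otimes> c"])
  show "inj_on (\<lambda>c. t \<otimes> c) {c\<in>B. t \<otimes> c \<in> A}"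
    using assms by (intro inj_onI) (auto simp: subset_iff)
qed (use assms in auto)

lemma card_r_coset_eq: "T \<subseteq> carrier G \<Longrightarrow> c \<in> carrier G \<Longrightarrow> card (T #> c) = card T"
  by (intro bij_betw_same_card[symmetric, where f="\<lambda>t. t \<otimes> c"])
     (auto simp: bij_betw_def inj_on_def r_coset_def subset_iff)

lemma r_coset_finite: "finite T \<Longrightarrow> finite (T #> c)"
  by (auto simp: r_coset_def)

text \<open>Right translation commutes with left multiplication by \<open>K\<close>, so it carries
  the outer boundary of \<open>T\<close> to that of the translate.\<close>

lemma invariant_set_r_coset:
  assumes "invariant_set G K \<delta> T" "K \<subseteq> carrier G" "c \<in> carrier G"
  shows "invariant_set G K \<delta> (T #> c)"
proof -
  have T: "T \<subseteq> carrier G" "finite T" "T \<noteq> {}" using assms(1) by (auto simp: invariant_set_def)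
  have "(K <#> (T #> c)) - (T #> c) \<subseteq> ((K <#> T) - T) #> c"
  proof
    fix x assume x: "x \<in> (K <#> (T #> c)) - (T #> c)"
    then obtain k t where "k \<in> K" "t \<in> T" "x = k \<otimes> (t \<otimes> c)" by (auto simp: set_mult_def r_coset_def)
    moreover have "x = k \<otimes> t \<otimes> c" using calculation T assms by (simp add: m_assoc subset_iff)
    moreover have "k \<otimes> t \<notin> T" using x calculation by (auto simp: r_coset_def)
    ultimately have "k \<otimes> t \<in> (K <#> T) - T" "x = (k \<otimes> t) \<otimes> c" using set_multI[of k K t T G] by auto
    then show "x \<in> ((K <#> T) - T) #> c" unfolding r_coset_def by blast
  qed
  moreover have "((K <#> T) - T) #> c \<subseteq> (K <#> (T #> c)) - (T #> c)"
  proof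
    fix x assume x: "x \<in> ((K <#> T) - T) #> c"
    then obtain k t where kt: "k \<in> K" "t \<in> T" "x = k \<otimes> t \<otimes> c" "k \<otimes> t \<notin> T"
      by (auto simp: set_mult_def r_coset_def)
    have c: "k \<in> carrier G" "t \<in> carrier G" using kt T assms by auto
    have "x = k \<otimes> (t \<otimes> c)" using kt c assms by (simp add: m_assoc)
    moreover have "x \<notin> T #> c"
    proof
      assume "x \<in> T #> c"
      then obtain s where s: "s \<in> T" "x = s \<otimes> c" by (auto simp: r_coset_def)
      moreover have "s \<in> carrier G" using s T by auto
      ultimately have "s = k \<otimes> t" using kt(3) c assms(3) by simp
      then show False using kt s by simp
    qed
    ultimately show "x \<in> (K <#> (T #> c)) - (T #> c)" using kt by (auto simp: set_mult_def r_coset_def)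
  qed
  ultimately have "(K <#> (T #> c)) - (T #> c) = ((K <#> T) - T) #> c" by blast
  moreover have "(K <#> T) - T \<subseteq> carrier G" using assms T by (auto simp: set_mult_def)
  moreover have "T #> c \<subseteq> carrier G" using T assms by (auto simp: r_coset_def)
  moreover have "T #> c \<noteq> {}" using T by (auto simp: r_coset_def)
  ultimately show ?thesis
    using assms T by (simp add: invariant_set_def card_r_coset_eq r_coset_finite)
qed

text \<open>Add translates of \<open>T\<close> to \<open>\<P>\<close>, within the overlap bound,
  until the union is as large as possible. Then each translate inside \<open>F\<close> meets the
  union in a proportion of at least \<open>\<epsilon>\<close>. By the invariance of \<open>F\<close>
  and of the old tiles many translates lie inside \<open>F\<close> and avoid the old union, and
  double counting turns them into a gain of \<open>\<epsilon>\<^sup>2/2 * card F\<close>, unless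
  \<open>(1 - 2*\<epsilon>) * card F\<close> is reached. Overlap is measured only in total, by
  \<open>sum\<close>; this is the form in which tilings are applied.\<close>

lemma quasi_tiling_step:
  fixes \<epsilon> :: real
  assumes \<epsilon>: "0 < \<epsilon>" "\<epsilon> < 1/2"
    and T: "finite T" "T \<noteq> {}" "T \<subseteq> carrier G"
    and F: "finite F" "F \<noteq> {}" "F \<subseteq> carrier G"
    and inv: "invariant_set G T (\<epsilon> / (8 * card T)) F"
    and P: "\<P> \<subseteq> Pow F" "\<And>Q. Q \<in> \<P> \<Longrightarrow> invariant_set G (m_inv G ` T) (\<epsilon>/8) Q"
    and sum: "(1 - \<epsilon>) * (\<Sum>Q\<in>\<P>. real (card Q)) \<le> real (card (\<Union>\<P>))"
  obtains \<Q> where "\<P> \<subseteq> \<Q>" "\<Q> \<subseteq> Pow F" "\<And>Q. Q \<in> \<Q> - \<P> \<Longrightarrow> \<exists>c\<in>carrier G. Q = T #> c"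
    "(1 - \<epsilon>) * (\<Sum>Q\<in>\<Q>. real (card Q)) \<le> real (card (\<Union>\<Q>))"
    "min (real (card (\<Union>\<P>)) + \<epsilon>\<^sup>2/2 * card F) ((1 - 2*\<epsilon>) * card F) \<le> real (card (\<Union>\<Q>))"
proof -
  define S where "S = {\<Q>. \<P> \<subseteq> \<Q> \<and> \<Q> \<subseteq> Pow F \<and> (\<forall>Q\<in>\<Q>-\<P>. \<exists>c\<in>carrier G. Q = T #> c) \<and>
    (1 - \<epsilon>) * (\<Sum>Q\<in>\<Q>. real (card Q)) \<le> real (card (\<Union>\<Q>))}"
  have "finite S" using F by (intro finite_subset[of S "Pow (Pow F)"]) (auto simp: S_def)
  moreover have "\<P> \<in> S" using P sum by (auto simp: S_def)
  ultimately have "Max ((\<lambda>\<Q>. card (\<Union>\<Q>)) ` S) \<in> (\<lambda>\<Q>. card (\<Union>\<Q>)) ` S" by (intro Max_in) auto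
  then obtain \<Q> where \<Q>: "\<Q> \<in> S" "card (\<Union>\<Q>) = Max ((\<lambda>\<Q>. card (\<Union>\<Q>)) ` S)" by auto
  have max: "card (\<Union>\<R>) \<le> card (\<Union>\<Q>)" if "\<R> \<in> S" for \<R>
    using \<open>finite S\<close> that \<Q>(2) by simp
  define A where "A = \<Union>\<P>"
  define A' where "A' = \<Union>\<Q>"
  have QF: "\<Q> \<subseteq> Pow F" "\<P> \<subseteq> \<Q>" using \<Q>(1) by (auto simp: S_def)
  have fQ: "finite \<Q>" "finite \<P>" using QF F(1) by (meson finite_Pow_iff finite_subset)+
  have AF: "A \<subseteq> A'" "A' \<subseteq> F" using QF by (auto simp: A_def A'_def)
  have fA: "finite A'" "finite A" using AF F(1) by (meson finite_subset)+
  have cT: "0 < card T" using T by (simp add: card_gt_0_iff)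
  \<comment> \<open>A translate with less overlap could be added: it brings at least
    \<open>(1 - \<epsilon>) * card T\<close> new elements, so the overlap bound persists and the
    union grows.\<close>
  have key: "\<epsilon> * card T \<le> card ((T #> c) \<inter> A')" if c: "c \<in> carrier G" "T #> c \<subseteq> F" for c
  proof (rule ccontr)
    assume neg: "\<not> ?thesis"
    have cc: "card (T #> c) = card T" using card_r_coset_eq T c by simp
    have fT: "finite (T #> c)" using T by (simp add: r_coset_finite)
    have nin: "T #> c \<notin> \<Q>"
    proof
      assume "T #> c \<in> \<Q>"
      then have "(T #> c) \<inter> A' = T #> c" by (auto simp: A'_def)
      then show False using neg \<epsilon> cc cT by (simp add: mult_le_cancel_right2)
    qed
    have split: "card (T #> c) = card ((T #> c) \<inter> A') + card ((T #> c) - A')"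
      using fT by (metis Int_commute card_Diff_subset_Int card_mono finite_Int inf.cobounded2 le_add_diff_inverse)
    then have new: "(1 - \<epsilon>) * card T \<le> card ((T #> c) - A')" "0 < card ((T #> c) - A')"
    proof -
      have "real (card T) = card ((T #> c) \<inter> A') + card ((T #> c) - A')" using split cc by simp
      then show *: "(1 - \<epsilon>) * card T \<le> card ((T #> c) - A')" using neg by (simp add: algebra_simps)
      have "0 < (1 - \<epsilon>) * card T" using \<epsilon> cT by simp
      then show "0 < card ((T #> c) - A')" using * by linarith
    qed
    have un: "card (\<Union>(insert (T #> c) \<Q>)) = card A' + card ((T #> c) - A')"
    proof -
      have "\<Union>(insert (T #> c) \<Q>) = A' \<union> ((T #> c) - A')" by (auto simp: A'_def)
      moreover have "card (A' \<union> ((T #> c) - A')) = card A' + card ((T #> c) - A')"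
        using fA fT by (intro card_Un_disjoint) auto
      ultimately show ?thesis by simp
    qed
    have "(1 - \<epsilon>) * (\<Sum>Q\<in>\<Q>. real (card Q)) \<le> card A'" using \<Q>(1) by (simp add: S_def A'_def)
    then have "(1 - \<epsilon>) * (\<Sum>Q\<in>insert (T #> c) \<Q>. real (card Q)) \<le> real (card (\<Union>(insert (T #> c) \<Q>)))"
      using new(1) fQ nin unfolding un by (simp add: cc algebra_simps)
    then have "insert (T #> c) \<Q> \<in> S" using \<Q>(1) c by (auto simp: S_def)
    from max[OF this] show False using un new(2) by (simp add: A'_def)
  qed
  define B where "B = {c\<in>F. T #> c \<subseteq> F \<and> (T #> c) \<inter> A = {}}"
  have BF: "B \<subseteq> carrier G" "finite B" using F by (auto simp: B_def)
  \<comment> \<open>Count pairs \<open>(t, c)\<close> with \<open>t \<otimes> c\<close> in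
    \<open>A' - A\<close>: each \<open>c\<close> in \<open>B\<close> has at least
    \<open>\<epsilon> * card T\<close> of them, each \<open>t\<close> at most
    \<open>card (A' - A)\<close>.\<close>
  have "card B * (\<epsilon> * card T) \<le> (\<Sum>c\<in>B. real (card ((T #> c) \<inter> (A' - A))))"
  proof (rule sum_bounded_below)
    fix c assume c: "c \<in> B"
    then have "(T #> c) \<inter> A' = (T #> c) \<inter> (A' - A)" by (auto simp: B_def)
    then show "\<epsilon> * card T \<le> card ((T #> c) \<inter> (A' - A))" using key[of c] c BF by (auto simp: B_def)
  qed
  also have "(\<Sum>c\<in>B. real (card ((T #> c) \<inter> (A' - A)))) = (\<Sum>c\<in>B. \<Sum>t\<in>T. of_bool (t \<otimes> c \<in> A' - A))"
  proof (rule sum.cong[OF refl])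
    fix c assume "c \<in> B"
    then have "(T #> c) \<inter> (A' - A) = (\<lambda>t. t \<otimes> c) ` {t\<in>T. t \<otimes> c \<in> A' - A}" "inj_on (\<lambda>t. t \<otimes> c) T"
      using BF T \<open>c \<in> B\<close> by (auto simp: r_coset_def inj_on_def subset_iff)
    then have "card ((T #> c) \<inter> (A' - A)) = card {t\<in>T. t \<otimes> c \<in> A' - A}"
      by (metis (no_types, lifting) card_image inj_on_subset mem_Collect_eq subsetI)
    also have "real \<dots> = (\<Sum>t\<in>T. of_bool (t \<otimes> c \<in> A' - A))"
      using T by (simp add: sum.inter_filter of_bool_def if_distrib flip: sum.inter_filter)
    finally show "real (card ((T #> c) \<inter> (A' - A))) = (\<Sum>t\<in>T. of_bool (t \<otimes> c \<in> A' - A))" .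
  qed
  also have "\<dots> = (\<Sum>t\<in>T. \<Sum>c\<in>B. of_bool (t \<otimes> c \<in> A' - A))" by (rule sum.swap)
  also have "\<dots> = (\<Sum>t\<in>T. real (card {c\<in>B. t \<otimes> c \<in> A' - A}))"
    using BF by (intro sum.cong refl) (simp add: of_bool_def flip: sum.inter_filter)
  also have "\<dots> \<le> (\<Sum>t\<in>T. real (card (A' - A)))"
    using T BF fA by (intro sum_mono of_nat_mono card_left_translate_inter) auto
  also have "\<dots> = card T * card (A' - A)" by simp
  finally have b1: "\<epsilon> * card B \<le> card (A' - A)" using cT by (simp add: mult.assoc mult.left_commute)
  \<comment> \<open>The translate at a centre outside \<open>B\<close> leaves \<open>F\<close> or
    meets \<open>A\<close>. In the second case the centre lies in the product of the inverse of
    \<open>T\<close> with an old tile, and old tiles hardly grow under that product.\<close>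
  have "card F \<le> card B + card {c\<in>F. \<not> T #> c \<subseteq> F} + card {c\<in>F. (T #> c) \<inter> A \<noteq> {}}"
  proof -
    have "F \<subseteq> (B \<union> {c\<in>F. \<not> T #> c \<subseteq> F}) \<union> {c\<in>F. (T #> c) \<inter> A \<noteq> {}}" by (auto simp: B_def)
    then have "card F \<le> card ((B \<union> {c\<in>F. \<not> T #> c \<subseteq> F}) \<union> {c\<in>F. (T #> c) \<inter> A \<noteq> {}})"
      using F BF by (intro card_mono) auto
    then show ?thesis by (meson add_right_mono card_Un_le order.trans)
  qed
  moreover have "card {c\<in>F. \<not> T #> c \<subseteq> F} \<le> \<epsilon>/8 * card F"
  proof -
    have "{c\<in>F. \<not> T #> c \<subseteq> F} \<subseteq> (\<Union>t\<in>T. {c\<in>F. t \<otimes> c \<in> (T <#> F) - F})"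
      by (auto simp: r_coset_def set_mult_def)
    then have "card {c\<in>F. \<not> T #> c \<subseteq> F} \<le> card (\<Union>t\<in>T. {c\<in>F. t \<otimes> c \<in> (T <#> F) - F})"
      using F T by (intro card_mono) auto
    also have "\<dots> \<le> (\<Sum>t\<in>T. card {c\<in>F. t \<otimes> c \<in> (T <#> F) - F})" by (rule card_UN_le[OF T(1)])
    also have "\<dots> \<le> (\<Sum>t\<in>T. card ((T <#> F) - F))"
      using T F by (intro sum_mono card_left_translate_inter) (auto intro: finite_set_mult)
    finally have "real (card {c\<in>F. \<not> T #> c \<subseteq> F}) \<le> card T * real (card ((T <#> F) - F))"
      by (simp flip: of_nat_mult)
    also have "\<dots> \<le> card T * (\<epsilon> / (8 * card T) * card F)"
      using inv by (intro mult_left_mono) (auto simp: invariant_set_def)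
    also have "\<dots> = \<epsilon>/8 * card F" using cT by simp
    finally show ?thesis .
  qed
  moreover have "(1 - \<epsilon>) * card {c\<in>F. (T #> c) \<inter> A \<noteq> {}} \<le> (1 + \<epsilon>/8) * card A"
  proof -
    have "{c\<in>F. (T #> c) \<inter> A \<noteq> {}} \<subseteq> (\<Union>Q\<in>\<P>. (m_inv G ` T) <#> Q)"
    proof
      fix c assume "c \<in> {c\<in>F. (T #> c) \<inter> A \<noteq> {}}"
      then obtain t Q where t: "t \<in> T" "Q \<in> \<P>" "t \<otimes> c \<in> Q" "c \<in> F" by (auto simp: r_coset_def A_def)
      then have "t \<in> carrier G" "c \<in> carrier G" using T F by auto
      then have "c = inv t \<otimes> (t \<otimes> c)" by (simp add: m_assoc[symmetric])
      then show "c \<in> (\<Union>Q\<in>\<P>. (m_inv G ` T) <#> Q)" using t by (auto simp: set_mult_def)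
    qed
    then have "card {c\<in>F. (T #> c) \<inter> A \<noteq> {}} \<le> card (\<Union>Q\<in>\<P>. (m_inv G ` T) <#> Q)"
      using T fQ P F by (intro card_mono) (auto intro!: finite_set_mult dest: finite_subset)
    also have "\<dots> \<le> (\<Sum>Q\<in>\<P>. card ((m_inv G ` T) <#> Q))" by (rule card_UN_le[OF fQ(2)])
    finally have "real (card {c\<in>F. (T #> c) \<inter> A \<noteq> {}}) \<le> (\<Sum>Q\<in>\<P>. real (card ((m_inv G ` T) <#> Q)))"
      by (rule real_le_sum)
    also have "\<dots> \<le> (\<Sum>Q\<in>\<P>. (1 + \<epsilon>/8) * real (card Q))"
      using P T by (intro sum_mono invariant_set_card_mult) auto
    also have "\<dots> = (1 + \<epsilon>/8) * (\<Sum>Q\<in>\<P>. real (card Q))" by (simp add: sum_distrib_left)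
    finally have "(1 - \<epsilon>) * card {c\<in>F. (T #> c) \<inter> A \<noteq> {}} \<le> (1 - \<epsilon>) * ((1 + \<epsilon>/8) * (\<Sum>Q\<in>\<P>. real (card Q)))"
      using \<epsilon> by (intro mult_left_mono) auto
    also have "\<dots> = (1 + \<epsilon>/8) * ((1 - \<epsilon>) * (\<Sum>Q\<in>\<P>. real (card Q)))" by (simp only: mult.left_commute)
    also have "\<dots> \<le> (1 + \<epsilon>/8) * card A" using sum \<epsilon> by (intro mult_left_mono) (auto simp: A_def)
    finally show ?thesis .
  qed
  ultimately have b2: "(1 - \<epsilon>) * card F \<le> (1 - \<epsilon>) * card B + (1 - \<epsilon>) * (\<epsilon>/8 * card F) + (1 + \<epsilon>/8) * card A"
  proof -
    assume 1: "card F \<le> card B + card {c\<in>F. \<not> T #> c \<subseteq> F} + card {c\<in>F. (T #> c) \<inter> A \<noteq> {}}"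
      and 2: "card {c\<in>F. \<not> T #> c \<subseteq> F} \<le> \<epsilon>/8 * card F"
      and 3: "(1 - \<epsilon>) * card {c\<in>F. (T #> c) \<inter> A \<noteq> {}} \<le> (1 + \<epsilon>/8) * card A"
    have "(1 - \<epsilon>) * card F \<le> (1 - \<epsilon>) * (real (card B) + \<epsilon>/8 * card F + card {c\<in>F. (T #> c) \<inter> A \<noteq> {}})"
      using 1 2 \<epsilon> by (intro mult_left_mono) linarith+
    then show ?thesis using 3 by (simp add: algebra_simps)
  qed
  have cA: "real (card A') = card A + card (A' - A)"
    using AF fA by (metis card_Diff_subset card_mono le_add_diff_inverse of_nat_add)
  have "min (real (card A) + \<epsilon>\<^sup>2/2 * card F) ((1 - 2*\<epsilon>) * card F) \<le> real (card A')"
  proof (cases "(1 - 2*\<epsilon>) * card F \<le> card A")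
    case True
    then show ?thesis using cA by linarith
  next
    case False
    then have "(1 + \<epsilon>/8) * card A \<le> (1 + \<epsilon>/8) * ((1 - 2*\<epsilon>) * card F)"
      using \<epsilon> by (intro mult_left_mono) auto
    then have "(1 - \<epsilon>) * card F - (1 - \<epsilon>) * (\<epsilon>/8 * card F) - (1 + \<epsilon>/8) * ((1 - 2*\<epsilon>) * card F) \<le> (1 - \<epsilon>) * card B"
      using b2 by linarith
    \<comment> \<open>The errors \<open>\<epsilon>/8\<close> are small against the gap between
      \<open>1 - 2*\<epsilon>\<close> and \<open>1 - \<epsilon>\<close>, so half of that gap is left
      for \<open>B\<close>.\<close>
    moreover have "(1 - \<epsilon>) * (\<epsilon>/2 * card F) \<le> (1 - \<epsilon>) * card F - (1 - \<epsilon>) * (\<epsilon>/8 * card F) - (1 + \<epsilon>/8) * ((1 - 2*\<epsilon>) * card F)"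
    proof -
      have "(1 - \<epsilon>) * card F - (1 - \<epsilon>) * (\<epsilon>/8 * card F) - (1 + \<epsilon>/8) * ((1 - 2*\<epsilon>) * card F) - (1 - \<epsilon>) * (\<epsilon>/2 * card F)
        = (\<epsilon>/4 + \<epsilon>*\<epsilon>*7/8) * real (card F)" by (simp add: field_simps)
      moreover have "0 \<le> \<dots>" using \<epsilon> by simp
      ultimately show ?thesis by linarith
    qed
    ultimately have "(1 - \<epsilon>) * (\<epsilon>/2 * card F) \<le> (1 - \<epsilon>) * card B" by linarith
    then have "\<epsilon>/2 * card F \<le> card B" using \<epsilon> by (subst (asm) mult_le_cancel_left_pos) auto
    then have "\<epsilon> * (\<epsilon>/2 * card F) \<le> \<epsilon> * card B" using \<epsilon> by (intro mult_left_mono) auto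
    then have "\<epsilon>\<^sup>2/2 * card F \<le> card (A' - A)" using b1 by (simp add: power2_eq_square)
    then show ?thesis using cA by linarith
  qed
  then show ?thesis using \<Q>(1) by (intro that[of \<Q>]) (auto simp: S_def A_def A'_def)
qed

text \<open>Shapes are placed one at a time, each gaining a fixed proportion, so finitely many
  suffice. Tiles already placed must be invariant under the inverse of the next shape; hence the
  shape placed last is chosen first, and \<open>F\<close> has to be invariant under all of
  them.\<close>

lemma quasi_tiling:
  fixes \<T> :: "'a set set" and \<epsilon> :: real
  assumes \<epsilon>: "0 < \<epsilon>" "\<epsilon> < 1/2"
    and avail: "\<And>K \<delta>. finite K \<Longrightarrow> K \<subseteq> carrier G \<Longrightarrow> 0 < \<delta> \<Longrightarrow> \<exists>T\<in>\<T>. invariant_set G K \<delta> T"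
  obtains K \<delta> where "finite K" "K \<subseteq> carrier G" "0 < \<delta>"
    "\<And>F. invariant_set G K \<delta> F \<Longrightarrow> \<exists>\<P>\<subseteq>Pow F. (\<forall>Q\<in>\<P>. \<exists>T\<in>\<T>. \<exists>c\<in>carrier G. Q = T #> c) \<and>
      (1 - \<epsilon>) * (\<Sum>Q\<in>\<P>. real (card Q)) \<le> real (card (\<Union>\<P>)) \<and> (1 - 2*\<epsilon>) * card F \<le> real (card (\<Union>\<P>))"
proof -
  \<comment> \<open>The invariance \<open>K0\<close>, \<open>\<delta>0\<close> demanded of all tiles
    is left arbitrary, since the induction adjoins the inverse of the newly chosen shape to
    it.\<close>
  have *: "\<exists>K \<delta>. finite K \<and> K \<subseteq> carrier G \<and> 0 < \<delta> \<and> (\<forall>F. invariant_set G K \<delta> F \<longrightarrow>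
      (\<exists>\<P>\<subseteq>Pow F. (\<forall>Q\<in>\<P>. invariant_set G K0 \<delta>0 Q \<and> (\<exists>T\<in>\<T>. \<exists>c\<in>carrier G. Q = T #> c)) \<and>
      (1 - \<epsilon>) * (\<Sum>Q\<in>\<P>. real (card Q)) \<le> real (card (\<Union>\<P>)) \<and>
      min (j * (\<epsilon>\<^sup>2/2)) (1 - 2*\<epsilon>) * card F \<le> real (card (\<Union>\<P>))))"
    if "finite K0" "K0 \<subseteq> carrier G" "0 < \<delta>0" for j :: nat and K0 \<delta>0
    using that
  proof (induction j arbitrary: K0 \<delta>0)
    case 0
    show ?case
      by (rule exI[of _ "{}"], rule exI[of _ 1]) (use \<epsilon> in \<open>auto intro!: exI[of _ "{}"]\<close>)
  next
    case (Suc j)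
    obtain T where T: "T \<in> \<T>" "invariant_set G K0 \<delta>0 T" using avail Suc.prems by blast
    have Tf: "finite T" "T \<noteq> {}" "T \<subseteq> carrier G" using T(2) by (auto simp: invariant_set_def)
    have cT: "0 < card T" using Tf by (simp add: card_gt_0_iff)
    have Kf: "finite (K0 \<union> m_inv G ` T)" "K0 \<union> m_inv G ` T \<subseteq> carrier G" "0 < min \<delta>0 (\<epsilon>/8)"
      using Suc.prems Tf \<epsilon> by auto
    obtain K \<delta> where K: "finite K" "K \<subseteq> carrier G" "0 < \<delta>" and
      IH: "\<And>F. invariant_set G K \<delta> F \<Longrightarrow> \<exists>\<P>\<subseteq>Pow F. (\<forall>Q\<in>\<P>. invariant_set G (K0 \<union> m_inv G ` T) (min \<delta>0 (\<epsilon>/8)) Q \<and>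
        (\<exists>T\<in>\<T>. \<exists>c\<in>carrier G. Q = T #> c)) \<and>
      (1 - \<epsilon>) * (\<Sum>Q\<in>\<P>. real (card Q)) \<le> real (card (\<Union>\<P>)) \<and>
      min (j * (\<epsilon>\<^sup>2/2)) (1 - 2*\<epsilon>) * card F \<le> real (card (\<Union>\<P>))"
      using Suc.IH[OF Kf] by blast
    let ?K = "K \<union> T" and ?\<delta> = "min \<delta> (\<epsilon> / (8 * card T))"
    show ?case
    proof (rule exI[of _ ?K], rule exI[of _ ?\<delta>], intro conjI allI impI)
      show "finite ?K" "?K \<subseteq> carrier G" "0 < ?\<delta>" using K Tf \<epsilon> cT by auto
      fix F assume F: "invariant_set G ?K ?\<delta> F"
      have F1: "invariant_set G K \<delta> F" "invariant_set G T (\<epsilon> / (8 * card T)) F"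
        using invariant_set_mono[OF F, of K \<delta>] invariant_set_mono[OF F, of T "\<epsilon> / (8 * card T)"] K Tf by auto
      have Ff: "finite F" "F \<noteq> {}" "F \<subseteq> carrier G" using F by (auto simp: invariant_set_def)
      obtain \<P> where P: "\<P> \<subseteq> Pow F" "\<forall>Q\<in>\<P>. invariant_set G (K0 \<union> m_inv G ` T) (min \<delta>0 (\<epsilon>/8)) Q \<and>
          (\<exists>T\<in>\<T>. \<exists>c\<in>carrier G. Q = T #> c)"
        "(1 - \<epsilon>) * (\<Sum>Q\<in>\<P>. real (card Q)) \<le> real (card (\<Union>\<P>))"
        "min (j * (\<epsilon>\<^sup>2/2)) (1 - 2*\<epsilon>) * card F \<le> real (card (\<Union>\<P>))"
        using IH[OF F1(1)] by blast
      have Pi: "invariant_set G (m_inv G ` T) (\<epsilon>/8) Q" "invariant_set G K0 \<delta>0 Q" if "Q \<in> \<P>" for Q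
        using P(2) that Kf(1) by (auto intro: invariant_set_mono)
      obtain \<Q> where Q: "\<P> \<subseteq> \<Q>" "\<Q> \<subseteq> Pow F" "\<And>Q. Q \<in> \<Q> - \<P> \<Longrightarrow> \<exists>c\<in>carrier G. Q = T #> c"
        "(1 - \<epsilon>) * (\<Sum>Q\<in>\<Q>. real (card Q)) \<le> real (card (\<Union>\<Q>))"
        "min (real (card (\<Union>\<P>)) + \<epsilon>\<^sup>2/2 * card F) ((1 - 2*\<epsilon>) * card F) \<le> real (card (\<Union>\<Q>))"
        by (rule quasi_tiling_step[OF \<epsilon> Tf Ff F1(2) P(1) Pi(1) P(3)]) (assumption | rule that)+
      have "min (real (Suc j) * (\<epsilon>\<^sup>2/2)) (1 - 2*\<epsilon>) * card F \<le> real (card (\<Union>\<Q>))"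
      proof -
        have 1: "min (real (Suc j) * (\<epsilon>\<^sup>2/2)) (1 - 2*\<epsilon>) \<le> min (j * (\<epsilon>\<^sup>2/2)) (1 - 2*\<epsilon>) + \<epsilon>\<^sup>2/2"
        proof -
          have "real (Suc j) * (\<epsilon>\<^sup>2/2) = j * (\<epsilon>\<^sup>2/2) + \<epsilon>\<^sup>2/2" by (simp add: field_simps)
          moreover have "0 \<le> \<epsilon>\<^sup>2/2" by simp
          ultimately show ?thesis by linarith
        qed
        have "min (real (Suc j) * (\<epsilon>\<^sup>2/2)) (1 - 2*\<epsilon>) * card F \<le> (min (j * (\<epsilon>\<^sup>2/2)) (1 - 2*\<epsilon>) + \<epsilon>\<^sup>2/2) * card F"
          using 1 by (rule mult_right_mono) simp
        also have "\<dots> \<le> real (card (\<Union>\<P>)) + \<epsilon>\<^sup>2/2 * card F" using P(4) by (simp add: distrib_right)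
        finally have a: "min (real (Suc j) * (\<epsilon>\<^sup>2/2)) (1 - 2*\<epsilon>) * card F \<le> real (card (\<Union>\<P>)) + \<epsilon>\<^sup>2/2 * card F" .
        have b: "min (real (Suc j) * (\<epsilon>\<^sup>2/2)) (1 - 2*\<epsilon>) * card F \<le> (1 - 2*\<epsilon>) * card F"
          by (intro mult_right_mono) auto
        show ?thesis using a b Q(5) by linarith
      qed
      moreover have "invariant_set G K0 \<delta>0 Q \<and> (\<exists>T\<in>\<T>. \<exists>c\<in>carrier G. Q = T #> c)" if "Q \<in> \<Q>" for Q
      proof (cases "Q \<in> \<P>")
        case True then show ?thesis using P(2) Pi by blast
      next
        case False
        then show ?thesis using Q(3)[of Q] that T invariant_set_r_coset[OF T(2) Suc.prems(2)] by blast
      qed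
      ultimately show "\<exists>\<P>\<subseteq>Pow F. (\<forall>Q\<in>\<P>. invariant_set G K0 \<delta>0 Q \<and> (\<exists>T\<in>\<T>. \<exists>c\<in>carrier G. Q = T #> c)) \<and>
        (1 - \<epsilon>) * (\<Sum>Q\<in>\<P>. real (card Q)) \<le> real (card (\<Union>\<P>)) \<and>
        min (real (Suc j) * (\<epsilon>\<^sup>2/2)) (1 - 2*\<epsilon>) * card F \<le> real (card (\<Union>\<P>))"
        using Q(2,4) by blast
    qed
  qed
  \<comment> \<open>More than \<open>2 / \<epsilon>\<^sup>2\<close> rounds are enough: the
    guaranteed gains then exceed the cap \<open>1 - 2*\<epsilon>\<close>.\<close>
  obtain j :: nat where "1 / (\<epsilon>\<^sup>2/2) < j" using reals_Archimedean2 by blast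
  then have "1 < j * (\<epsilon>\<^sup>2/2)" using \<epsilon> by (simp add: field_simps)
  then have j: "min (j * (\<epsilon>\<^sup>2/2)) (1 - 2*\<epsilon>) = 1 - 2*\<epsilon>" using \<epsilon> by auto
  obtain K \<delta> where K: "finite K" "K \<subseteq> carrier G" "0 < \<delta>" and *: "\<And>F. invariant_set G K \<delta> F \<Longrightarrow>
      (\<exists>\<P>\<subseteq>Pow F. (\<forall>Q\<in>\<P>. invariant_set G {} 1 Q \<and> (\<exists>T\<in>\<T>. \<exists>c\<in>carrier G. Q = T #> c)) \<and>
      (1 - \<epsilon>) * (\<Sum>Q\<in>\<P>. real (card Q)) \<le> real (card (\<Union>\<P>)) \<and>
      (1 - 2*\<epsilon>) * card F \<le> real (card (\<Union>\<P>)))"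
    using *[of "{}" 1 j] unfolding j by auto
  show ?thesis
  proof (rule that[OF K])
    fix F assume "invariant_set G K \<delta> F"
    from *[OF this] show "\<exists>\<P>\<subseteq>Pow F. (\<forall>Q\<in>\<P>. \<exists>T\<in>\<T>. \<exists>c\<in>carrier G. Q = T #> c) \<and>
      (1 - \<epsilon>) * (\<Sum>Q\<in>\<P>. real (card Q)) \<le> real (card (\<Union>\<P>)) \<and> (1 - 2*\<epsilon>) * card F \<le> real (card (\<Union>\<P>))"
      by (elim ex_forward) simp
  qed
qed

text \<open>If the ratios along one Folner sequence are often below \<open>l\<close>, its sets serve
  as tiles. A sufficiently invariant set is covered by tiles of total size at most
  \<open>1 / (1 - \<epsilon>)\<close> times its own and a remainder of proportion
  \<open>2 * \<epsilon>\<close>, on which \<open>h\<close> is at most \<open>C\<close> per element.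
  So along every Folner sequence the ratios are eventually below \<open>l\<close>, up to a small
  error.\<close>

theorem ornstein_weiss:
  fixes h :: "'a set \<Rightarrow> real"
  assumes nonneg: "\<And>A. finite A \<Longrightarrow> A \<subseteq> carrier G \<Longrightarrow> 0 \<le> h A"
    and empty: "h {} = 0"
    and sub: "\<And>A B. finite A \<Longrightarrow> A \<subseteq> carrier G \<Longrightarrow> finite B \<Longrightarrow> B \<subseteq> carrier G \<Longrightarrow> h (A \<union> B) \<le> h A + h B"
    and inv: "\<And>A g. finite A \<Longrightarrow> A \<subseteq> carrier G \<Longrightarrow> g \<in> carrier G \<Longrightarrow> h (A #> g) = h A"
  shows "\<exists>L. \<forall>F. folner_sequence G F \<longrightarrow> (\<lambda>n. h (F n) / card (F n)) \<longlonglongrightarrow> L"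
proof -
  define C where "C = h {\<one>}"
  have C0: "0 \<le> C" unfolding C_def by (intro nonneg) auto
  have sing: "h {g} = C" if "g \<in> carrier G" for g
    using inv[of "{\<one>}" g] that by (simp add: C_def r_coset_def)
  have hC: "h A \<le> C * card A" if "finite A" "A \<subseteq> carrier G" for A
    using that
  proof (induction A)
    case (insert a A)
    then have "h ({a} \<union> A) \<le> h {a} + h A" by (intro sub) auto
    then show ?case using insert sing[of a] by (simp add: algebra_simps)
  qed (simp add: empty)
  have union: "h (\<Union>\<P> \<union> B) \<le> (\<Sum>Q\<in>\<P>. h Q) + h B"
    if "finite \<P>" "finite B" "B \<subseteq> carrier G" "\<And>Q. Q \<in> \<P> \<Longrightarrow> finite Q \<and> Q \<subseteq> carrier G" for \<P> B
    using that(1,4)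
  proof (induction \<P>)
    case (insert Q \<P>)
    have "h (Q \<union> (\<Union>\<P> \<union> B)) \<le> h Q + h (\<Union>\<P> \<union> B)" using insert that by (intro sub) auto
    then show ?case using insert by (simp add: Un_assoc)
  qed simp
  have claim: "\<forall>\<^sub>F n in sequentially. h (F n) / card (F n) \<le> l / (1 - \<epsilon>) + C * (2*\<epsilon>)"
    if F: "folner_sequence G F" and F': "folner_sequence G F'"
      and fr: "\<exists>\<^sub>F n in sequentially. h (F' n) / card (F' n) < l" and \<epsilon>: "0 < \<epsilon>" "\<epsilon> < 1/2"
    for F F' l \<epsilon>
  proof -
    define \<T> where "\<T> = {F' n |n. h (F' n) / card (F' n) < l}"
    have Tf: "finite T" "T \<noteq> {}" "T \<subseteq> carrier G" "h T \<le> l * card T" if T: "T \<in> \<T>" for T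
    proof -
      obtain n where n: "T = F' n" "h (F' n) / card (F' n) < l" using T by (auto simp: \<T>_def)
      then show *: "finite T" "T \<noteq> {}" "T \<subseteq> carrier G" using F' by (auto simp: folner_sequence_def)
      then have "0 < real (card T)" by (simp add: card_gt_0_iff)
      then show "h T \<le> l * card T" using n by (simp add: field_simps)
    qed
    have avail: "\<exists>T\<in>\<T>. invariant_set G K \<delta> T" if "finite K" "K \<subseteq> carrier G" "0 < \<delta>" for K \<delta>
    proof -
      from frequently_eventually_frequently[OF fr folner_eventually_invariant[OF F' that]]
      obtain n where "h (F' n) / card (F' n) < l" "invariant_set G K \<delta> (F' n)"
        by (auto dest: frequently_ex)
      then show ?thesis by (auto simp: \<T>_def)
    qed
    have l0: "0 \<le> l"
    proof -
      obtain n where "h (F' n) / card (F' n) < l" using fr by (auto dest: frequently_ex)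
      moreover have "0 \<le> h (F' n)" using F' by (intro nonneg) (auto simp: folner_sequence_def)
      ultimately show ?thesis by (smt (verit) divide_nonneg_nonneg of_nat_0_le_iff)
    qed
    obtain K \<delta> where K: "finite K" "K \<subseteq> carrier G" "0 < \<delta>"
      "\<And>F. invariant_set G K \<delta> F \<Longrightarrow> \<exists>\<P>\<subseteq>Pow F. (\<forall>Q\<in>\<P>. \<exists>T\<in>\<T>. \<exists>c\<in>carrier G. Q = T #> c) \<and>
      (1 - \<epsilon>) * (\<Sum>Q\<in>\<P>. real (card Q)) \<le> real (card (\<Union>\<P>)) \<and> (1 - 2*\<epsilon>) * card F \<le> real (card (\<Union>\<P>))"
      by (rule quasi_tiling[OF \<epsilon> avail]) (assumption | rule that)+
    show ?thesis
    proof (rule eventually_mono[OF folner_eventually_invariant[OF F K(1-3)]])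
      fix n assume n: "invariant_set G K \<delta> (F n)"
      then have Fn: "finite (F n)" "F n \<noteq> {}" "F n \<subseteq> carrier G" by (auto simp: invariant_set_def)
      obtain \<P> where P: "\<P> \<subseteq> Pow (F n)" "\<forall>Q\<in>\<P>. \<exists>T\<in>\<T>. \<exists>c\<in>carrier G. Q = T #> c"
        "(1 - \<epsilon>) * (\<Sum>Q\<in>\<P>. real (card Q)) \<le> real (card (\<Union>\<P>))" "(1 - 2*\<epsilon>) * card (F n) \<le> real (card (\<Union>\<P>))"
        using K(4)[OF n] by (elim exE conjE) (rule that; assumption)
      have fP: "finite \<P>" using P(1) Fn by (meson finite_Pow_iff finite_subset)
      have UP: "\<Union>\<P> \<subseteq> F n" using P(1) by auto
      have hQ: "h Q \<le> l * card Q" if Q: "Q \<in> \<P>" for Q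
      proof -
        obtain T c where "T \<in> \<T>" "c \<in> carrier G" "Q = T #> c" using bspec[OF P(2) Q] by blast
        then show ?thesis using Tf[of T] inv[of T c] by (simp add: card_r_coset_eq)
      qed
      have "h (F n) = h (\<Union>\<P> \<union> (F n - \<Union>\<P>))" using UP by (simp add: Un_absorb1)
      also have "\<dots> \<le> (\<Sum>Q\<in>\<P>. h Q) + h (F n - \<Union>\<P>)"
        using P(1) Fn fP by (intro union) (auto dest: finite_subset)
      also have "(\<Sum>Q\<in>\<P>. h Q) \<le> (\<Sum>Q\<in>\<P>. l * card Q)" using hQ by (intro sum_mono) auto
      also have "\<dots> = l * (\<Sum>Q\<in>\<P>. real (card Q))" by (simp add: sum_distrib_left)
      also have "\<dots> \<le> l * (card (F n) / (1 - \<epsilon>))"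
      proof (rule mult_left_mono[OF _ l0])
        have "real (card (\<Union>\<P>)) \<le> card (F n)" using UP Fn by (simp add: card_mono)
        then have "(1 - \<epsilon>) * (\<Sum>Q\<in>\<P>. real (card Q)) \<le> card (F n)" using P(3) by linarith
        then show "(\<Sum>Q\<in>\<P>. real (card Q)) \<le> card (F n) / (1 - \<epsilon>)"
          using \<epsilon> by (simp add: pos_le_divide_eq mult.commute)
      qed
      also have "h (F n - \<Union>\<P>) \<le> C * card (F n - \<Union>\<P>)" using Fn by (intro hC) auto
      also have "real (card (F n - \<Union>\<P>)) \<le> 2 * \<epsilon> * card (F n)"
      proof -
        have "real (card (F n - \<Union>\<P>)) = real (card (F n)) - card (\<Union>\<P>)"
          using UP Fn by (metis card_Diff_subset card_mono finite_subset of_nat_diff)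
        then show ?thesis using P(4) by (simp add: algebra_simps)
      qed
      finally have "h (F n) \<le> l * (card (F n) / (1 - \<epsilon>)) + C * (2 * \<epsilon> * card (F n))"
        using C0 by (simp add: mult_left_mono)
      moreover have "0 < real (card (F n))" using Fn by (simp add: card_gt_0_iff)
      ultimately show "h (F n) / card (F n) \<le> l / (1 - \<epsilon>) + C * (2*\<epsilon>)"
        by (simp add: pos_divide_le_eq algebra_simps)
    qed
  qed
  have claim': "\<forall>\<^sub>F n in sequentially. h (F n) / card (F n) < l + e"
    if F: "folner_sequence G F" "folner_sequence G F'"
      and fr: "\<exists>\<^sub>F n in sequentially. h (F' n) / card (F' n) < l" and e: "0 < e"
    for F F' l e
  proof -
    have "((\<lambda>\<epsilon>. l / (1 - \<epsilon>) + C * (2*\<epsilon>)) \<longlongrightarrow> l / (1 - 0) + C * (2*0)) (at_right 0)"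
      by (intro tendsto_intros) auto
    then have "\<forall>\<^sub>F \<epsilon> in at_right 0. l / (1 - \<epsilon>) + C * (2*\<epsilon>) < l + e"
      using e by (intro order_tendstoD(2)) auto
    moreover have "\<forall>\<^sub>F \<epsilon>::real in at_right 0. \<epsilon> < 1/2 \<and> 0 < \<epsilon>"
      unfolding eventually_at_right_field by (intro exI[of _ "1/2"]) auto
    ultimately have "\<forall>\<^sub>F \<epsilon> in at_right 0. l / (1 - \<epsilon>) + C * (2*\<epsilon>) < l + e \<and> \<epsilon> < 1/2 \<and> 0 < \<epsilon>"
      by (rule eventually_conj)
    from eventually_happens'[OF trivial_limit_at_right_real this]
    have "\<exists>\<epsilon>. l / (1 - \<epsilon>) + C * (2*\<epsilon>) < l + e \<and> \<epsilon> < 1/2 \<and> 0 < \<epsilon>" .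
    then obtain \<epsilon> where "l / (1 - \<epsilon>) + C * (2*\<epsilon>) < l + e" "\<epsilon> < 1/2" "0 < \<epsilon>" by blast
    with claim[OF F fr this(3,2)] show ?thesis by (auto elim: eventually_mono)
  qed
  \<comment> \<open>\<open>Inf S\<close> is the infimum of the lower limits of the ratios over all
    Folner sequences.\<close>
  define S where "S = {l. \<exists>F. folner_sequence G F \<and> (\<exists>\<^sub>F n in sequentially. h (F n) / card (F n) < l)}"
  have lower: "0 \<le> l" if l: "l \<in> S" for l
  proof -
    obtain F n where F: "folner_sequence G F" "h (F n) / card (F n) < l"
      using l by (auto simp: S_def dest: frequently_ex)
    then have "0 \<le> h (F n)" by (intro nonneg) (auto simp: folner_sequence_def)
    then show ?thesis using F by (smt (verit) divide_nonneg_nonneg of_nat_0_le_iff)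
  qed
  then have bdd: "bdd_below S" by (rule bdd_belowI)
  show ?thesis
  proof (intro exI[of _ "Inf S"] allI impI)
    fix F assume F: "folner_sequence G F"
    have "h (F n) / card (F n) < C + 1" for n
    proof -
      have Fn: "finite (F n)" "F n \<noteq> {}" "F n \<subseteq> carrier G" using F by (auto simp: folner_sequence_def)
      then have "0 < real (card (F n))" by (simp add: card_gt_0_iff)
      then show ?thesis using hC[of "F n"] Fn by (simp add: field_simps)
    qed
    then have "C + 1 \<in> S" using F by (auto simp: S_def)
    then have ne: "S \<noteq> {}" by auto
    show "(\<lambda>n. h (F n) / card (F n)) \<longlonglongrightarrow> Inf S"
    proof (rule order_tendstoI)
      fix a assume a: "a < Inf S"
      define b where "b = (a + Inf S) / 2"
      have ab: "a < b" "b < Inf S" using a by (auto simp: b_def)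
      have "\<not> (\<exists>\<^sub>F n in sequentially. h (F n) / card (F n) < b)"
        using F cInf_lower[OF _ bdd, of b] ab by (auto simp: S_def)
      then have "\<forall>\<^sub>F n in sequentially. \<not> h (F n) / card (F n) < b" by (simp add: not_frequently)
      then show "\<forall>\<^sub>F n in sequentially. a < h (F n) / card (F n)"
        using ab by (auto elim!: eventually_mono)
    next
      fix a assume a: "Inf S < a"
      then obtain l where l: "l \<in> S" "l < a" using cInf_lessD[OF ne] by blast
      then obtain F' where "folner_sequence G F'" "\<exists>\<^sub>F n in sequentially. h (F' n) / card (F' n) < l"
        by (auto simp: S_def)
      from claim'[OF F this, of "a - l"] l show "\<forall>\<^sub>F n in sequentially. h (F n) / card (F n) < a" by simp
    qed
  qed
qed

end

section \<open>Symbolic subshifts and the density of free coordinates\<close>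

definition depends_on :: "'g set \<Rightarrow> (('g \<Rightarrow> 'p) \<Rightarrow> 'c) \<Rightarrow> bool" where
  "depends_on E Q \<longleftrightarrow> (\<forall>x y. (\<forall>e\<in>E. x e = y e) \<longrightarrow> Q x = Q y)"

lemma depends_onD: "depends_on E Q \<Longrightarrow> (\<And>e. e \<in> E \<Longrightarrow> x e = y e) \<Longrightarrow> Q x = Q y"
  unfolding depends_on_def by blast

lemma topspace_full_shift: "topspace (full_shift G X) = (\<Pi>\<^sub>E g\<in>carrier G. topspace X)"
  by (simp add: full_shift_def)

lemma openin_full_shift_depends_on:
  assumes "finite E" "depends_on E Q"
  shows "openin (full_shift G (discrete_topology B)) {x\<in>topspace (full_shift G (discrete_topology B)). Q x}"
  unfolding full_shift_def openin_product_topology_alt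
proof (intro ballI)
  fix x assume x: "x \<in> {x\<in>topspace (product_topology (\<lambda>_. discrete_topology B) (carrier G)). Q x}"
  define U where "U i = (if i \<in> E then {x i} else B)" for i
  have xB: "x \<in> (\<Pi>\<^sub>E i\<in>carrier G. B)" "Q x" using x by auto
  have "{i\<in>carrier G. U i \<noteq> B} \<subseteq> E" by (auto simp: U_def)
  then have "finite {i\<in>carrier G. U i \<noteq> B}" using assms(1) by (rule finite_subset)
  moreover have "U i \<subseteq> B" if "i \<in> carrier G" for i using xB that by (auto simp: U_def)
  moreover have "x \<in> Pi\<^sub>E (carrier G) U" using xB by (auto simp: U_def PiE_iff)
  moreover have "Q y" if "y \<in> Pi\<^sub>E (carrier G) U" for y
  proof -
    have "y e = x e" if "e \<in> E" for e
      using \<open>y \<in> Pi\<^sub>E (carrier G) U\<close> xB(1) that by (cases "e \<in> carrier G") (auto simp: U_def PiE_iff extensional_def)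
    then have "Q y = Q x" by (rule depends_onD[OF assms(2)])
    then show ?thesis using xB by simp
  qed
  ultimately show "\<exists>U. finite {i\<in>carrier G. U i \<noteq> topspace (discrete_topology B)} \<and>
     (\<forall>i\<in>carrier G. openin (discrete_topology B) (U i)) \<and> x \<in> Pi\<^sub>E (carrier G) U \<and>
     Pi\<^sub>E (carrier G) U \<subseteq> {x\<in>topspace (product_topology (\<lambda>_. discrete_topology B) (carrier G)). Q x}"
    by (intro exI[of _ U]) (auto simp: PiE_iff)
qed

lemma depends_on_not: "depends_on E Q \<Longrightarrow> depends_on E (\<lambda>x. \<not> Q x)"
  unfolding depends_on_def by blast

lemma closedin_full_shift_depends_on:
  assumes "finite E" "depends_on E Q"
  shows "closedin (full_shift G (discrete_topology B)) {x\<in>topspace (full_shift G (discrete_topology B)). Q x}"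
proof -
  have "topspace (full_shift G (discrete_topology B)) - {x\<in>topspace (full_shift G (discrete_topology B)). Q x}
     = {x\<in>topspace (full_shift G (discrete_topology B)). \<not> Q x}" by auto
  then show ?thesis unfolding closedin_def
    using openin_full_shift_depends_on[OF assms(1) depends_on_not[OF assms(2)], of G B] by auto
qed

lemma compact_space_full_shift: "compact_space X \<Longrightarrow> compact_space (full_shift G X)"
  by (simp add: full_shift_def compact_space_product_topology)

lemma Hausdorff_space_full_shift: "Hausdorff_space X \<Longrightarrow> Hausdorff_space (full_shift G X)"
  by (simp add: full_shift_def Hausdorff_space_product_topology)

section \<open>Minimal subshifts and sliding block codes\<close>

context group begin

lemma shift_map_apply: "h \<in> carrier G \<Longrightarrow> shift_map G g x h = x (h \<otimes> g)"
  by (simp add: shift_map_def)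

lemma shift_map_shift_map:
  assumes "g \<in> carrier G" "g' \<in> carrier G"
  shows "shift_map G g (shift_map G g' x) = shift_map G (g \<otimes> g') x"
  using assms by (auto simp: shift_map_def m_assoc fun_eq_iff)

lemma shift_map_one: "x \<in> extensional (carrier G) \<Longrightarrow> shift_map G \<one> x = x"
  by (auto simp: shift_map_def fun_eq_iff extensional_def)

lemma shift_map_in_topspace:
  assumes "x \<in> topspace (full_shift G X)" "g \<in> carrier G"
  shows "shift_map G g x \<in> topspace (full_shift G X)"
  using assms by (auto simp: topspace_full_shift shift_map_def PiE_iff)

lemma continuous_map_shift_map:
  assumes "g \<in> carrier G"
  shows "continuous_map (full_shift G X) (full_shift G X) (shift_map G g)"
  unfolding full_shift_def continuous_map_componentwise
proof (intro conjI ballI)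
  show "shift_map G g ` topspace (product_topology (\<lambda>_. X) (carrier G)) \<subseteq> extensional (carrier G)"
    by (auto simp: shift_map_def)
  fix k assume "k \<in> carrier G"
  then show "continuous_map (product_topology (\<lambda>_. X) (carrier G)) X (\<lambda>x. shift_map G g x k)"
    using assms continuous_map_product_projection[of "k \<otimes> g" "carrier G" "\<lambda>_. X"]
    by (simp add: shift_map_apply)
qed

lemma subshift_subset: "subshift G X Y \<Longrightarrow> Y \<subseteq> topspace (full_shift G X)"
  by (simp add: subshift_def closedin_subset)

lemma subshift_shift: "subshift G X Y \<Longrightarrow> g \<in> carrier G \<Longrightarrow> y \<in> Y \<Longrightarrow> shift_map G g y \<in> Y"
  by (auto simp: subshift_def)

definition minimal_subshift :: "'p topology \<Rightarrow> ('a \<Rightarrow> 'p) set \<Rightarrow> bool" where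
  "minimal_subshift X W \<longleftrightarrow> subshift G X W \<and> W \<noteq> {} \<and>
     (\<forall>V. subshift G X V \<longrightarrow> V \<noteq> {} \<longrightarrow> V \<subseteq> W \<longrightarrow> V = W)"

text \<open>Zorn's lemma is applied to complements, which reverses inclusions. By compactness a
  chain of proper open subsets cannot exhaust the space.\<close>

lemma minimal_subshift_exists:
  assumes X: "compact_space X" and Y: "subshift G X Y" "Y \<noteq> {}"
  obtains M where "minimal_subshift X M" "M \<subseteq> Y"
proof -
  let ?T = "full_shift G X"
  define \<A> where "\<A> = {U. U \<subseteq> topspace ?T \<and> subshift G X (topspace ?T - U) \<and> topspace ?T - U \<noteq> {} \<and> topspace ?T - U \<subseteq> Y}"
  have YT: "Y \<subseteq> topspace ?T" using Y(1) by (rule subshift_subset)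
  have YA: "topspace ?T - Y \<in> \<A>" using Y YT by (auto simp: \<A>_def double_diff)
  have "\<exists>M\<in>\<A>. \<forall>U\<in>\<A>. M \<subseteq> U \<longrightarrow> U = M"
  proof (rule subset_Zorn)
    fix \<C> assume C: "subset.chain \<A> \<C>"
    show "\<exists>U\<in>\<A>. \<forall>X\<in>\<C>. X \<subseteq> U"
    proof (cases "\<C> = {}")
      case True then show ?thesis using YA by auto
    next
      case False
      have CA: "\<C> \<subseteq> \<A>" using C by (simp add: subset.chain_def)
      have op: "openin ?T U" if "U \<in> \<C>" for U
      proof -
        have "U \<subseteq> topspace ?T" "closedin ?T (topspace ?T - U)" using that CA by (auto simp: \<A>_def subshift_def)
        then show ?thesis using openin_closedin_eq by blast
      qed
      have "\<not> topspace ?T \<subseteq> \<Union>\<C>"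
      proof
        assume "topspace ?T \<subseteq> \<Union>\<C>"
        then have "\<exists>\<F>. finite \<F> \<and> \<F> \<subseteq> \<C> \<and> topspace ?T \<subseteq> \<Union>\<F>"
          using compact_space_full_shift[OF X, of G] op unfolding compact_space_alt by blast
        then obtain \<F> where \<F>: "finite \<F>" "\<F> \<subseteq> \<C>" "topspace ?T \<subseteq> \<Union>\<F>" by blast
        have "\<F> \<noteq> {}" using \<F>(3) YT Y(2) by auto
        moreover have "A \<subseteq> B \<or> B \<subseteq> A" if "A \<in> \<C>" "B \<in> \<C>" for A B
          using C that by (simp add: subset_chain_def)
        then have "subset.chain \<A> \<F>" using \<F>(2) CA unfolding subset_chain_def by (meson subsetD subset_trans)
        ultimately have "\<Union>\<F> \<in> \<F>" using \<F>(1) by (intro Union_in_chain)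
        then show False using \<F> CA by (auto simp: \<A>_def)
      qed
      moreover have "subshift G X (topspace ?T - \<Union>\<C>)"
        unfolding subshift_def
      proof (intro conjI ballI subsetI)
        show "closedin ?T (topspace ?T - \<Union>\<C>)" using op by (intro closedin_diff openin_Union) auto
        fix g y assume g: "g \<in> carrier G" and y: "y \<in> shift_map G g ` (topspace ?T - \<Union>\<C>)"
        then obtain x where x: "x \<in> topspace ?T - \<Union>\<C>" "y = shift_map G g x" by blast
        then have "y \<notin> U" if "U \<in> \<C>" for U
          using that CA x g subshift_shift[of X "topspace ?T - U" g x] by (auto simp: \<A>_def)
        moreover have "y \<in> topspace ?T" using shift_map_in_topspace[of x X g] x g by simp
        ultimately show "y \<in> topspace ?T - \<Union>\<C>" by auto
      qed
      moreover have "topspace ?T - \<Union>\<C> \<subseteq> Y" using False CA by (auto simp: \<A>_def)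
      moreover have "\<Union>\<C> \<subseteq> topspace ?T" using CA by (auto simp: \<A>_def)
      ultimately have "\<Union>\<C> \<in> \<A>" by (auto simp: \<A>_def)
      then show ?thesis by blast
    qed
  qed
  then obtain U where U: "U \<in> \<A>" and max: "\<And>V. V \<in> \<A> \<Longrightarrow> U \<subseteq> V \<Longrightarrow> V = U" by blast
  show ?thesis
  proof (rule that)
    show "topspace ?T - U \<subseteq> Y" using U by (simp add: \<A>_def)
    show "minimal_subshift X (topspace ?T - U)" unfolding minimal_subshift_def
    proof (intro conjI allI impI)
      show "subshift G X (topspace ?T - U)" "topspace ?T - U \<noteq> {}" using U by (auto simp: \<A>_def)
      fix V assume V: "subshift G X V" "V \<noteq> {}" "V \<subseteq> topspace ?T - U"
      then have "topspace ?T - V \<in> \<A>"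
        using U subshift_subset[OF V(1)] by (auto simp: \<A>_def double_diff)
      moreover have "U \<subseteq> topspace ?T - V" using U V by (auto simp: \<A>_def)
      ultimately have "topspace ?T - V = U" by (rule max)
      then show "V = topspace ?T - U" using subshift_subset[OF V(1)] by auto
    qed
  qed
qed

text \<open>The sliding block code with local rule \<open>\<psi>\<close>.\<close>

definition block_map :: "(('a \<Rightarrow> 'p) \<Rightarrow> 'c) \<Rightarrow> ('a \<Rightarrow> 'p) \<Rightarrow> 'a \<Rightarrow> 'c" where
  "block_map \<psi> c = (\<lambda>g\<in>carrier G. \<psi> (shift_map G g c))"

lemma block_map_apply: "g \<in> carrier G \<Longrightarrow> block_map \<psi> c g = \<psi> (shift_map G g c)"
  by (simp add: block_map_def)

lemma block_map_shift:
  assumes "g \<in> carrier G"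
  shows "block_map \<psi> (shift_map G g c) = shift_map G g (block_map \<psi> c)"
  using assms by (auto simp: block_map_def shift_map_def[of G g "restrict _ _"] shift_map_shift_map fun_eq_iff)

lemma depends_on_shift_map:
  fixes \<psi> :: "('a \<Rightarrow> 'p) \<Rightarrow> 'c"
  assumes "E \<subseteq> carrier G" "depends_on E \<psi>" "g \<in> carrier G"
  shows "depends_on (E #> g) (\<lambda>c. \<psi> (shift_map G g c))"
  unfolding depends_on_def
proof (intro allI impI)
  fix x y :: "'a \<Rightarrow> 'p" assume *: "\<forall>e\<in>E #> g. x e = y e"
  show "\<psi> (shift_map G g x) = \<psi> (shift_map G g y)"
    using assms * by (intro depends_onD[OF assms(2)]) (auto simp: shift_map_apply r_coset_def subset_iff)
qed

lemma continuous_map_block_map: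
  assumes E: "finite E" "E \<subseteq> carrier G" "depends_on E \<psi>"
    and \<psi>: "\<And>c. c \<in> topspace (full_shift G (discrete_topology A)) \<Longrightarrow> \<psi> c \<in> B"
  shows "continuous_map (full_shift G (discrete_topology A)) (full_shift G (discrete_topology B)) (block_map \<psi>)"
  unfolding full_shift_def[of G "discrete_topology B"] continuous_map_componentwise
proof (intro conjI ballI)
  show "block_map \<psi> ` topspace (full_shift G (discrete_topology A)) \<subseteq> extensional (carrier G)"
    by (auto simp: block_map_def)
  fix k assume k: "k \<in> carrier G"
  show "continuous_map (full_shift G (discrete_topology A)) (discrete_topology B) (\<lambda>x. block_map \<psi> x k)"
    unfolding continuous_map_def
  proof (intro conjI allI impI)
    show "(\<lambda>x. block_map \<psi> x k) \<in> topspace (full_shift G (discrete_topology A)) \<rightarrow> topspace (discrete_topology B)"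
      using k \<psi> shift_map_in_topspace by (auto simp: block_map_apply)
    fix U
    have "depends_on (E #> k) (\<lambda>c. block_map \<psi> c k \<in> U)"
      unfolding depends_on_def block_map_apply[OF k]
      using depends_onD[OF depends_on_shift_map[OF E(2,3) k]] by (metis (no_types, lifting))
    then show "openin (full_shift G (discrete_topology A)) {x \<in> topspace (full_shift G (discrete_topology A)). block_map \<psi> x k \<in> U}"
      using E(1) by (intro openin_full_shift_depends_on) (auto simp: r_coset_def)
  qed
qed

lemma subshift_equivariant_image:
  assumes "compact_space X" "Hausdorff_space Y" "subshift G X M"
    and f: "continuous_map (full_shift G X) (full_shift G Y) f"
    and eq: "\<And>g c. g \<in> carrier G \<Longrightarrow> f (shift_map G g c) = shift_map G g (f c)"
  shows "subshift G Y (f ` M)"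
  unfolding subshift_def
proof (intro conjI ballI subsetI)
  have "compactin (full_shift G X) M"
    using assms(3) compact_space_full_shift[OF assms(1)] by (auto simp: subshift_def intro: closedin_compact_space)
  then have "compactin (full_shift G Y) (f ` M)" using f by (rule image_compactin)
  then show "closedin (full_shift G Y) (f ` M)"
    using Hausdorff_space_full_shift[OF assms(2)] compactin_imp_closedin by blast
  fix g y assume "g \<in> carrier G" "y \<in> shift_map G g ` f ` M"
  then show "y \<in> f ` M" using subshift_shift[OF assms(3)] eq[symmetric] by fastforce
qed

text \<open>The preimage of a smaller nonempty subshift is a nonempty subshift in \<open>M\<close>,
  hence all of \<open>M\<close>.\<close>

lemma minimal_subshift_equivariant_image:
  assumes X: "compact_space X" "Hausdorff_space Y" and M: "minimal_subshift X M"
    and f: "continuous_map (full_shift G X) (full_shift G Y) f"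
    and eq: "\<And>g c. g \<in> carrier G \<Longrightarrow> f (shift_map G g c) = shift_map G g (f c)"
  shows "minimal_subshift Y (f ` M)"
  unfolding minimal_subshift_def
proof (intro conjI allI impI)
  have MX: "subshift G X M" "M \<noteq> {}" using M by (auto simp: minimal_subshift_def)
  show "subshift G Y (f ` M)" using subshift_equivariant_image[OF X MX(1) f eq] by simp
  show "f ` M \<noteq> {}" using MX by simp
  fix V assume V: "subshift G Y V" "V \<noteq> {}" "V \<subseteq> f ` M"
  define V' where "V' = {x\<in>M. f x \<in> V}"
  have "V' = M \<inter> {x\<in>topspace (full_shift G X). f x \<in> V}"
    using subshift_subset[OF MX(1)] by (auto simp: V'_def)
  moreover have "closedin (full_shift G X) {x\<in>topspace (full_shift G X). f x \<in> V}"
    using f V(1) by (intro closedin_continuous_map_preimage) (auto simp: subshift_def)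
  ultimately have "closedin (full_shift G X) V'" using MX(1) by (simp add: subshift_def closedin_Int)
  moreover have "shift_map G g ` V' \<subseteq> V'" if "g \<in> carrier G" for g
    using that subshift_shift[OF MX(1) that] subshift_shift[OF V(1) that] eq[OF that] by (auto simp: V'_def)
  ultimately have "subshift G X V'" by (simp add: subshift_def)
  moreover have "V' \<noteq> {}" "V' \<subseteq> M" using V by (auto simp: V'_def)
  ultimately have "V' = M" using M by (simp add: minimal_subshift_def)
  then show "V = f ` M" using V(3) by (auto simp: V'_def)
qed

text \<open>The words of \<open>W\<close> in which the pattern of \<open>v\<close> on
  \<open>F\<close> never appears form a subshift. It misses \<open>v\<close>, so by minimality it is
  empty.\<close>

lemma minimal_subshift_pattern_recurs:
  assumes W: "minimal_subshift (discrete_topology A) W" and vw: "v \<in> W" "w \<in> W"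
    and F: "finite F" "F \<subseteq> carrier G"
  obtains g where "g \<in> carrier G" "\<And>f. f \<in> F \<Longrightarrow> w (f \<otimes> g) = v f"
proof -
  have "\<exists>g\<in>carrier G. \<forall>f\<in>F. w (f \<otimes> g) = v f"
  proof (rule ccontr)
    assume neg: "\<not> ?thesis"
    have no: "\<not> (\<forall>f\<in>F. w (f \<otimes> g) = v f)" if g: "g \<in> carrier G" for g using neg g by blast
    let ?T = "full_shift G (discrete_topology A)"
    have WX: "subshift G (discrete_topology A) W" using W by (simp add: minimal_subshift_def)
    define Q where "Q = (\<lambda>x. \<not> (\<forall>f\<in>F. x f = v f))"
    define V where "V = W \<inter> (\<Inter>g\<in>carrier G. {x\<in>topspace ?T. Q (shift_map G g x)})"
    have "depends_on F Q" by (auto simp: Q_def depends_on_def)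
    have "closedin ?T {x\<in>topspace ?T. Q (shift_map G g x)}" if "g \<in> carrier G" for g
      using F that depends_on_shift_map[OF F(2) \<open>depends_on F Q\<close> that]
      by (intro closedin_full_shift_depends_on[of "F #> g"]) (auto simp: r_coset_def)
    then have "closedin ?T V" unfolding V_def
      using WX by (intro closedin_Int closedin_Inter) (auto simp: subshift_def)
    moreover have "shift_map G g ` V \<subseteq> V" if "g \<in> carrier G" for g
      using that subshift_shift[OF WX that] shift_map_in_topspace[OF _ that] by (auto simp: V_def shift_map_shift_map)
    ultimately have "subshift G (discrete_topology A) V" by (simp add: subshift_def)
    moreover have "Q (shift_map G g w)" if g: "g \<in> carrier G" for g
    proof -
      have "shift_map G g w f = w (f \<otimes> g)" if "f \<in> F" for f using that F by (simp add: shift_map_apply subset_iff)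
      then show ?thesis using no[OF g] by (simp add: Q_def)
    qed
    then have "w \<in> V" using vw subshift_subset[OF WX] by (auto simp: V_def)
    ultimately have "V = W" using W by (auto simp: minimal_subshift_def V_def)
    then have "Q (shift_map G \<one> v)" using vw by (auto simp: V_def)
    then show False using F by (auto simp: Q_def shift_map_apply subset_iff)
  qed
  then show ?thesis using that by blast
qed

section \<open>The density of free coordinates\<close>

definition stars :: "('a \<Rightarrow> 'p option) \<Rightarrow> 'a set \<Rightarrow> nat" where
  "stars w K = card {g\<in>K. w g = None}"

text \<open>This is the maximal frequency of \<open>None\<close>, as an infimum over windows of the
  worst ratio over \<open>W\<close>. In this form one good window already gives an upper bound, and
  every window has a word whose ratio exceeds any given number below the density.
  \<open>star_density_upper\<close> recovers the meaning as a limit along invariant sets.\<close>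

definition star_density :: "('a \<Rightarrow> 'p option) set \<Rightarrow> real" where
  "star_density W = Inf {q::real. \<exists>K. finite K \<and> K \<noteq> {} \<and> K \<subseteq> carrier G \<and> (\<forall>w\<in>W. real (stars w K) \<le> q * card K)}"

lemma stars_ratio_nonneg:
  assumes "W \<noteq> {}" "\<exists>K. finite K \<and> K \<noteq> {} \<and> K \<subseteq> carrier G \<and> (\<forall>w\<in>W. real (stars w K) \<le> q * real (card K))"
  shows "0 \<le> q"
proof -
  obtain K where K: "finite K \<and> K \<noteq> {} \<and> K \<subseteq> carrier G \<and> (\<forall>w\<in>W. real (stars w K) \<le> q * real (card K))"
    using assms(2) ..
  obtain w where "w \<in> W" using assms(1) by auto
  then have "real (stars w K) \<le> q * real (card K)" using K by simp
  then have "0 \<le> q * real (card K)" by (rule order.trans[rotated]) simp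
  moreover have "0 < card K" using K by (simp add: card_gt_0_iff)
  ultimately show ?thesis by (simp add: zero_le_mult_iff)
qed

lemma star_density_le:
  fixes q :: real
  assumes "W \<noteq> {}" "finite K" "K \<noteq> {}" "K \<subseteq> carrier G" "\<And>w. w \<in> W \<Longrightarrow> real (stars w K) \<le> q * card K"
  shows "star_density W \<le> q"
  unfolding star_density_def
proof (rule cInf_lower)
  show "bdd_below {q::real. \<exists>K. finite K \<and> K \<noteq> {} \<and> K \<subseteq> carrier G \<and> (\<forall>w\<in>W. real (stars w K) \<le> q * card K)}"
  proof (rule bdd_belowI[of _ 0])
    fix q :: real assume "q \<in> {q::real. \<exists>K. finite K \<and> K \<noteq> {} \<and> K \<subseteq> carrier G \<and> (\<forall>w\<in>W. real (stars w K) \<le> q * card K)}"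
    then show "0 \<le> q" using stars_ratio_nonneg[OF assms(1)] by blast
  qed
qed (use assms in auto)

lemma star_density_less:
  fixes q :: real
  assumes "W \<noteq> {}" "q < star_density W" "finite K" "K \<noteq> {}" "K \<subseteq> carrier G"
  obtains w where "w \<in> W" "q * card K < stars w K"
  using star_density_le[OF assms(1,3,4,5), of q] assms(2) by (meson not_le)

lemma stars_le: "finite K \<Longrightarrow> stars w K \<le> card K"
  by (auto simp: stars_def intro: card_mono)

lemma stars_one_le: "stars w {\<one>} \<le> Suc 0"
  using stars_le[of "{\<one>}" w] by simp

lemma star_density_nonneg: "W \<noteq> {} \<Longrightarrow> 0 \<le> star_density W"
  unfolding star_density_def
proof (rule cInf_greatest)
  assume "W \<noteq> {}"
  have "(1::real) \<in> {q::real. \<exists>K. finite K \<and> K \<noteq> {} \<and> K \<subseteq> carrier G \<and> (\<forall>w\<in>W. real (stars w K) \<le> q * card K)}"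
    by (intro CollectI exI[of _ "{\<one>}"] conjI ballI) (simp_all add: stars_one_le)
  then show "{q::real. \<exists>K. finite K \<and> K \<noteq> {} \<and> K \<subseteq> carrier G \<and> (\<forall>w\<in>W. real (stars w K) \<le> q * card K)} \<noteq> {}" by blast
  fix q :: real assume "q \<in> {q::real. \<exists>K. finite K \<and> K \<noteq> {} \<and> K \<subseteq> carrier G \<and> (\<forall>w\<in>W. real (stars w K) \<le> q * card K)}"
  then show "0 \<le> q" using stars_ratio_nonneg[OF \<open>W \<noteq> {}\<close>] by blast
qed

text \<open>Average the ratio of a nearly optimal window \<open>K\<close> over its translates by the
  elements of \<open>F\<close>. For fixed \<open>k\<close> in \<open>K\<close> the average counts
  the free coordinates of \<open>k F\<close>, which differs little from \<open>F\<close>.\<close>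

lemma star_density_upper:
  assumes inv: "\<And>g w. g \<in> carrier G \<Longrightarrow> w \<in> W \<Longrightarrow> shift_map G g w \<in> W" and e: "0 < e"
  obtains K \<delta> where "finite K" "K \<subseteq> carrier G" "0 < \<delta>"
    "\<And>F w. invariant_set G K \<delta> F \<Longrightarrow> w \<in> W \<Longrightarrow> real (stars w F) \<le> (star_density W + e) * card F"
proof -
  let ?S = "{q::real. \<exists>K. finite K \<and> K \<noteq> {} \<and> K \<subseteq> carrier G \<and> (\<forall>w\<in>W. real (stars w K) \<le> q * card K)}"
  have "(1::real) \<in> ?S"
    by (intro CollectI exI[of _ "{\<one>}"] conjI ballI) (simp_all add: stars_one_le)
  then have "?S \<noteq> {}" by blast
  moreover have "Inf ?S < star_density W + e/2" using e by (simp add: star_density_def)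
  ultimately have "\<exists>q\<in>?S. q < star_density W + e/2" by (rule cInf_lessD)
  then obtain q where "q \<in> ?S" "q < star_density W + e/2" ..
  then obtain K where "finite K \<and> K \<noteq> {} \<and> K \<subseteq> carrier G \<and> (\<forall>w\<in>W. real (stars w K) \<le> q * card K)" by blast
  then have K: "finite K" "K \<noteq> {}" "K \<subseteq> carrier G" "\<And>w. w \<in> W \<Longrightarrow> real (stars w K) \<le> q * card K" by simp_all
  have cK: "0 < real (card K)" using K by (simp add: card_gt_0_iff)
  show ?thesis
  proof (rule that[of K "e/2"])
    fix F w assume F: "invariant_set G K (e/2) F" and w: "w \<in> W"
    have Ff: "finite F" "F \<noteq> {}" "F \<subseteq> carrier G" using F by (auto simp: invariant_set_def)
    have "(\<Sum>g\<in>F. real (stars (shift_map G g w) K)) \<le> (\<Sum>g\<in>F. q * card K)"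
      using Ff inv w by (intro sum_mono K(4)) auto
    also have "\<dots> = card K * (q * card F)" by simp
    also have "(\<Sum>g\<in>F. real (stars (shift_map G g w) K)) = (\<Sum>g\<in>F. \<Sum>k\<in>K. of_bool (w (k \<otimes> g) = None))"
    proof (rule sum.cong[OF refl])
      fix g assume "g \<in> F"
      have "{k\<in>K. shift_map G g w k = None} = {k\<in>K. w (k \<otimes> g) = None}" using K by (auto simp: shift_map_apply subset_iff)
      then show "real (stars (shift_map G g w) K) = (\<Sum>k\<in>K. of_bool (w (k \<otimes> g) = None))"
        using K(1) by (simp add: stars_def of_bool_def flip: sum.inter_filter)
    qed
    also have "\<dots> = (\<Sum>k\<in>K. \<Sum>g\<in>F. of_bool (w (k \<otimes> g) = None))" by (rule sum.swap)
    finally have 1: "(\<Sum>k\<in>K. \<Sum>g\<in>F. of_bool (w (k \<otimes> g) = None)) \<le> card K * (q * card F)" .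
    have "(\<Sum>k\<in>K. real (stars w F) - e/2 * card F) \<le> (\<Sum>k\<in>K. \<Sum>g\<in>F. of_bool (w (k \<otimes> g) = None))"
    proof (rule sum_mono)
      fix k assume k: "k \<in> K"
      then have kc: "k \<in> carrier G" using K by auto
      let ?kF = "(\<lambda>g. k \<otimes> g) ` F"
      have inj: "inj_on (\<lambda>g. k \<otimes> g) F" using Ff kc by (auto simp: inj_on_def subset_iff)
      have "{g\<in>F. w g = None} \<subseteq> {g\<in>?kF. w g = None} \<union> (F - ?kF)" by auto
      then have "stars w F \<le> card ({g\<in>?kF. w g = None} \<union> (F - ?kF))"
        unfolding stars_def using Ff by (intro card_mono) auto
      also have "\<dots> \<le> card {g\<in>?kF. w g = None} + card (F - ?kF)" by (rule card_Un_le)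
      also have "{g\<in>?kF. w g = None} = (\<lambda>g. k \<otimes> g) ` {g\<in>F. w (k \<otimes> g) = None}" by auto
      also have "card \<dots> = card {g\<in>F. w (k \<otimes> g) = None}" using inj by (intro card_image) (auto simp: inj_on_def)
      also have "card (F - ?kF) = card (?kF - F)"
      proof -
        have "card F = card ?kF" using inj by (simp add: card_image)
        then show ?thesis using Ff by (metis card_Diff_subset_Int finite_Int finite_imageI inf_commute)
      qed
      also have "card (?kF - F) \<le> card ((K <#> F) - F)"
        using k K(1) Ff by (intro card_mono) (auto simp: set_mult_def)
      finally have "stars w F \<le> card {g\<in>F. w (k \<otimes> g) = None} + card ((K <#> F) - F)" by simp
      then have "real (stars w F) \<le> card {g\<in>F. w (k \<otimes> g) = None} + real (card ((K <#> F) - F))" by linarith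
      also have "real (card {g\<in>F. w (k \<otimes> g) = None}) = (\<Sum>g\<in>F. of_bool (w (k \<otimes> g) = None))"
        using Ff(1) by (simp add: of_bool_def flip: sum.inter_filter)
      finally show "real (stars w F) - e/2 * card F \<le> (\<Sum>g\<in>F. of_bool (w (k \<otimes> g) = None))"
        using F by (simp add: invariant_set_def)
    qed
    then have "card K * (real (stars w F) - e/2 * card F) \<le> card K * (q * card F)" using 1 by simp
    then have "real (stars w F) - e/2 * card F \<le> q * card F" using cK by simp
    also have "\<dots> \<le> (star_density W + e/2) * card F"
      using \<open>q < star_density W + e/2\<close> by (intro mult_right_mono) auto
    finally show "real (stars w F) \<le> (star_density W + e) * card F" by (simp add: algebra_simps)
  qed (use K e in auto)
qed

definition refines_stars :: "('a \<Rightarrow> 'p option) set \<Rightarrow> ('a \<Rightarrow> 'p option) set \<Rightarrow> bool" where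
  "refines_stars W' W \<longleftrightarrow> (\<forall>w'\<in>W'. \<exists>w\<in>W. \<forall>g\<in>carrier G. w g \<noteq> None \<longrightarrow> w' g = w g)"

lemma refines_stars_trans: "refines_stars W'' W' \<Longrightarrow> refines_stars W' W \<Longrightarrow> refines_stars W'' W"
  unfolding refines_stars_def by (metis (no_types, lifting))

lemma refines_stars_refl: "refines_stars W W"
  unfolding refines_stars_def by blast

end

section \<open>Writing a pattern at a maximal separated set of places\<close>

context group begin

text \<open>Separation passes to unions of chains, so Zorn's lemma gives a maximal \<open>S\<close>.
  An element \<open>r\<close> of \<open>R\<close> for which \<open>N r\<close> misses
  \<open>S\<close> could be added; here closure of \<open>N\<close> under inverses makes separation
  symmetric.\<close>

lemma maximal_separated_subset:
  assumes N: "N \<subseteq> carrier G" "\<one> \<in> N" "\<And>h. h \<in> N \<Longrightarrow> inv h \<in> N" and R: "R \<subseteq> carrier G"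
  obtains S where "S \<subseteq> R" "\<And>s h. s \<in> S \<Longrightarrow> h \<in> N \<Longrightarrow> h \<noteq> \<one> \<Longrightarrow> h \<otimes> s \<notin> S"
    "\<And>r. r \<in> R \<Longrightarrow> \<exists>h\<in>N. h \<otimes> r \<in> S"
proof -
  define sep where "sep S \<longleftrightarrow> (\<forall>s\<in>S. \<forall>h\<in>N. h \<noteq> \<one> \<longrightarrow> h \<otimes> s \<notin> S)" for S
  have "\<exists>M\<in>{S. S \<subseteq> R \<and> sep S}. \<forall>X\<in>{S. S \<subseteq> R \<and> sep S}. M \<subseteq> X \<longrightarrow> X = M"
  proof (rule subset_Zorn)
    fix \<C> assume C: "subset.chain {S. S \<subseteq> R \<and> sep S} \<C>"
    then have ch: "A \<subseteq> B \<or> B \<subseteq> A" if "A \<in> \<C>" "B \<in> \<C>" for A B using that by (simp add: subset_chain_def)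
    have CR: "A \<subseteq> R" "sep A" if "A \<in> \<C>" for A using C that by (auto simp: subset_chain_def)
    have "sep (\<Union>\<C>)" unfolding sep_def
    proof (intro ballI impI notI)
      fix s h assume s: "s \<in> \<Union>\<C>" "h \<in> N" "h \<noteq> \<one>" "h \<otimes> s \<in> \<Union>\<C>"
      then obtain A B where "A \<in> \<C>" "s \<in> A" "B \<in> \<C>" "h \<otimes> s \<in> B" by blast
      then obtain D where "D \<in> \<C>" "s \<in> D" "h \<otimes> s \<in> D" using ch by blast
      then show False using CR(2)[of D] s by (auto simp: sep_def)
    qed
    then show "\<exists>U\<in>{S. S \<subseteq> R \<and> sep S}. \<forall>X\<in>\<C>. X \<subseteq> U" using CR(1) by (intro bexI[of _ "\<Union>\<C>"]) auto
  qed
  then obtain S where S: "S \<subseteq> R" "sep S" and max: "\<And>X. X \<subseteq> R \<Longrightarrow> sep X \<Longrightarrow> S \<subseteq> X \<Longrightarrow> X = S" by auto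
  show ?thesis
  proof (rule that[OF S(1)])
    show "h \<otimes> s \<notin> S" if "s \<in> S" "h \<in> N" "h \<noteq> \<one>" for s h using S(2) that by (auto simp: sep_def)
    fix r assume r: "r \<in> R"
    show "\<exists>h\<in>N. h \<otimes> r \<in> S"
    proof (rule ccontr)
      assume no: "\<not> ?thesis"
      have rc: "r \<in> carrier G" using r R by auto
      have "sep (insert r S)" unfolding sep_def
      proof (intro ballI impI notI)
        fix s h assume s: "s \<in> insert r S" "h \<in> N" "h \<noteq> \<one>" "h \<otimes> s \<in> insert r S"
        have hc: "h \<in> carrier G" using s N by auto
        consider "s = r" "h \<otimes> s = r" | "s = r" "h \<otimes> s \<in> S" | "s \<in> S" "h \<otimes> s = r" | "s \<in> S" "h \<otimes> s \<in> S" using s by auto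
        then show False
        proof cases
          case 1 then show False using rc hc s(3) by simp
        next
          case 2 then show False using no s(2) by auto
        next
          case 3
          have "s \<in> carrier G" using 3 S(1) R by auto
          then have "inv h \<otimes> r = s" using 3 hc by (simp add: m_assoc[symmetric] flip: 3(2))
          then show False using no N(3)[OF s(2)] 3 by auto
        next
          case 4 then show False using S(2) s by (auto simp: sep_def)
        qed
      qed
      then have "insert r S = S" using max[of "insert r S"] S(1) r by auto
      then have "\<one> \<otimes> r \<in> S" using rc by auto
      then show False using no N(2) by blast
    qed
  qed
qed

text \<open>\<open>w'\<close> arises from \<open>w\<close> by writing \<open>\<mu>\<close> at a maximal \<open>N\<close>-separated set \<open>S\<close> of occurrences of \<open>v\<close>.\<close>

definition fills :: "'a set \<Rightarrow> ('a \<Rightarrow> 'p option) \<Rightarrow> ('a \<Rightarrow> 'p option) \<Rightarrow> ('a \<Rightarrow> 'p option) \<Rightarrow> ('a \<Rightarrow> 'p option) \<Rightarrow> 'a set \<Rightarrow> bool" where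
  "fills N \<mu> v w w' S \<longleftrightarrow> S \<subseteq> carrier G \<and> S \<noteq> {} \<and>
     (\<forall>s\<in>S. \<forall>h\<in>N. h \<noteq> \<one> \<longrightarrow> h \<otimes> s \<notin> S) \<and>
     (\<forall>s\<in>S. \<forall>f\<in>dom \<mu>. w (f \<otimes> s) = v f \<and> w' (f \<otimes> s) = \<mu> f) \<and>
     (\<forall>g\<in>carrier G. (\<forall>f\<in>dom \<mu>. w (f \<otimes> g) = v f) \<longrightarrow> (\<exists>h\<in>N. h \<otimes> g \<in> S)) \<and>
     (\<forall>g\<in>carrier G. (\<forall>f\<in>dom \<mu>. \<forall>s\<in>S. g \<noteq> f \<otimes> s) \<longrightarrow> w' g = w g)"

text \<open>For \<open>N\<close> of this form, \<open>S\<close> is \<open>N\<close>-separated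
  exactly if the translates \<open>T s\<close> are pairwise disjoint; this will bound the number of
  marks.\<close>

lemma difference_set_props:
  assumes "T \<subseteq> carrier G" "T \<noteq> {}" "finite T"
  defines "N \<equiv> (m_inv G ` T) <#> T"
  shows "N \<subseteq> carrier G" "\<one> \<in> N" "h \<in> N \<Longrightarrow> inv h \<in> N" "finite N"
proof -
  show "N \<subseteq> carrier G" using assms by (auto simp: N_def set_mult_def)
  obtain t where "t \<in> T" using assms by auto
  then have "inv t \<otimes> t \<in> N" "t \<in> carrier G" using assms by (auto simp: N_def set_mult_def)
  then show "\<one> \<in> N" by simp
  show "inv h \<in> N" if h: "h \<in> N"
  proof -
    obtain s t where st: "s \<in> T" "t \<in> T" "h = inv s \<otimes> t" using h by (auto simp: N_def set_mult_def)
    then have "s \<in> carrier G" "t \<in> carrier G" using assms by auto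
    then have "inv h = inv t \<otimes> s" using st by (simp add: inv_mult_group)
    then show ?thesis using st by (auto simp: N_def set_mult_def)
  qed
  show "finite N" using assms by (auto simp: N_def intro: finite_set_mult)
qed

text \<open>Words of \<open>W\<close> are paired with marks subject to the local rule
  \<open>loc\<close>: marks are separated, sit at occurrences of \<open>v\<close>, and are maximal.
  On a minimal subset \<open>M\<close> of this system two block codes act. Forgetting the marks maps
  \<open>M\<close> onto \<open>W\<close>, by minimality of \<open>W\<close>; writing
  \<open>\<mu>\<close> at the marks gives \<open>W'\<close>. As both are images of the same
  \<open>M\<close>, the correspondence holds in both directions.\<close>

lemma fill_exists:
  fixes W :: "('a \<Rightarrow> 'p option) set"
  assumes W: "minimal_subshift (discrete_topology A) W" and A: "finite A"
    and T: "finite T" "T \<noteq> {}" "T \<subseteq> carrier G"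
    and \<mu>: "dom \<mu> \<subseteq> T" and v: "v \<in> W"
  defines "N \<equiv> (m_inv G ` T) <#> T"
  obtains W' where "minimal_subshift (discrete_topology (A \<union> \<mu> ` dom \<mu>)) W'"
    "\<And>w'. w' \<in> W' \<Longrightarrow> \<exists>w\<in>W. \<exists>S. fills N \<mu> v w w' S"
    "\<And>w. w \<in> W \<Longrightarrow> \<exists>w'\<in>W'. \<exists>S. fills N \<mu> v w w' S"
proof -
  note N = difference_set_props[OF T(3,2,1), folded N_def]
  define F where "F = dom \<mu>"
  have F: "finite F" "F \<subseteq> carrier G" "F \<subseteq> T" using \<mu> T by (auto simp: F_def intro: finite_subset)
  have WX: "subshift G (discrete_topology A) W" "W \<noteq> {}" using W by (auto simp: minimal_subshift_def)
  define B where "B = A \<times> (UNIV :: bool set)"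
  have B: "finite B" using A by (simp add: B_def)
  let ?T = "full_shift G (discrete_topology B)"
  define loc :: "('a \<Rightarrow> 'p option \<times> bool) \<Rightarrow> bool" where
    "loc c \<longleftrightarrow> (snd (c \<one>) \<longrightarrow> (\<forall>h\<in>N-{\<one>}. \<not> snd (c h)) \<and> (\<forall>f\<in>F. fst (c f) = v f)) \<and>
       ((\<forall>f\<in>F. fst (c f) = v f) \<longrightarrow> (\<exists>h\<in>N. snd (c h)))" for c
  define E where "E = insert \<one> (N \<union> F)"
  have E: "finite E" "E \<subseteq> carrier G" "\<one> \<in> E" "N \<subseteq> E" "F \<subseteq> E" using N F by (auto simp: E_def)
  have loc_dep: "depends_on E loc" unfolding depends_on_def
  proof (intro allI impI)
    fix x y :: "'a \<Rightarrow> 'p option \<times> bool" assume *: "\<forall>e\<in>E. x e = y e"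
    then have "x \<one> = y \<one>" "\<And>h. h \<in> N \<Longrightarrow> x h = y h" "\<And>f. f \<in> F \<Longrightarrow> x f = y f" using E by auto
    then show "loc x = loc y" by (simp add: loc_def)
  qed
  define \<psi>1 :: "('a \<Rightarrow> 'p option \<times> bool) \<Rightarrow> 'p option" where "\<psi>1 c = fst (c \<one>)" for c
  have \<psi>1_dep: "depends_on {\<one>} \<psi>1" by (simp add: depends_on_def \<psi>1_def)
  define E2 where "E2 = insert \<one> (m_inv G ` F)"
  \<comment> \<open>On marked words at most one \<open>f\<close> qualifies, because marks are
    separated; \<open>SOME\<close> then names it.\<close>
  define \<psi>2 :: "('a \<Rightarrow> 'p option \<times> bool) \<Rightarrow> 'p option" where
    "\<psi>2 c = (if \<exists>f\<in>F. snd (c (inv f)) then \<mu> (SOME f. f \<in> F \<and> snd (c (inv f))) else fst (c \<one>))" for c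
  have E2: "finite E2" "E2 \<subseteq> carrier G" using F by (auto simp: E2_def)
  have \<psi>2_dep: "depends_on E2 \<psi>2" unfolding depends_on_def
  proof (intro allI impI)
    fix x y :: "'a \<Rightarrow> 'p option \<times> bool" assume *: "\<forall>e\<in>E2. x e = y e"
    then have "x \<one> = y \<one>" and 1: "\<And>f. f \<in> F \<Longrightarrow> x (inv f) = y (inv f)" by (auto simp: E2_def)
    moreover have "(\<lambda>f. f \<in> F \<and> snd (x (inv f))) = (\<lambda>f. f \<in> F \<and> snd (y (inv f)))" using 1 by auto
    ultimately show "\<psi>2 x = \<psi>2 y" by (simp add: \<psi>2_def)
  qed
  have c1: "continuous_map ?T (full_shift G (discrete_topology A)) (block_map \<psi>1)"
  proof (rule continuous_map_block_map[OF _ _ \<psi>1_dep])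
    fix c assume "c \<in> topspace ?T"
    then have "c \<one> \<in> B" by (auto simp: topspace_full_shift PiE_iff)
    then show "\<psi>1 c \<in> A" by (auto simp: \<psi>1_def B_def)
  qed auto
  have c2: "continuous_map ?T (full_shift G (discrete_topology (A \<union> \<mu> ` dom \<mu>))) (block_map \<psi>2)"
  proof (rule continuous_map_block_map[OF E2 \<psi>2_dep])
    fix c assume "c \<in> topspace ?T"
    then have "c \<one> \<in> B" by (auto simp: topspace_full_shift PiE_iff)
    moreover have "(SOME f. f \<in> F \<and> snd (c (inv f))) \<in> F" if "\<exists>f\<in>F. snd (c (inv f))"
      using someI_ex[of "\<lambda>f. f \<in> F \<and> snd (c (inv f))"] that by blast
    ultimately show "\<psi>2 c \<in> A \<union> \<mu> ` dom \<mu>" by (auto simp: \<psi>2_def B_def F_def)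
  qed
  define Y where "Y = {c\<in>topspace ?T. block_map \<psi>1 c \<in> W} \<inter> (\<Inter>g\<in>carrier G. {c\<in>topspace ?T. loc (shift_map G g c)})"
  have Ysub: "subshift G (discrete_topology B) Y" unfolding subshift_def
  proof (intro conjI ballI)
    have "closedin ?T {c\<in>topspace ?T. block_map \<psi>1 c \<in> W}"
      using c1 WX(1) by (intro closedin_continuous_map_preimage) (auto simp: subshift_def)
    moreover have "closedin ?T {c\<in>topspace ?T. loc (shift_map G g c)}" if "g \<in> carrier G" for g
      using depends_on_shift_map[OF E(2) loc_dep that] E(1)
      by (intro closedin_full_shift_depends_on[of "E #> g"]) (auto intro: r_coset_finite)
    ultimately show "closedin ?T Y" unfolding Y_def by (intro closedin_Int closedin_Inter) auto
    fix g assume g: "g \<in> carrier G"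
    show "shift_map G g ` Y \<subseteq> Y"
      using g shift_map_in_topspace[OF _ g] subshift_shift[OF WX(1) g]
      by (auto simp: Y_def block_map_shift shift_map_shift_map)
  qed
  have "Y \<noteq> {}"
  proof -
    obtain w where w: "w \<in> W" using WX by auto
    then have wA: "w \<in> (\<Pi>\<^sub>E g\<in>carrier G. A)" using subshift_subset[OF WX(1)] by (auto simp: topspace_full_shift)
    define R where "R = {s\<in>carrier G. \<forall>f\<in>F. w (f \<otimes> s) = v f}"
    have "R \<subseteq> carrier G" by (auto simp: R_def)
    then obtain S where S: "S \<subseteq> R" "\<And>s h. s \<in> S \<Longrightarrow> h \<in> N \<Longrightarrow> h \<noteq> \<one> \<Longrightarrow> h \<otimes> s \<notin> S"
      "\<And>r. r \<in> R \<Longrightarrow> \<exists>h\<in>N. h \<otimes> r \<in> S"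
      using maximal_separated_subset[OF N(1-3)] by metis
    define c where "c = (\<lambda>g\<in>carrier G. (w g, g \<in> S))"
    have ca: "c g = (w g, g \<in> S)" if "g \<in> carrier G" for g using that by (simp add: c_def)
    have "c \<in> topspace ?T" using wA by (auto simp: c_def topspace_full_shift B_def)
    moreover have "block_map \<psi>1 c = w"
      using wA by (auto simp: fun_eq_iff block_map_def \<psi>1_def shift_map_def c_def PiE_iff extensional_def)
    moreover have "loc (shift_map G g c)" if g: "g \<in> carrier G" for g
    proof -
      have *: "shift_map G g c h = (w (h \<otimes> g), h \<otimes> g \<in> S)" if "h \<in> carrier G" for h
        using that g by (simp add: shift_map_apply ca)
      have R: "(\<forall>f\<in>F. fst (shift_map G g c f) = v f) \<longleftrightarrow> g \<in> R" using g F * by (auto simp: R_def subset_iff)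
      show ?thesis unfolding loc_def R using S N g * by (auto simp: subset_iff)
    qed
    ultimately have "c \<in> Y" using w by (auto simp: Y_def)
    then show ?thesis by auto
  qed
  then obtain M where M: "minimal_subshift (discrete_topology B) M" "M \<subseteq> Y"
    using minimal_subshift_exists[OF _ Ysub] B by (metis compact_space_discrete_topology)
  have cB: "compact_space (discrete_topology B)" using B by (simp add: compact_space_discrete_topology)
  have M1: "minimal_subshift (discrete_topology A) (block_map \<psi>1 ` M)"
    by (rule minimal_subshift_equivariant_image[OF cB _ M(1) c1]) (auto simp: block_map_shift)
  moreover have "block_map \<psi>1 ` M \<subseteq> W" using M(2) by (auto simp: Y_def)
  ultimately have M1W: "block_map \<psi>1 ` M = W" using W unfolding minimal_subshift_def by blast
  have M2: "minimal_subshift (discrete_topology (A \<union> \<mu> ` dom \<mu>)) (block_map \<psi>2 ` M)"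
    by (rule minimal_subshift_equivariant_image[OF cB _ M(1) c2]) (auto simp: block_map_shift)
  have key: "fills N \<mu> v (block_map \<psi>1 c) (block_map \<psi>2 c) {s\<in>carrier G. snd (c s)}" if c: "c \<in> M" for c
  proof -
    let ?S = "{s\<in>carrier G. snd (c s)}" and ?w = "block_map \<psi>1 c" and ?w' = "block_map \<psi>2 c"
    have w: "?w g = fst (c g)" if "g \<in> carrier G" for g
      using that by (simp add: block_map_apply \<psi>1_def shift_map_apply)
    have w': "?w' g = (if \<exists>f\<in>F. snd (c (inv f \<otimes> g)) then \<mu> (SOME f. f \<in> F \<and> snd (c (inv f \<otimes> g))) else fst (c g))"
      if g: "g \<in> carrier G" for g
    proof -
      have "(\<lambda>f. f \<in> F \<and> snd (shift_map G g c (inv f))) = (\<lambda>f. f \<in> F \<and> snd (c (inv f \<otimes> g)))"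
        using F by (auto simp: shift_map_apply subset_iff fun_eq_iff)
      moreover have "(\<exists>f\<in>F. snd (shift_map G g c (inv f))) \<longleftrightarrow> (\<exists>f\<in>F. snd (c (inv f \<otimes> g)))"
        using F by (auto simp: shift_map_apply subset_iff)
      ultimately show ?thesis using g by (simp add: block_map_apply \<psi>2_def shift_map_apply)
    qed
    have loc: "loc (shift_map G g c)" if "g \<in> carrier G" for g using that c M(2) by (auto simp: Y_def)
    have sep: "\<not> snd (c (h \<otimes> s))" if "s \<in> ?S" "h \<in> N" "h \<noteq> \<one>" for s h
      using loc[of s] that N by (auto simp: loc_def shift_map_apply subset_iff)
    have ret: "?w (f \<otimes> s) = v f" if "s \<in> ?S" "f \<in> F" for s f
      using loc[of s] that F by (auto simp: loc_def shift_map_apply subset_iff w)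
    have max: "\<exists>h\<in>N. h \<otimes> g \<in> ?S" if g: "g \<in> carrier G" "\<forall>f\<in>F. ?w (f \<otimes> g) = v f" for g
    proof -
      have "\<forall>f\<in>F. fst (shift_map G g c f) = v f" using g F by (auto simp: shift_map_apply subset_iff w)
      then have "\<exists>h\<in>N. snd (shift_map G g c h)" using loc[OF g(1)] by (simp add: loc_def)
      then show ?thesis using N g by (auto simp: shift_map_apply subset_iff)
    qed
    \<comment> \<open>Minimality of \<open>W\<close> makes the pattern of \<open>v\<close> occur in
      this word too, and maximality of the marks then provides one.\<close>
    have "?w \<in> W" using M1W c by auto
    then obtain g where "g \<in> carrier G" "\<And>f. f \<in> F \<Longrightarrow> ?w (f \<otimes> g) = v f"
      using minimal_subshift_pattern_recurs[OF W v _ F(1,2)] by metis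
    then have ne: "?S \<noteq> {}" using max by blast
    have fill: "?w' (f \<otimes> s) = \<mu> f" if s: "s \<in> ?S" and f: "f \<in> F" for s f
    proof -
      have fs: "f \<in> carrier G" "s \<in> carrier G" using f s F by auto
      have "f' = f" if f': "f' \<in> F" "snd (c (inv f' \<otimes> (f \<otimes> s)))" for f'
      proof (rule ccontr)
        assume "f' \<noteq> f"
        have f'c: "f' \<in> carrier G" using f' F by auto
        have "inv f' \<otimes> f \<in> N" using f f' F by (auto simp: N_def set_mult_def)
        moreover have "inv f' \<otimes> f \<noteq> \<one>" using \<open>f' \<noteq> f\<close> fs f'c
          by (metis inv_closed inv_equality inv_inv)
        ultimately have "\<not> snd (c (inv f' \<otimes> f \<otimes> s))" using sep[OF s] by blast
        then show False using f'(2) fs f'c by (simp add: m_assoc)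
      qed
      moreover have "snd (c (inv f \<otimes> (f \<otimes> s)))" using fs s by (simp add: m_assoc[symmetric])
      ultimately have ex: "\<exists>f'\<in>F. snd (c (inv f' \<otimes> (f \<otimes> s)))" and
         some: "(SOME f'. f' \<in> F \<and> snd (c (inv f' \<otimes> (f \<otimes> s)))) = f"
        using f by (blast, intro some_equality) auto
      show ?thesis unfolding w'[OF m_closed[OF fs]] some using ex by simp
    qed
    have same: "?w' g = ?w g" if g: "g \<in> carrier G" "\<forall>f\<in>F. \<forall>s\<in>?S. g \<noteq> f \<otimes> s" for g
    proof -
      have "\<not> snd (c (inv f \<otimes> g))" if f: "f \<in> F" for f
      proof
        assume "snd (c (inv f \<otimes> g))"
        moreover have "f \<in> carrier G" using f F by auto
        ultimately have "inv f \<otimes> g \<in> ?S" "g = f \<otimes> (inv f \<otimes> g)" using g by (auto simp: m_assoc[symmetric])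
        then show False using g f by blast
      qed
      then show ?thesis using g w w' by auto
    qed
    show ?thesis unfolding fills_def F_def[symmetric]
    proof (intro conjI ballI impI)
      show "?S \<subseteq> carrier G" by auto
      show "h \<otimes> s \<notin> ?S" if "s \<in> ?S" "h \<in> N" "h \<noteq> \<one>" for s h using sep[OF that] by simp
    qed (fact ne | rule ret fill max same; assumption)+
  qed
  show ?thesis
  proof (rule that[OF M2])
    show "\<exists>w\<in>W. \<exists>S. fills N \<mu> v w w' S" if "w' \<in> block_map \<psi>2 ` M" for w'
      using that key M1W by blast
    show "\<exists>w'\<in>block_map \<psi>2 ` M. \<exists>S. fills N \<mu> v w w' S" if "w \<in> W" for w
      using that key unfolding M1W[symmetric] by blast
  qed
qed

text \<open>A letter of \<open>w\<close> at an overwritten place is a letter of \<open>v\<close>,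
  and \<open>\<mu>\<close> agrees with it; so only free coordinates change.\<close>

lemma fills_extends:
  assumes "fills N \<mu> v w w' S" "dom \<mu> \<subseteq> carrier G"
    and "\<And>f. f \<in> dom \<mu> \<Longrightarrow> v f \<noteq> None \<Longrightarrow> \<mu> f = v f"
    and g: "g \<in> carrier G" "w g \<noteq> None"
  shows "w' g = w g"
proof (cases "\<exists>f\<in>dom \<mu>. \<exists>s\<in>S. g = f \<otimes> s")
  case True
  then obtain f s where f: "f \<in> dom \<mu>" "s \<in> S" "g = f \<otimes> s" by blast
  then have "w g = v f" "w' g = \<mu> f" using assms(1) by (auto simp: fills_def)
  then show ?thesis using assms(3)[OF f(1)] g by simp
next
  case False
  then show ?thesis using assms(1) g unfolding fills_def by blast
qed

end

section \<open>How filling changes the density\<close>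

locale infinite_folner_group = group +
  fixes \<Phi> :: "nat \<Rightarrow> 'a set"
  assumes folner: "folner_sequence G \<Phi>" and infinite_carrier: "infinite (carrier G)"
begin

lemma invariant_set_exists:
  assumes "finite K" "K \<subseteq> carrier G" "0 < \<delta>"
  obtains F where "invariant_set G K \<delta> F"
  using eventually_happens[OF folner_eventually_invariant[OF folner assms]] by auto

lemma invariant_set_exists2:
  assumes "finite K" "K \<subseteq> carrier G" "0 < \<delta>" "finite K'" "K' \<subseteq> carrier G" "0 < \<delta>'"
  obtains F where "invariant_set G K \<delta> F" "invariant_set G K' \<delta>' F"
proof -
  obtain F where "invariant_set G (K \<union> K') (min \<delta> \<delta>') F"
    using invariant_set_exists[of "K \<union> K'" "min \<delta> \<delta>'"] assms by auto
  then show ?thesis using assms by (intro that[of F]; elim invariant_set_mono) auto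
qed

text \<open>Separation makes all products \<open>t \<otimes> s\<close> distinct, so every element of
  \<open>S \<inter> Z\<close> occupies \<open>card T\<close> elements of \<open>T Z\<close> of its
  own.\<close>

lemma separated_card_le:
  assumes T: "T \<subseteq> carrier G" "finite T" and N: "N = (m_inv G ` T) <#> T"
    and S: "S \<subseteq> carrier G" "\<And>s h. s \<in> S \<Longrightarrow> h \<in> N \<Longrightarrow> h \<noteq> \<one> \<Longrightarrow> h \<otimes> s \<notin> S"
    and Z: "finite Z"
  shows "card T * card (S \<inter> Z) \<le> card (T <#> Z)"
proof -
  have "inj_on (\<lambda>(t, s). t \<otimes> s) (T \<times> (S \<inter> Z))"
  proof (rule inj_onI, clarsimp)
    fix t s t' s' assume a: "t \<in> T" "s \<in> S" "s \<in> Z" "t' \<in> T" "s' \<in> S" "s' \<in> Z" "t \<otimes> s = t' \<otimes> s'"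
    then have c: "t \<in> carrier G" "s \<in> carrier G" "t' \<in> carrier G" "s' \<in> carrier G" using T S by auto
    have "(inv t' \<otimes> t) \<otimes> s = inv t' \<otimes> (t' \<otimes> s')" using a(7) c by (simp add: m_assoc)
    then have eq: "(inv t' \<otimes> t) \<otimes> s = s'" using c by (simp add: m_assoc[symmetric])
    moreover have "inv t' \<otimes> t \<in> N" using a N by (auto simp: set_mult_def)
    ultimately have "inv t' \<otimes> t = \<one>" using S(2) a by metis
    then have "s = s'" "t' \<otimes> (inv t' \<otimes> t) = t'" using eq c by auto
    then show "t = t' \<and> s = s'" using c by (simp add: m_assoc[symmetric])
  qed
  then have "card (T \<times> (S \<inter> Z)) = card ((\<lambda>(t, s). t \<otimes> s) ` (T \<times> (S \<inter> Z)))" by (simp add: card_image)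
  also have "\<dots> \<le> card (T <#> Z)"
    using T Z by (intro card_mono finite_set_mult) (auto simp: set_mult_def)
  finally show ?thesis by (simp add: card_cartesian_product)
qed

text \<open>A free coordinate lost in \<open>F\<close> has the form \<open>f \<otimes> s\<close>
  with \<open>f\<close> in \<open>dom \<mu>\<close> and a mark \<open>s\<close>, so the mark lies
  near \<open>F\<close>.\<close>

lemma fills_stars_ge:
  assumes f: "fills N \<mu> v w w' S" and \<mu>: "finite (dom \<mu>)" "dom \<mu> \<subseteq> carrier G"
    and F: "finite F" "F \<subseteq> carrier G"
  shows "stars w F \<le> stars w' F + card (dom \<mu>) * card (S \<inter> (m_inv G ` dom \<mu> <#> F))"
proof -
  let ?Z = "S \<inter> (m_inv G ` dom \<mu> <#> F)"
  have Z: "finite ?Z" using \<mu> F by (simp add: finite_set_mult)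
  have "{g\<in>F. w g = None} \<subseteq> {g\<in>F. w' g = None} \<union> (\<lambda>(f, s). f \<otimes> s) ` (dom \<mu> \<times> ?Z)"
  proof
    fix g assume g: "g \<in> {g\<in>F. w g = None}"
    then have gc: "g \<in> carrier G" using F by auto
    show "g \<in> {g\<in>F. w' g = None} \<union> (\<lambda>(f, s). f \<otimes> s) ` (dom \<mu> \<times> ?Z)"
    proof (cases "\<exists>f\<in>dom \<mu>. \<exists>s\<in>S. g = f \<otimes> s")
      case True
      then obtain f' s where fs: "f' \<in> dom \<mu>" "s \<in> S" "g = f' \<otimes> s" by blast
      then have "f' \<in> carrier G" "s \<in> carrier G" using \<mu> f by (auto simp: fills_def)
      then have "s = inv f' \<otimes> g" using fs by (simp add: m_assoc[symmetric])
      then have "s \<in> ?Z" using fs g by (auto simp: set_mult_def)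
      then show ?thesis using fs by force
    next
      case False
      then have "w' g = w g" using f gc unfolding fills_def by blast
      then show ?thesis using g by auto
    qed
  qed
  then have "stars w F \<le> card ({g\<in>F. w' g = None} \<union> (\<lambda>(f, s). f \<otimes> s) ` (dom \<mu> \<times> ?Z))"
    unfolding stars_def using F Z \<mu> by (intro card_mono) auto
  also have "\<dots> \<le> stars w' F + card ((\<lambda>(f, s). f \<otimes> s) ` (dom \<mu> \<times> ?Z))"
    unfolding stars_def by (rule card_Un_le)
  also have "\<dots> \<le> stars w' F + card (dom \<mu> \<times> ?Z)"
    using \<mu> Z by (intro add_left_mono card_image_le) auto
  finally show ?thesis by (simp add: card_cartesian_product)
qed

text \<open>Each mark costs at most \<open>card (dom \<mu>)\<close> free coordinates, and there are
  hardly more than \<open>card F / card T\<close> marks near \<open>F\<close>, because the sets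
  \<open>T s\<close> are disjoint and stay near \<open>F\<close>.\<close>

lemma star_density_fill_lower:
  assumes T: "finite T" "T \<noteq> {}" "T \<subseteq> carrier G" and N: "N = (m_inv G ` T) <#> T"
    and \<mu>: "dom \<mu> \<subseteq> T"
    and W: "W \<noteq> {}" and W': "\<And>g w. g \<in> carrier G \<Longrightarrow> w \<in> W' \<Longrightarrow> shift_map G g w \<in> W'"
    and fill: "\<And>w. w \<in> W \<Longrightarrow> \<exists>w'\<in>W'. \<exists>S. fills N \<mu> v w w' S"
  shows "star_density W - real (card (dom \<mu>)) / card T \<le> star_density W'"
proof (rule field_le_epsilon)
  fix e' :: real assume "0 < e'"
  \<comment> \<open>Three errors of size at most \<open>e\<close> occur: in the density of
    \<open>W\<close>, in that of \<open>W'\<close>, and in the invariance of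
    \<open>F\<close>.\<close>
  define e where "e = e' / 3"
  have e: "0 < e" using \<open>0 < e'\<close> by (simp add: e_def)
  have f\<mu>: "finite (dom \<mu>)" "dom \<mu> \<subseteq> carrier G" using \<mu> T by (auto intro: finite_subset)
  have cT: "0 < card T" using T by (simp add: card_gt_0_iff)
  obtain K \<delta> where K: "finite K" "K \<subseteq> carrier G" "0 < \<delta>"
    "\<And>F w. invariant_set G K \<delta> F \<Longrightarrow> w \<in> W' \<Longrightarrow> real (stars w F) \<le> (star_density W' + e) * card F"
    using star_density_upper[OF W' e] by metis
  \<comment> \<open>The translates of \<open>T\<close> at marks near \<open>F\<close> lie in
    \<open>?K' <#> F\<close>, so \<open>F\<close> is taken invariant under this set as well.\<close>
  let ?K' = "T <#> m_inv G ` dom \<mu>"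
  have K': "finite ?K'" "?K' \<subseteq> carrier G"
    using T f\<mu> by (auto intro: finite_set_mult simp: set_mult_def)
  obtain F where F: "invariant_set G K \<delta> F" "invariant_set G ?K' e F"
    using invariant_set_exists2[OF K(1-3) K' e] by blast
  have Ff: "finite F" "F \<noteq> {}" "F \<subseteq> carrier G" using F by (auto simp: invariant_set_def)
  have cF: "0 < real (card F)" using Ff by (simp add: card_gt_0_iff)
  obtain w where w: "w \<in> W" "(star_density W - e) * card F < stars w F"
    using star_density_less[OF W, of "star_density W - e" F] Ff e by auto
  obtain w' S where w': "w' \<in> W'" "fills N \<mu> v w w' S" using fill[OF w(1)] by blast
  let ?Z = "m_inv G ` dom \<mu> <#> F"
  have "card T * card (S \<inter> ?Z) \<le> card (T <#> ?Z)"
    using w'(2) T f\<mu> Ff by (intro separated_card_le[OF _ _ N]) (auto simp: fills_def intro: finite_set_mult)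
  also have "T <#> ?Z = ?K' <#> F"
    using T f\<mu> Ff by (subst set_mult_assoc) auto
  finally have "real (card T) * card (S \<inter> ?Z) \<le> real (card (?K' <#> F))" by (simp flip: of_nat_mult)
  also have "\<dots> \<le> (1 + e) * card F" by (rule invariant_set_card_mult[OF F(2) K'(1)])
  finally have 1: "real (card (S \<inter> ?Z)) \<le> (1 + e) * card F / card T"
    using cT by (simp add: field_simps)
  have "real (stars w F) \<le> stars w' F + real (card (dom \<mu>)) * card (S \<inter> ?Z)"
    using fills_stars_ge[OF w'(2) f\<mu> Ff(1,3)] by (simp flip: of_nat_mult of_nat_add)
  also have "\<dots> \<le> (star_density W' + e) * card F + real (card (dom \<mu>)) * ((1 + e) * card F / card T)"
    using K(4)[OF F(1) w'(1)] 1 by (intro add_mono mult_left_mono) auto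
  finally have "(star_density W - e) * card F < ((star_density W' + e) + real (card (dom \<mu>)) / card T * (1 + e)) * card F"
    using w(2) by (simp add: algebra_simps)
  then have "star_density W - e < (star_density W' + e) + real (card (dom \<mu>)) / card T * (1 + e)"
    using cF by (simp only: mult_less_cancel_right_pos)
  moreover have "real (card (dom \<mu>)) / card T * e \<le> 1 * e"
    using e cT \<mu> T by (intro mult_right_mono) (auto simp: card_mono)
  ultimately show "star_density W - real (card (dom \<mu>)) / card T \<le> star_density W' + e'"
  proof -
    have "real (card (dom \<mu>)) / card T * (1 + e) = real (card (dom \<mu>)) / card T + real (card (dom \<mu>)) / card T * e"
      by (simp add: distrib_left)
    moreover have "e' = 3 * e" by (simp add: e_def)
    ultimately show ?thesis
      using \<open>star_density W - e < (star_density W' + e) + real (card (dom \<mu>)) / card T * (1 + e)\<close>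
        \<open>real (card (dom \<mu>)) / card T * e \<le> 1 * e\<close> by linarith
  qed
qed

text \<open>When the pattern is a single free coordinate, every free coordinate of \<open>w\<close>
  is an occurrence, so maximality puts a mark in its \<open>N\<close>-neighbourhood. Up to boundary
  effects the marks make up a fraction of at least \<open>1 / card N\<close> of the free
  coordinates, and each of them is filled.\<close>

lemma star_density_fill_upper:
  assumes T: "finite T" "T \<noteq> {}" "T \<subseteq> carrier G" and N: "N = (m_inv G ` T) <#> T"
    and \<mu>: "\<mu> = [\<one> \<mapsto> p]" and v: "v \<one> = None"
    and W: "\<And>g w. g \<in> carrier G \<Longrightarrow> w \<in> W \<Longrightarrow> shift_map G g w \<in> W" and W': "W' \<noteq> {}"
    and fill: "\<And>w'. w' \<in> W' \<Longrightarrow> \<exists>w\<in>W. \<exists>S. fills N \<mu> v w w' S"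
  shows "star_density W' \<le> (1 - 1 / card N) * star_density W"
proof (rule field_le_epsilon)
  fix e' :: real assume "0 < e'"
  define e where "e = e' / 2"
  have e: "0 < e" using \<open>0 < e'\<close> by (simp add: e_def)
  note Np = difference_set_props[OF T(3,2,1), folded N]
  have cN: "0 < card N" using Np by (auto simp: card_gt_0_iff)
  obtain K \<delta> where K: "finite K" "K \<subseteq> carrier G" "0 < \<delta>"
    "\<And>F w. invariant_set G K \<delta> F \<Longrightarrow> w \<in> W \<Longrightarrow> real (stars w F) \<le> (star_density W + e) * card F"
    using star_density_upper[OF W e] by metis
  obtain F where F: "invariant_set G K \<delta> F" "invariant_set G N e F"
    using invariant_set_exists2[OF K(1-3) Np(4,1) e] by blast
  have Ff: "finite F" "F \<noteq> {}" "F \<subseteq> carrier G" using F by (auto simp: invariant_set_def)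
  show "star_density W' \<le> (1 - 1 / card N) * star_density W + e'"
  proof (rule star_density_le[OF W' Ff])
    fix w' assume "w' \<in> W'"
    then obtain w S where w: "w \<in> W" "fills N \<mu> v w w' S" using fill by blast
    have S: "S \<subseteq> carrier G" using w(2) by (simp add: fills_def)
    have Ss: "w s = None" "w' s \<noteq> None" if "s \<in> S" for s
    proof -
      have "w (\<one> \<otimes> s) = None" "w' (\<one> \<otimes> s) = Some p" using w(2) that v \<mu> by (auto simp: fills_def)
      then show "w s = None" "w' s \<noteq> None" using S that by auto
    qed
    have ext: "w' g = w g" if "g \<in> carrier G" "w g \<noteq> None" for g
      using fills_extends[OF w(2)] \<mu> v that by auto
    have "{g\<in>F. w' g = None} \<inter> (S \<inter> F) = {}" using Ss(2) by blast
    then have "stars w' F + card (S \<inter> F) = card ({g\<in>F. w' g = None} \<union> (S \<inter> F))"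
      unfolding stars_def using Ff(1) by (intro card_Un_disjoint[symmetric]) simp_all
    also have "\<dots> \<le> stars w F" unfolding stars_def
    proof (rule card_mono)
      show "{g\<in>F. w' g = None} \<union> (S \<inter> F) \<subseteq> {g\<in>F. w g = None}"
      proof -
        have "w g = None" if "g \<in> F" "w' g = None" for g
          using ext[of g] that Ff(3) by (cases "w g = None") auto
        then show ?thesis using Ss(1) by blast
      qed
    qed (use Ff in auto)
    finally have 1: "real (stars w' F) \<le> real (stars w F) - card (S \<inter> F)" by linarith
    have NF: "finite (N <#> F)" using Np Ff by (simp add: finite_set_mult)
    have "{g\<in>F. w g = None} \<subseteq> (\<lambda>(h, s). inv h \<otimes> s) ` (N \<times> (S \<inter> (N <#> F)))"
    proof
      fix g assume g: "g \<in> {g\<in>F. w g = None}"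
      then have gc: "g \<in> carrier G" using Ff by auto
      have "\<forall>f\<in>dom \<mu>. w (f \<otimes> g) = v f" using g gc \<mu> v by auto
      then obtain h where h: "h \<in> N" "h \<otimes> g \<in> S" using w(2) gc unfolding fills_def by blast
      then have "h \<in> carrier G" using Np by auto
      then have "g = inv h \<otimes> (h \<otimes> g)" using gc by (simp add: m_assoc[symmetric])
      moreover have "h \<otimes> g \<in> N <#> F" using h g by (auto simp: set_mult_def)
      ultimately show "g \<in> (\<lambda>(h, s). inv h \<otimes> s) ` (N \<times> (S \<inter> (N <#> F)))" using h by force
    qed
    then have "stars w F \<le> card ((\<lambda>(h, s). inv h \<otimes> s) ` (N \<times> (S \<inter> (N <#> F))))"
      unfolding stars_def using NF Np by (intro card_mono) auto
    also have "\<dots> \<le> card (N \<times> (S \<inter> (N <#> F)))" using NF Np by (intro card_image_le) auto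
    finally have 2: "stars w F \<le> card N * card (S \<inter> (N <#> F))" by (simp add: card_cartesian_product)
    \<comment> \<open>Marks outside \<open>F\<close> may serve free coordinates inside
      \<open>F\<close>; invariance makes them few.\<close>
    have "card (S \<inter> (N <#> F)) \<le> card ((S \<inter> F) \<union> ((N <#> F) - F))" using NF Ff by (intro card_mono) auto
    also have "\<dots> \<le> card (S \<inter> F) + card ((N <#> F) - F)" by (rule card_Un_le)
    finally have "stars w F \<le> card N * (card (S \<inter> F) + card ((N <#> F) - F))"
      using 2 by (meson le_trans mult_le_mono2)
    then have "real (stars w F) \<le> card N * (real (card (S \<inter> F)) + card ((N <#> F) - F))"
      by (simp flip: of_nat_mult of_nat_add)
    then have "real (stars w F) / card N \<le> real (card (S \<inter> F)) + card ((N <#> F) - F)"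
      using cN by (simp add: field_simps)
    also have "real (card ((N <#> F) - F)) \<le> e * card F" using F(2) by (simp add: invariant_set_def)
    finally have 3: "real (stars w F) / card N \<le> real (card (S \<inter> F)) + e * card F" by simp
    have n: "0 \<le> 1 - 1 / real (card N)" using cN by simp
    have "real (stars w' F) \<le> (1 - 1 / card N) * stars w F + e * card F"
      using 1 3 by (simp add: algebra_simps)
    also have "\<dots> \<le> (1 - 1 / card N) * ((star_density W + e) * card F) + e * card F"
      using K(4)[OF F(1) w(1)] n by (intro add_right_mono mult_left_mono) auto
    also have "\<dots> = ((1 - 1 / card N) * star_density W + (1 - 1 / card N) * e + e) * card F"
      by (simp add: algebra_simps)
    also have "\<dots> \<le> ((1 - 1 / card N) * star_density W + e') * card F"
    proof (rule mult_right_mono)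
      have "(1 - 1 / card N) * e \<le> 1 * e" using e cN by (intro mult_right_mono) auto
      moreover have "e' = e + e" by (simp add: e_def)
      ultimately show "(1 - 1 / card N) * star_density W + (1 - 1 / card N) * e + e \<le> (1 - 1 / card N) * star_density W + e'"
        by linarith
    qed simp
    finally show "real (stars w' F) \<le> ((1 - 1 / card N) * star_density W + e') * card F" .
  qed
qed

section \<open>Systems with finitely many letters and the decreasing sequence\<close>

definition star_system :: "'p set \<Rightarrow> ('a \<Rightarrow> 'p option) set \<Rightarrow> bool" where
  "star_system D W \<longleftrightarrow> (\<exists>A. finite A \<and> A \<subseteq> insert None (Some ` D) \<and> minimal_subshift (discrete_topology A) W)"

lemma star_system_nonempty: "star_system D W \<Longrightarrow> W \<noteq> {}"
  by (auto simp: star_system_def minimal_subshift_def)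

lemma star_system_shift: "star_system D W \<Longrightarrow> g \<in> carrier G \<Longrightarrow> w \<in> W \<Longrightarrow> shift_map G g w \<in> W"
  by (auto simp: star_system_def minimal_subshift_def intro: subshift_shift)

lemma star_system_fill:
  assumes W: "star_system D W" and T: "finite T" "T \<noteq> {}" "T \<subseteq> carrier G"
    and \<mu>: "dom \<mu> \<subseteq> T" "ran \<mu> \<subseteq> D"
    and v: "v \<in> W" "\<And>f. f \<in> dom \<mu> \<Longrightarrow> v f \<noteq> None \<Longrightarrow> \<mu> f = v f"
  defines "N \<equiv> (m_inv G ` T) <#> T"
  obtains W' where "star_system D W'" "refines_stars W' W"
    "star_density W - real (card (dom \<mu>)) / card T \<le> star_density W'"
    "\<And>w'. w' \<in> W' \<Longrightarrow> \<exists>g\<in>carrier G. \<forall>f\<in>dom \<mu>. w' (f \<otimes> g) = \<mu> f"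
    "\<And>w'. w' \<in> W' \<Longrightarrow> \<exists>w\<in>W. \<exists>S. fills N \<mu> v w w' S"
proof -
  obtain A where A: "finite A" "A \<subseteq> insert None (Some ` D)" "minimal_subshift (discrete_topology A) W"
    using W by (auto simp: star_system_def)
  obtain W' where W': "minimal_subshift (discrete_topology (A \<union> \<mu> ` dom \<mu>)) W'"
    "\<And>w'. w' \<in> W' \<Longrightarrow> \<exists>w\<in>W. \<exists>S. fills N \<mu> v w w' S"
    "\<And>w. w \<in> W \<Longrightarrow> \<exists>w'\<in>W'. \<exists>S. fills N \<mu> v w w' S"
    using fill_exists[OF A(3,1) T \<mu>(1) v(1), folded N_def] by metis
  have d: "finite (dom \<mu>)" "dom \<mu> \<subseteq> carrier G" using finite_subset[OF \<mu>(1) T(1)] \<mu>(1) T(3) by auto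
  have sys: "star_system D W'" unfolding star_system_def
  proof (intro exI conjI)
    show "finite (A \<union> \<mu> ` dom \<mu>)" using A d by auto
    show "A \<union> \<mu> ` dom \<mu> \<subseteq> insert None (Some ` D)" using A(2) \<mu>(2) by (auto simp: ran_def subset_iff)
  qed (rule W'(1))
  show ?thesis
  proof (rule that[OF sys])
    show "refines_stars W' W" unfolding refines_stars_def
    proof (intro ballI)
      fix w' assume "w' \<in> W'"
      then obtain w S where "w \<in> W" "fills N \<mu> v w w' S" using W'(2) by blast
      then show "\<exists>w\<in>W. \<forall>g\<in>carrier G. w g \<noteq> None \<longrightarrow> w' g = w g"
        using fills_extends[OF _ d(2) v(2)] by blast
    qed
    show "star_density W - real (card (dom \<mu>)) / card T \<le> star_density W'"
      using star_density_fill_lower[OF T N_def[THEN meta_eq_to_obj_eq] \<mu>(1) star_system_nonempty[OF W] star_system_shift[OF sys] W'(3)] .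
    show "\<exists>g\<in>carrier G. \<forall>f\<in>dom \<mu>. w' (f \<otimes> g) = \<mu> f" if "w' \<in> W'" for w'
    proof -
      obtain w S where "fills N \<mu> v w w' S" using W'(2) \<open>w' \<in> W'\<close> by blast
      then obtain s where "s \<in> S" "S \<subseteq> carrier G" "\<forall>s\<in>S. \<forall>f\<in>dom \<mu>. w' (f \<otimes> s) = \<mu> f"
        unfolding fills_def by blast
      then show ?thesis by blast
    qed
  qed (rule W'(2))
qed

text \<open>This is where the group has to be infinite: a window that is large compared with a
  pattern makes writing the pattern cheap.\<close>

lemma large_finite_subset:
  assumes "finite E" "E \<subseteq> carrier G"
  obtains T where "finite T" "E \<subseteq> T" "T \<subseteq> carrier G" "n \<le> card T"
proof -
  have "infinite (carrier G - E)" using infinite_carrier assms by simp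
  then obtain U where U: "finite U" "card U = n" "U \<subseteq> carrier G - E" by (meson infinite_arbitrarily_large)
  have "card U \<le> card (E \<union> U)" using U assms by (intro card_mono) auto
  then show ?thesis using U assms by (intro that[of "E \<union> U"]) auto
qed

text \<open>Let \<open>m\<close> be the infimum of the densities above \<open>c\<close> of
  refinements of \<open>W\<close>, and suppose \<open>c + e \<le> m\<close>. The window
  \<open>T\<close> depends on \<open>e\<close> only, so a refinement with density close enough to
  \<open>m\<close> can be chosen afterwards. Filling it once costs less than \<open>e / 2\<close>
  and leaves it above \<open>c\<close>, yet multiplies its density by at most
  \<open>1 - 1 / card N\<close>, which brings it below \<open>m\<close>.\<close>

lemma star_system_reduce:
  assumes W: "star_system D W" and D: "p \<in> D" and c: "0 \<le> c" "c < star_density W" and e: "0 < e"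
  obtains W' where "star_system D W'" "refines_stars W' W" "c < star_density W'" "star_density W' < c + e"
proof (rule ccontr)
  assume no: "\<not> thesis"
  define S where "S = {star_density W' |W'. star_system D W' \<and> refines_stars W' W \<and> c < star_density W'}"
  have big: "c + e \<le> x" if "x \<in> S" for x
    using that no \<open>\<And>W'. \<lbrakk>star_system D W'; refines_stars W' W; c < star_density W'; star_density W' < c + e\<rbrakk> \<Longrightarrow> thesis\<close>
    unfolding S_def by (smt (verit) mem_Collect_eq)
  have "star_density W \<in> S" using W c refines_stars_refl by (auto simp: S_def)
  then have ne: "S \<noteq> {}" by auto
  have bdd: "bdd_below S" using big by (rule bdd_belowI)
  define m where "m = Inf S"
  have m: "c + e \<le> m" unfolding m_def using ne big by (intro cInf_greatest)
  obtain n :: nat where n: "2 / e < n" using reals_Archimedean2 by blast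
  obtain T where T: "finite T" "{\<one>} \<subseteq> T" "T \<subseteq> carrier G" "max n 1 \<le> card T"
    using large_finite_subset[of "{\<one>}" "max n 1"] by auto
  have Tn: "T \<noteq> {}" using T by auto
  have "2 / e < card T" using n T(4) by linarith
  then have Te: "1 / card T < e / 2" using e T(4) by (simp add: field_simps)
  define N where "N = (m_inv G ` T) <#> T"
  note Np = difference_set_props[OF T(3) Tn T(1), folded N_def]
  have cN: "0 < card N" using Np by (auto simp: card_gt_0_iff)
  define k where "k = 1 / real (card N)"
  have k: "0 < k" "k \<le> 1" using cN by (auto simp: k_def)
  have m0: "0 < m" using m c e by linarith
  \<comment> \<open>Since \<open>(1 - k) * (1 + k) < 1\<close>, a density below
    \<open>(1 + k) * m\<close> falls below \<open>m\<close> under the factor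
    \<open>1 - k\<close>.\<close>
  then have "m < m + k * m" using k by simp
  then obtain x where x: "x \<in> S" "x < m + k * m" using cInf_lessD[OF ne] unfolding m_def by blast
  then obtain W1 where W1: "star_system D W1" "refines_stars W1 W" "c < star_density W1" "x = star_density W1"
    by (auto simp: S_def)
  have mx: "m \<le> x" unfolding m_def using x(1) bdd by (rule cInf_lower)
  obtain v where v: "v \<in> W1" "0 * real (card {\<one>}) < stars v {\<one>}"
    using star_density_less[OF star_system_nonempty[OF W1(1)], of 0 "{\<one>}"] W1(3) c by auto
  have v1: "v \<one> = None"
  proof (rule ccontr)
    assume "v \<one> \<noteq> None"
    then have *: "{g\<in>{\<one>}. v g = None} = {}" by auto
    show False using v(2) unfolding stars_def * by simp
  qed
  let ?\<mu> = "[\<one> \<mapsto> p]"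
  obtain W2 where W2: "star_system D W2" "refines_stars W2 W1"
    "star_density W1 - real (card (dom ?\<mu>)) / card T \<le> star_density W2"
    "\<And>w'. w' \<in> W2 \<Longrightarrow> \<exists>w\<in>W1. \<exists>S. fills N ?\<mu> v w w' S"
    by (rule star_system_fill[OF W1(1) T(1) Tn T(3) _ _ v(1), of ?\<mu>, folded N_def]) (use T D v1 in auto)
  have "star_density W1 - 1 / card T \<le> star_density W2" using W2(3) by simp
  then have "c < star_density W2" using Te mx m W1(4) e by linarith
  then have "star_density W2 \<in> S" using W2(1) refines_stars_trans[OF W2(2) W1(2)] by (auto simp: S_def)
  then have "m \<le> star_density W2" unfolding m_def using bdd by (rule cInf_lower)
  also have "\<dots> \<le> (1 - k) * x" unfolding k_def W1(4)
    by (rule star_density_fill_upper[OF T(1) Tn T(3) N_def refl v1 star_system_shift[OF W1(1)] star_system_nonempty[OF W2(1)] W2(4)])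
  also have "\<dots> \<le> (1 - k) * (m + k * m)" using k x by (intro mult_left_mono) auto
  also have "\<dots> = m - k * k * m" by (simp add: algebra_simps)
  also have "\<dots> < m" using k m0 by simp
  finally show False by simp
qed

text \<open>The window is so large that writing \<open>\<mu>\<close> costs less than the distance to
  \<open>c\<close>; afterwards the density is brought below \<open>c + e\<close>, and the
  occurrences survive because filling keeps letters. If no word of \<open>W\<close> is compatible
  with \<open>\<mu>\<close>, the last claim is vacuous and only the density is lowered.\<close>

lemma star_system_step:
  assumes W: "star_system D W" and D: "p \<in> D" and c: "0 \<le> c" "c < star_density W" and e: "0 < e"
    and \<mu>: "finite (dom \<mu>)" "dom \<mu> \<subseteq> carrier G" "ran \<mu> \<subseteq> D"
  obtains W' where "star_system D W'" "refines_stars W' W" "c < star_density W'" "star_density W' < c + e"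
    "\<And>v w'. v \<in> W \<Longrightarrow> (\<And>f. f \<in> dom \<mu> \<Longrightarrow> v f \<noteq> None \<Longrightarrow> \<mu> f = v f) \<Longrightarrow> w' \<in> W' \<Longrightarrow>
       \<exists>g\<in>carrier G. \<forall>f\<in>dom \<mu>. w' (f \<otimes> g) = \<mu> f"
proof (cases "\<exists>v\<in>W. \<forall>f\<in>dom \<mu>. v f \<noteq> None \<longrightarrow> \<mu> f = v f")
  case False
  obtain W' where "star_system D W'" "refines_stars W' W" "c < star_density W'" "star_density W' < c + e"
    using star_system_reduce[OF W D c e] .
  then show ?thesis
  proof (rule that)
    fix v w' assume "v \<in> W" "\<And>f. f \<in> dom \<mu> \<Longrightarrow> v f \<noteq> None \<Longrightarrow> \<mu> f = v f"
    then show "\<exists>g\<in>carrier G. \<forall>f\<in>dom \<mu>. w' (f \<otimes> g) = \<mu> f" using False by blast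
  qed
next
  case True
  then obtain v where v: "v \<in> W" "\<And>f. f \<in> dom \<mu> \<Longrightarrow> v f \<noteq> None \<Longrightarrow> \<mu> f = v f" by blast
  define d where "d = star_density W - c"
  have d: "0 < d" using c by (simp add: d_def)
  obtain n :: nat where n: "card (dom \<mu>) / d < n" using reals_Archimedean2 by blast
  obtain T where T: "finite T" "insert \<one> (dom \<mu>) \<subseteq> T" "T \<subseteq> carrier G" "max n 1 \<le> card T"
    using large_finite_subset[of "insert \<one> (dom \<mu>)" "max n 1"] \<mu> by auto
  have Tn: "T \<noteq> {}" using T by auto
  have "card (dom \<mu>) / d < card T" using n T(4) by linarith
  then have Td: "card (dom \<mu>) / card T < d" using d T(4) by (simp add: field_simps)
  obtain W1 where W1: "star_system D W1" "refines_stars W1 W"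
    "star_density W - real (card (dom \<mu>)) / card T \<le> star_density W1"
    "\<And>w'. w' \<in> W1 \<Longrightarrow> \<exists>g\<in>carrier G. \<forall>f\<in>dom \<mu>. w' (f \<otimes> g) = \<mu> f"
    by (rule star_system_fill[OF W T(1) Tn T(3) _ \<mu>(3) v(1)]) (use T v(2) in auto)
  have "c < star_density W1" using W1(3) Td by (simp add: d_def)
  then obtain W' where W': "star_system D W'" "refines_stars W' W1" "c < star_density W'" "star_density W' < c + e"
    using star_system_reduce[OF W1(1) D c(1) _ e] by blast
  have "\<exists>g\<in>carrier G. \<forall>f\<in>dom \<mu>. w' (f \<otimes> g) = \<mu> f" if w': "w' \<in> W'" for w'
  proof -
    obtain w where w: "w \<in> W1" "\<forall>g\<in>carrier G. w g \<noteq> None \<longrightarrow> w' g = w g"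
      using W'(2) w' unfolding refines_stars_def by blast
    obtain g where g: "g \<in> carrier G" "\<forall>f\<in>dom \<mu>. w (f \<otimes> g) = \<mu> f" using W1(4)[OF w(1)] by blast
    have "w' (f \<otimes> g) = \<mu> f" if f: "f \<in> dom \<mu>" for f
    proof -
      have "f \<otimes> g \<in> carrier G" using f g(1) \<mu>(2) by auto
      moreover have "w (f \<otimes> g) = \<mu> f" "\<mu> f \<noteq> None" using g(2) f by auto
      ultimately show ?thesis using w(2) by simp
    qed
    then show ?thesis using g(1) by blast
  qed
  then show ?thesis using W' refines_stars_trans[OF W'(2) W1(2)] by (intro that) auto
qed

lemma star_system_all: "star_system D {\<lambda>g\<in>carrier G. None}"
  unfolding star_system_def
proof (intro exI conjI)
  show "minimal_subshift (discrete_topology {None}) {\<lambda>g\<in>carrier G. None}"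
    unfolding minimal_subshift_def
  proof (intro conjI allI impI)
    have "topspace (full_shift G (discrete_topology {None})) = {\<lambda>g\<in>carrier G. None}"
      by (simp add: topspace_full_shift PiE_eq_singleton[THEN iffD2])
    then show "subshift G (discrete_topology {None}) {\<lambda>g\<in>carrier G. None}"
      unfolding subshift_def by (metis closedin_topspace image_subsetI shift_map_in_topspace)
  qed auto
qed auto

lemma star_density_all: "1 \<le> star_density {(\<lambda>g\<in>carrier G. None) :: 'a \<Rightarrow> 'p option}"
  unfolding star_density_def
proof (rule cInf_greatest)
  let ?S = "{q::real. \<exists>K. finite K \<and> K \<noteq> {} \<and> K \<subseteq> carrier G \<and>
    (\<forall>w\<in>{(\<lambda>g\<in>carrier G. None) :: 'a \<Rightarrow> 'p option}. real (stars w K) \<le> q * real (card K))}"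
  have "(1::real) \<in> ?S"
    by (intro CollectI exI[of _ "{\<one>}"] conjI ballI) (simp_all add: stars_one_le)
  then show "?S \<noteq> {}" by blast
  fix q assume "q \<in> ?S"
  then obtain K where K: "finite K" "K \<noteq> {}" "K \<subseteq> carrier G" "real (stars ((\<lambda>g\<in>carrier G. None) :: 'a \<Rightarrow> 'p option) K) \<le> q * real (card K)"
    by auto
  have "{g\<in>K. ((\<lambda>g\<in>carrier G. None) :: 'a \<Rightarrow> 'p option) g = None} = K" using K by auto
  then have "1 * real (card K) \<le> q * real (card K)" using K(4) by (simp add: stars_def)
  moreover have "0 < real (card K)" using K by (simp add: card_gt_0_iff)
  ultimately show "1 \<le> q" by (simp only: mult_le_cancel_right_pos)
qed

text \<open>The passage from stage \<open>k\<close> to the next one writes the pattern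
  \<open>\<tau> k\<close> and brings the density below \<open>c + 1 / Suc k\<close>. It stays
  strictly above \<open>c\<close>, so that the construction can go on.\<close>

theorem star_system_sequence:
  fixes D :: "'p set" and \<tau> :: "nat \<Rightarrow> 'a \<Rightarrow> 'p option"
  assumes D: "p \<in> D" and c: "0 \<le> c" "c < 1"
    and \<tau>: "\<And>k. finite (dom (\<tau> k)) \<and> dom (\<tau> k) \<subseteq> carrier G \<and> ran (\<tau> k) \<subseteq> D"
  obtains W where "\<And>k. star_system D (W k)" "\<And>k. refines_stars (W (Suc k)) (W k)"
    "\<And>k. c < star_density (W k)" "(\<lambda>k. star_density (W k)) \<longlonglongrightarrow> c"
    "\<And>k v w'. v \<in> W k \<Longrightarrow> \<forall>f\<in>dom (\<tau> k). v f \<noteq> None \<longrightarrow> \<tau> k f = v f \<Longrightarrow> w' \<in> W (Suc k) \<Longrightarrow>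
       \<exists>g\<in>carrier G. \<forall>f\<in>dom (\<tau> k). w' (f \<otimes> g) = \<tau> k f"
proof -
  define P where "P k W \<longleftrightarrow> star_system D W \<and> c < star_density W \<and> (k > 0 \<longrightarrow> star_density W < c + 1 / real k)" for k W
  define Q where "Q k W W' \<longleftrightarrow> refines_stars W' W \<and>
    (\<forall>v w'. v \<in> W \<longrightarrow> (\<forall>f\<in>dom (\<tau> k). v f \<noteq> None \<longrightarrow> \<tau> k f = v f) \<longrightarrow> w' \<in> W' \<longrightarrow>
       (\<exists>g\<in>carrier G. \<forall>f\<in>dom (\<tau> k). w' (f \<otimes> g) = \<tau> k f))" for k W W'
  have "\<exists>W. \<forall>k. P k (W k) \<and> Q k (W k) (W (Suc k))"
  proof (rule dependent_nat_choice)
    \<comment> \<open>At the start every coordinate is free; here \<open>c < 1\<close> is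
      used.\<close>
    have "c < star_density {(\<lambda>g\<in>carrier G. None) :: 'a \<Rightarrow> 'p option}"
      using c(2) star_density_all by (rule less_le_trans)
    then show "\<exists>W. P 0 W" using star_system_all[of D] unfolding P_def by blast
    fix W k assume P: "P k W"
    then have W: "star_system D W" "c < star_density W" by (auto simp: P_def)
    have e: "0 < 1 / real (Suc k)" by simp
    obtain W' where "star_system D W'" "refines_stars W' W" "c < star_density W'" "star_density W' < c + 1 / real (Suc k)"
      "\<And>v w'. v \<in> W \<Longrightarrow> (\<And>f. f \<in> dom (\<tau> k) \<Longrightarrow> v f \<noteq> None \<Longrightarrow> \<tau> k f = v f) \<Longrightarrow> w' \<in> W' \<Longrightarrow>
       \<exists>g\<in>carrier G. \<forall>f\<in>dom (\<tau> k). w' (f \<otimes> g) = \<tau> k f"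
      by (rule star_system_step[OF W(1) D c(1) W(2) e, of "\<tau> k"]) (use \<tau> in auto)
    then show "\<exists>W'. P (Suc k) W' \<and> Q k W W'" by (intro exI[of _ W']) (auto simp: P_def Q_def)
  qed
  then obtain W where PQ: "\<And>k. P k (W k)" "\<And>k. Q k (W k) (W (Suc k))" by blast
  show ?thesis
  proof (rule that[of W])
    show "star_system D (W k)" "c < star_density (W k)" for k using PQ(1)[of k] by (auto simp: P_def)
    show "refines_stars (W (Suc k)) (W k)" for k using PQ(2)[of k] by (auto simp: Q_def)
    show "\<exists>g\<in>carrier G. \<forall>f\<in>dom (\<tau> k). w' (f \<otimes> g) = \<tau> k f"
      if "v \<in> W k" "\<forall>f\<in>dom (\<tau> k). v f \<noteq> None \<longrightarrow> \<tau> k f = v f" "w' \<in> W (Suc k)" for k v w'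
      using PQ(2)[of k] that unfolding Q_def by blast
    show "(\<lambda>k. star_density (W k)) \<longlonglongrightarrow> c"
    proof (rule tendsto_sandwich[of "\<lambda>_. c"])
      show "\<forall>\<^sub>F k in sequentially. c \<le> star_density (W k)" using PQ(1) by (simp add: P_def less_imp_le)
      show "\<forall>\<^sub>F k in sequentially. star_density (W k) \<le> c + 1 / real k"
        using PQ(1) by (intro eventually_sequentiallyI[of 1]) (auto simp: P_def intro: less_imp_le)
      have "(\<lambda>k. c + 1 / real k) \<longlonglongrightarrow> c + 0" by (intro tendsto_intros lim_1_over_n)
      then show "(\<lambda>k. c + 1 / real k) \<longlonglongrightarrow> c" by simp
    qed simp
  qed
qed

end

section \<open>Mean dimension\<close>

lemma cover_join_over_eq:
  "cover_join_over X \<phi> \<alpha> F = (\<lambda>U. {x\<in>topspace X. \<forall>g\<in>F. \<phi> g x \<in> U g}) ` (\<Pi>\<^sub>E g\<in>F. \<alpha>)"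
proof (intro equalityI subsetI)
  fix A assume "A \<in> cover_join_over X \<phi> \<alpha> F"
  then obtain c where c: "A = topspace X \<inter> (\<Inter>g\<in>F. c g)" "\<forall>g\<in>F. c g \<in> preimage_cover X (\<phi> g) \<alpha>"
    by (auto simp: cover_join_over_def join_covers_def)
  then have "\<forall>g\<in>F. \<exists>U. U \<in> \<alpha> \<and> c g = {x \<in> topspace X. \<phi> g x \<in> U}" by (auto simp: preimage_cover_def)
  then obtain U where U: "\<forall>g\<in>F. U g \<in> \<alpha> \<and> c g = {x \<in> topspace X. \<phi> g x \<in> U g}" by metis
  have "A = {x\<in>topspace X. \<forall>g\<in>F. \<phi> g x \<in> restrict U F g}" using c(1) U by auto
  moreover have "restrict U F \<in> (\<Pi>\<^sub>E g\<in>F. \<alpha>)" using U by auto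
  ultimately show "A \<in> (\<lambda>U. {x\<in>topspace X. \<forall>g\<in>F. \<phi> g x \<in> U g}) ` (\<Pi>\<^sub>E g\<in>F. \<alpha>)" by blast
next
  fix A assume "A \<in> (\<lambda>U. {x\<in>topspace X. \<forall>g\<in>F. \<phi> g x \<in> U g}) ` (\<Pi>\<^sub>E g\<in>F. \<alpha>)"
  then obtain U where U: "U \<in> (\<Pi>\<^sub>E g\<in>F. \<alpha>)" "A = {x\<in>topspace X. \<forall>g\<in>F. \<phi> g x \<in> U g}" by blast
  define c where "c g = {x \<in> topspace X. \<phi> g x \<in> U g}" for g
  have "A = topspace X \<inter> (\<Inter>g\<in>F. c g)" using U(2) by (auto simp: c_def)
  moreover have "\<forall>g\<in>F. c g \<in> preimage_cover X (\<phi> g) \<alpha>" using U(1) by (auto simp: c_def preimage_cover_def)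
  ultimately show "A \<in> cover_join_over X \<phi> \<alpha> F" unfolding cover_join_over_def join_covers_def by blast
qed

lemma cover_join_over_memI:
  assumes "\<And>g. g \<in> F \<Longrightarrow> U g \<in> \<alpha>"
  shows "{x\<in>topspace X. \<forall>g\<in>F. \<phi> g x \<in> U g} \<in> cover_join_over X \<phi> \<alpha> F"
  unfolding cover_join_over_eq by (rule image_eqI[of _ _ "restrict U F"]) (use assms in auto)

lemma cover_join_over_memE:
  assumes "A \<in> cover_join_over X \<phi> \<alpha> F"
  obtains U where "\<And>g. g \<in> F \<Longrightarrow> U g \<in> \<alpha>" "A = {x\<in>topspace X. \<forall>g\<in>F. \<phi> g x \<in> U g}"
  using assms unfolding cover_join_over_eq by (auto simp: PiE_iff)

lemma finite_open_cover_join_over: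
  assumes \<alpha>: "finite_open_cover X \<alpha>" and F: "finite F" and \<phi>: "\<And>g. g \<in> F \<Longrightarrow> continuous_map X X (\<phi> g)"
  shows "finite_open_cover X (cover_join_over X \<phi> \<alpha> F)"
  unfolding finite_open_cover_def
proof (intro conjI ballI)
  show "finite (cover_join_over X \<phi> \<alpha> F)" unfolding cover_join_over_eq
    using F \<alpha> by (intro finite_imageI finite_PiE) (auto simp: finite_open_cover_def)
  fix A assume "A \<in> cover_join_over X \<phi> \<alpha> F"
  then obtain U where U: "\<And>g. g \<in> F \<Longrightarrow> U g \<in> \<alpha>" "A = {x\<in>topspace X. \<forall>g\<in>F. \<phi> g x \<in> U g}"
    by (rule cover_join_over_memE) (assumption | rule that)+
  have "A = (\<Inter>g\<in>F. {x\<in>topspace X. \<phi> g x \<in> U g}) \<inter> topspace X" using U(2) by auto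
  also have "openin X \<dots>"
    using F U(1) \<alpha> by (intro openin_INT openin_continuous_map_preimage[OF \<phi>]) (auto simp: finite_open_cover_def)
  finally show "openin X A" .
next
  have "x \<in> \<Union>(cover_join_over X \<phi> \<alpha> F)" if x: "x \<in> topspace X" for x
  proof -
    have "\<exists>U\<in>\<alpha>. \<phi> g x \<in> U" if "g \<in> F" for g
    proof -
      have "\<phi> g x \<in> topspace X" using continuous_map_image_subset_topspace[OF \<phi>[OF that]] x by blast
      then have "\<phi> g x \<in> \<Union>\<alpha>" using \<alpha> by (simp add: finite_open_cover_def)
      then show ?thesis by blast
    qed
    then obtain U where U: "\<And>g. g \<in> F \<Longrightarrow> U g \<in> \<alpha> \<and> \<phi> g x \<in> U g" by metis
    then have "x \<in> {x\<in>topspace X. \<forall>g\<in>F. \<phi> g x \<in> U g}" using x by auto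
    moreover have "{x\<in>topspace X. \<forall>g\<in>F. \<phi> g x \<in> U g} \<in> cover_join_over X \<phi> \<alpha> F"
      using U by (intro cover_join_over_memI) auto
    ultimately show ?thesis by (rule UnionI[rotated])
  qed
  then show "\<Union>(cover_join_over X \<phi> \<alpha> F) = topspace X" by (auto elim: cover_join_over_memE)
qed

lemma cover_D_optimal:
  assumes "finite_open_cover X \<alpha>" "topspace X \<noteq> {}"
  obtains \<beta> where "finite_open_cover X \<beta>" "refines_cover \<beta> \<alpha>"
    "\<And>x. x \<in> topspace X \<Longrightarrow> card {U\<in>\<beta>. x \<in> U} - 1 \<le> nat (cover_D X \<alpha>)"
proof -
  have "cover_D X \<alpha> \<le> int (nat (cover_D X \<alpha>))" by simp
  then obtain \<beta> where "finite_open_cover X \<beta>" "refines_cover \<beta> \<alpha>"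
    "\<forall>x\<in>topspace X. card {U\<in>\<beta>. x \<in> U} \<le> Suc (nat (cover_D X \<alpha>))"
    unfolding cover_D_le_iff[OF assms(1)] by blast
  then show ?thesis by (intro that[of \<beta>]) (auto simp: le_diff_conv)
qed

section \<open>Existence of the limits that define mean dimension\<close>

context group begin

lemma G_system_props:
  assumes "G_system G X \<phi>"
  shows "normal_space X" "topspace X \<noteq> {}" "\<And>g. g \<in> carrier G \<Longrightarrow> continuous_map X X (\<phi> g)"
    "\<And>g h x. g \<in> carrier G \<Longrightarrow> h \<in> carrier G \<Longrightarrow> x \<in> topspace X \<Longrightarrow> \<phi> (g \<otimes> h) x = \<phi> g (\<phi> h x)"
    "\<And>g x. g \<in> carrier G \<Longrightarrow> x \<in> topspace X \<Longrightarrow> \<phi> g x \<in> topspace X"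
proof -
  show "normal_space X" "topspace X \<noteq> {}" using assms by (auto simp: G_system_def metrizable_imp_normal_space)
  show c: "continuous_map X X (\<phi> g)" if "g \<in> carrier G" for g using assms that by (simp add: G_system_def)
  show "\<phi> (g \<otimes> h) x = \<phi> g (\<phi> h x)" if "g \<in> carrier G" "h \<in> carrier G" "x \<in> topspace X" for g h x
    using assms that by (auto simp: G_system_def intro: group_action.composition_rule)
  show "\<phi> g x \<in> topspace X" if "g \<in> carrier G" "x \<in> topspace X" for g x
    using continuous_map_image_subset_topspace[OF c[OF that(1)]] that(2) by blast
qed

text \<open>\<open>cover_D_le_sum\<close> is applied to two copies of the identity map, with an
  optimal refinement for each of the two joins: intersections of their members refine the common
  join, and the orders add.\<close>

lemma cover_D_join_Un:
  assumes S: "G_system G X \<phi>" and \<alpha>: "finite_open_cover X \<alpha>"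
    and A: "finite A" "A \<subseteq> carrier G" and B: "finite B" "B \<subseteq> carrier G"
  shows "cover_D X (cover_join_over X \<phi> \<alpha> (A \<union> B)) \<le> cover_D X (cover_join_over X \<phi> \<alpha> A) + cover_D X (cover_join_over X \<phi> \<alpha> B)"
proof -
  note p = G_system_props[OF S]
  have foc: "finite_open_cover X (cover_join_over X \<phi> \<alpha> F)" if "finite F" "F \<subseteq> carrier G" for F
    using that p(3) by (intro finite_open_cover_join_over[OF \<alpha>]) auto
  obtain \<beta>A where \<beta>A: "finite_open_cover X \<beta>A" "refines_cover \<beta>A (cover_join_over X \<phi> \<alpha> A)"
    "\<And>x. x \<in> topspace X \<Longrightarrow> card {U\<in>\<beta>A. x \<in> U} - 1 \<le> nat (cover_D X (cover_join_over X \<phi> \<alpha> A))"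
    by (rule cover_D_optimal[OF foc[OF A] p(2)]) (assumption | rule that)+
  obtain \<beta>B where \<beta>B: "finite_open_cover X \<beta>B" "refines_cover \<beta>B (cover_join_over X \<phi> \<alpha> B)"
    "\<And>x. x \<in> topspace X \<Longrightarrow> card {U\<in>\<beta>B. x \<in> U} - 1 \<le> nat (cover_D X (cover_join_over X \<phi> \<alpha> B))"
    by (rule cover_D_optimal[OF foc[OF B] p(2)]) (assumption | rule that)+
  define \<beta> where "\<beta> i = (if i then \<beta>A else \<beta>B)" for i
  let ?N = "nat (cover_D X (cover_join_over X \<phi> \<alpha> A)) + nat (cover_D X (cover_join_over X \<phi> \<alpha> B))"
  have "cover_D X (cover_join_over X \<phi> \<alpha> (A \<union> B)) \<le> int ?N"
  proof (rule cover_D_le_sum[OF p(1), where I=UNIV and Y=X and \<phi>="\<lambda>_ x. x" and \<beta>=\<beta>])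
    show "finite_open_cover X (cover_join_over X \<phi> \<alpha> (A \<union> B))" using A B by (intro foc) auto
    show "finite_open_cover X (\<beta> i)" for i using \<beta>A(1) \<beta>B(1) by (simp add: \<beta>_def)
    show "(\<Sum>i\<in>UNIV. card {U \<in> \<beta> i. x \<in> U} - 1) \<le> ?N" if "x \<in> topspace X" for x
      using \<beta>A(3)[OF that] \<beta>B(3)[OF that] by (simp add: UNIV_bool \<beta>_def)
    fix U assume U: "\<And>i. i \<in> UNIV \<Longrightarrow> U i \<in> \<beta> i"
    then have "U True \<in> \<beta>A" "U False \<in> \<beta>B" using U[of True] U[of False] by (simp_all add: \<beta>_def)
    then obtain CA CB where C: "CA \<in> cover_join_over X \<phi> \<alpha> A" "U True \<subseteq> CA" "CB \<in> cover_join_over X \<phi> \<alpha> B" "U False \<subseteq> CB"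
      using \<beta>A(2) \<beta>B(2) unfolding refines_cover_def by blast
    obtain V where V: "\<And>g. g \<in> A \<Longrightarrow> V g \<in> \<alpha>" "CA = {x\<in>topspace X. \<forall>g\<in>A. \<phi> g x \<in> V g}"
      using C(1) by (rule cover_join_over_memE) (assumption | rule that)+
    obtain W where W: "\<And>g. g \<in> B \<Longrightarrow> W g \<in> \<alpha>" "CB = {x\<in>topspace X. \<forall>g\<in>B. \<phi> g x \<in> W g}"
      using C(3) by (rule cover_join_over_memE) (assumption | rule that)+
    have "{x\<in>topspace X. \<forall>g\<in>A \<union> B. \<phi> g x \<in> (if g \<in> A then V g else W g)} \<in> cover_join_over X \<phi> \<alpha> (A \<union> B)"
      using V(1) W(1) by (intro cover_join_over_memI) auto
    moreover have "{x \<in> topspace X. \<forall>i\<in>UNIV. x \<in> U i} \<subseteq> {x\<in>topspace X. \<forall>g\<in>A \<union> B. \<phi> g x \<in> (if g \<in> A then V g else W g)}"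
      using C(2,4) V(2) W(2) by auto
    ultimately show "\<exists>C\<in>cover_join_over X \<phi> \<alpha> (A \<union> B). {x \<in> topspace X. \<forall>i\<in>UNIV. x \<in> U i} \<subseteq> C" by blast
  qed auto
  then show ?thesis
    using cover_D_nonneg[OF foc[OF A] p(2)] cover_D_nonneg[OF foc[OF B] p(2)] by simp
qed

text \<open>As \<open>\<phi> (a \<otimes> g) x = \<phi> a (\<phi> g x)\<close>, pulling back along
  \<open>\<phi> g\<close> turns a refinement of the join over \<open>A\<close> into one of the join
  over the right coset, without raising the order.\<close>

lemma cover_D_join_r_coset_le:
  assumes S: "G_system G X \<phi>" and \<alpha>: "finite_open_cover X \<alpha>"
    and A: "finite A" "A \<subseteq> carrier G" and g: "g \<in> carrier G"
  shows "cover_D X (cover_join_over X \<phi> \<alpha> (A #> g)) \<le> cover_D X (cover_join_over X \<phi> \<alpha> A)"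
proof -
  note p = G_system_props[OF S]
  have foc: "finite_open_cover X (cover_join_over X \<phi> \<alpha> F)" if "finite F" "F \<subseteq> carrier G" for F
    using that p(3) by (intro finite_open_cover_join_over[OF \<alpha>]) auto
  have Ag: "finite (A #> g)" "A #> g \<subseteq> carrier G" using A g by (auto simp: r_coset_finite r_coset_def)
  obtain \<beta> where \<beta>: "finite_open_cover X \<beta>" "refines_cover \<beta> (cover_join_over X \<phi> \<alpha> A)"
    "\<And>x. x \<in> topspace X \<Longrightarrow> card {U\<in>\<beta>. x \<in> U} - 1 \<le> nat (cover_D X (cover_join_over X \<phi> \<alpha> A))"
    by (rule cover_D_optimal[OF foc[OF A] p(2)]) (assumption | rule that)+
  have "cover_D X (cover_join_over X \<phi> \<alpha> (A #> g)) \<le> int (nat (cover_D X (cover_join_over X \<phi> \<alpha> A)))"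
  proof (rule cover_D_le_sum[OF p(1) foc[OF Ag], where I="{()}" and Y=X and \<phi>="\<lambda>_. \<phi> g" and \<beta>="\<lambda>_. \<beta>"])
    show "continuous_map X X (\<phi> g)" using p(3) g by simp
    show "finite_open_cover X \<beta>" by fact
    show "(\<Sum>i\<in>{()}. card {U \<in> \<beta>. \<phi> g x \<in> U} - 1) \<le> nat (cover_D X (cover_join_over X \<phi> \<alpha> A))"
      if "x \<in> topspace X" for x using \<beta>(3)[OF p(5)[OF g that]] by simp
    fix U :: "unit \<Rightarrow> _" assume "\<And>i. i \<in> {()} \<Longrightarrow> U i \<in> \<beta>"
    then obtain C where C: "C \<in> cover_join_over X \<phi> \<alpha> A" "U () \<subseteq> C" using \<beta>(2) unfolding refines_cover_def by blast
    obtain V where V: "\<And>a. a \<in> A \<Longrightarrow> V a \<in> \<alpha>" "C = {x\<in>topspace X. \<forall>a\<in>A. \<phi> a x \<in> V a}"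
      using C(1) by (rule cover_join_over_memE) (assumption | rule that)+
    have inv_in: "b \<otimes> inv g \<in> A \<and> b = (b \<otimes> inv g) \<otimes> g" if b: "b \<in> A #> g" for b
    proof -
      obtain a where a: "a \<in> A" "b = a \<otimes> g" using b by (auto simp: r_coset_def)
      then have "a \<in> carrier G" using A by auto
      then have "b \<otimes> inv g = a" using a g by (simp add: m_assoc)
      then show ?thesis using a by simp
    qed
    have "{x\<in>topspace X. \<forall>b\<in>A #> g. \<phi> b x \<in> V (b \<otimes> inv g)} \<in> cover_join_over X \<phi> \<alpha> (A #> g)"
      using V(1) inv_in by (intro cover_join_over_memI) blast
    moreover have "{x \<in> topspace X. \<forall>i\<in>{()}. \<phi> g x \<in> U i} \<subseteq> {x\<in>topspace X. \<forall>b\<in>A #> g. \<phi> b x \<in> V (b \<otimes> inv g)}"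
    proof (intro subsetI CollectI conjI ballI)
      fix x assume x: "x \<in> {x \<in> topspace X. \<forall>i\<in>{()}. \<phi> g x \<in> U i}"
      then show "x \<in> topspace X" by simp
      fix b assume b: "b \<in> A #> g"
      have "b \<otimes> inv g \<in> carrier G" using inv_in[OF b] A by auto
      then have "\<phi> b x = \<phi> (b \<otimes> inv g) (\<phi> g x)" using p(4)[of "b \<otimes> inv g" g x] inv_in[OF b] g x by simp
      moreover have "\<phi> g x \<in> C" using x C(2) by auto
      ultimately show "\<phi> b x \<in> V (b \<otimes> inv g)" using V(2) inv_in[OF b] by auto
    qed
    ultimately show "\<exists>C\<in>cover_join_over X \<phi> \<alpha> (A #> g). {x \<in> topspace X. \<forall>i\<in>{()}. \<phi> g x \<in> U i} \<subseteq> C" by blast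
  qed auto
  then show ?thesis using cover_D_nonneg[OF foc[OF A] p(2)] by simp
qed

lemma cover_D_join_r_coset:
  assumes S: "G_system G X \<phi>" and \<alpha>: "finite_open_cover X \<alpha>"
    and A: "finite A" "A \<subseteq> carrier G" and g: "g \<in> carrier G"
  shows "cover_D X (cover_join_over X \<phi> \<alpha> (A #> g)) = cover_D X (cover_join_over X \<phi> \<alpha> A)"
proof (rule antisym)
  have "A #> g \<subseteq> carrier G" using A g by (auto simp: r_coset_def)
  then have "cover_D X (cover_join_over X \<phi> \<alpha> (A #> g #> inv g)) \<le> cover_D X (cover_join_over X \<phi> \<alpha> (A #> g))"
    using A g by (intro cover_D_join_r_coset_le[OF S \<alpha>]) (auto simp: r_coset_finite)
  moreover have "A #> g #> inv g = A" using A g by (simp add: coset_mult_assoc)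
  ultimately show "cover_D X (cover_join_over X \<phi> \<alpha> A) \<le> cover_D X (cover_join_over X \<phi> \<alpha> (A #> g))" by simp
qed (rule cover_D_join_r_coset_le[OF assms])

text \<open>The Ornstein-Weiss lemma applies to \<open>cover_D\<close> of the joins; the given
  sequence \<open>F\<close> makes the common limit unique, as the definite description
  requires.\<close>

lemma mean_cover_D_tendsto:
  assumes S: "G_system G X \<phi>" and \<alpha>: "finite_open_cover X \<alpha>" and F: "folner_sequence G F"
  shows "(\<lambda>n. of_int (cover_D X (cover_join_over X \<phi> \<alpha> (F n))) / real (card (F n))) \<longlonglongrightarrow> mean_cover_D G X \<phi> \<alpha>"
proof -
  note p = G_system_props[OF S]
  have foc: "finite_open_cover X (cover_join_over X \<phi> \<alpha> F)" if "finite F" "F \<subseteq> carrier G" for F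
    using that p(3) by (intro finite_open_cover_join_over[OF \<alpha>]) auto
  define h where "h A = real_of_int (cover_D X (cover_join_over X \<phi> \<alpha> A))" for A
  have "\<exists>L. \<forall>F. folner_sequence G F \<longrightarrow> (\<lambda>n. h (F n) / real (card (F n))) \<longlonglongrightarrow> L"
  proof (rule ornstein_weiss)
    show "0 \<le> h A" if "finite A" "A \<subseteq> carrier G" for A
      using cover_D_nonneg[OF foc[OF that] p(2)] by (simp add: h_def)
    have "cover_D X (cover_join_over X \<phi> \<alpha> {}) \<le> int 0"
      by (rule cover_D_le_sum[OF p(1) foc, where I="{}" and Y=X and \<phi>="\<lambda>_ x. x" and \<beta>="\<lambda>_. {}"])
         (auto simp: cover_join_over_eq)
    then show "h {} = 0" using cover_D_nonneg[OF foc p(2), of "{}"] by (simp add: h_def)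
    show "h (A \<union> B) \<le> h A + h B" if "finite A" "A \<subseteq> carrier G" "finite B" "B \<subseteq> carrier G" for A B
      using cover_D_join_Un[OF S \<alpha> that] by (simp add: h_def flip: of_int_add)
    show "h (A #> g) = h A" if "finite A" "A \<subseteq> carrier G" "g \<in> carrier G" for A g
      using cover_D_join_r_coset[OF S \<alpha> that] by (simp add: h_def)
  qed
  then obtain L where L: "\<forall>F. folner_sequence G F \<longrightarrow> (\<lambda>n. h (F n) / real (card (F n))) \<longlonglongrightarrow> L" by blast
  have "mean_cover_D G X \<phi> \<alpha> = L" unfolding mean_cover_D_def h_def[symmetric]
  proof (rule the_equality[where P="\<lambda>L. \<forall>F. folner_sequence G F \<longrightarrow> (\<lambda>n. h (F n) / real (card (F n))) \<longlonglongrightarrow> L", OF L])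
    fix L' assume "\<forall>F. folner_sequence G F \<longrightarrow> (\<lambda>n. h (F n) / real (card (F n))) \<longlonglongrightarrow> L'"
    then show "L' = L" using L F LIMSEQ_unique by blast
  qed
  then show ?thesis using L F by (simp add: h_def)
qed

text \<open>The coordinates in \<open>J\<close> carry independent copies of the
  \<open>d\<close>-cube, so a cube of dimension \<open>d * card J\<close> maps into
  \<open>X\<close>. A refinement of the join pulls back to a cover none of whose members meets
  opposite faces, because the join controls each coordinate \<open>g\<close> in \<open>J\<close>
  through \<open>x g = shift_map G g x \<one>\<close>. Lebesgue's theorem then gives a point in
  \<open>d * card J + 1\<close> members.\<close>

lemma cover_D_cube_lower:
  assumes e: "continuous_map (unit_cube d) T e" and d: "0 < d"
    and \<U>: "\<And>U i s t. U \<in> \<U> \<Longrightarrow> i < d \<Longrightarrow> s \<in> topspace (unit_cube d) \<Longrightarrow> t \<in> topspace (unit_cube d) \<Longrightarrow>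
       e s \<in> U \<Longrightarrow> e t \<in> U \<Longrightarrow> s i = 0 \<Longrightarrow> t i \<noteq> 1"
    and J: "J \<subseteq> F" "F \<subseteq> carrier G" "finite F" and y: "y \<in> topspace (full_shift G T)"
    and X: "X \<subseteq> topspace (full_shift G T)"
      "\<And>t. (\<And>g. g \<in> J \<Longrightarrow> t g \<in> topspace T) \<Longrightarrow> (\<lambda>g\<in>carrier G. if g \<in> J then t g else y g) \<in> X"
  defines "XT \<equiv> subtopology (full_shift G T) X" and "\<alpha> \<equiv> (\<lambda>U. {x\<in>X. x \<one> \<in> U}) ` \<U>"
  assumes join: "finite_open_cover XT (cover_join_over XT (shift_action G X) \<alpha> F)"
  shows "int (d * card J) \<le> cover_D XT (cover_join_over XT (shift_action G X) \<alpha> F)"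
proof -
  have topXT: "topspace XT = X" using X(1) by (auto simp: XT_def)
  have fJ: "finite J" "J \<subseteq> carrier G" using J by (auto intro: finite_subset)
  obtain idx where idx: "bij_betw idx J {0..<card J}" using ex_bij_betw_finite_nat[OF fJ(1)] by blast
  define n where "n = d * card J"
  define block where "block g t = (\<lambda>i\<in>{..<d}. t (idx g * d + i))" for g and t :: "nat \<Rightarrow> real"
  have ix: "idx g * d + i < n" if "g \<in> J" "i < d" for g i
  proof -
    have "idx g < card J" using idx that by (auto simp: bij_betw_def)
    then have "Suc (idx g) * d \<le> card J * d" by (intro mult_le_mono1) auto
    then show ?thesis using that by (simp add: n_def mult.commute)
  qed
  have block: "continuous_map (unit_cube n) (unit_cube d) (block g)" if g: "g \<in> J" for g
    unfolding unit_cube_def[of d] continuous_map_componentwise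
  proof (intro conjI ballI)
    show "block g ` topspace (unit_cube n) \<subseteq> extensional {..<d}" by (auto simp: block_def)
    fix i assume "i \<in> {..<d}"
    then show "continuous_map (unit_cube n) (top_of_set {0..1}) (\<lambda>t. block g t i)"
      using ix[OF g, of i] continuous_map_product_projection[of "idx g * d + i" "{..<n}" "\<lambda>_. top_of_set {0..1::real}"]
      by (simp add: block_def unit_cube_def)
  qed
  define q where "q t = (\<lambda>g\<in>carrier G. if g \<in> J then e (block g t) else y g)" for t
  have "continuous_map (unit_cube n) (full_shift G T) q"
    unfolding full_shift_def continuous_map_componentwise
  proof (intro conjI ballI)
    show "q ` topspace (unit_cube n) \<subseteq> extensional (carrier G)" by (auto simp: q_def)
    fix g assume g: "g \<in> carrier G"
    show "continuous_map (unit_cube n) T (\<lambda>t. q t g)"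
    proof (cases "g \<in> J")
      case True
      then have "continuous_map (unit_cube n) T (e \<circ> block g)" using block e by (intro continuous_map_compose)
      then show ?thesis using True g by (simp add: q_def o_def)
    next
      case False
      then show ?thesis using g y by (auto simp: q_def topspace_full_shift PiE_iff)
    qed
  qed
  moreover have "q t \<in> X" if "t \<in> topspace (unit_cube n)" for t
    unfolding q_def
  proof (rule X(2))
    fix g assume "g \<in> J"
    then show "e (block g t) \<in> topspace T"
      using continuous_map_image_subset_topspace[OF block] continuous_map_image_subset_topspace[OF e] that by blast
  qed
  ultimately have q: "continuous_map (unit_cube n) XT q" by (auto simp: XT_def continuous_map_in_subtopology)
  obtain \<beta> where \<beta>: "finite_open_cover XT \<beta>" "refines_cover \<beta> (cover_join_over XT (shift_action G X) \<alpha> F)"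
    "cover_ord XT \<beta> = cover_D XT (cover_join_over XT (shift_action G X) \<alpha> F)"
    using cover_D_attained[OF join] .
  have f\<beta>: "finite \<beta>" using \<beta>(1) by (simp add: finite_open_cover_def)
  define pre where "pre V = {t\<in>topspace (unit_cube n). q t \<in> V}" for V
  obtain t where t: "t \<in> topspace (unit_cube n)" "Suc n \<le> card {V\<in>pre ` \<beta>. t \<in> V}"
  proof (rule Lebesgue_covering[of "pre ` \<beta>" n])
    show "finite (pre ` \<beta>)" using f\<beta> by simp
    show "openin (unit_cube n) V" if "V \<in> pre ` \<beta>" for V
      using that \<beta>(1) q by (auto simp: pre_def finite_open_cover_def intro: openin_continuous_map_preimage)
    show "topspace (unit_cube n) \<subseteq> \<Union>(pre ` \<beta>)"
    proof
      fix t assume t: "t \<in> topspace (unit_cube n)"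
      then have "q t \<in> topspace XT" using continuous_map_image_subset_topspace[OF q] by blast
      then have "q t \<in> \<Union>\<beta>" using \<beta>(1) by (simp add: finite_open_cover_def)
      then show "t \<in> \<Union>(pre ` \<beta>)" using t by (auto simp: pre_def)
    qed
    show "t i \<noteq> 1" if a: "V' \<in> pre ` \<beta>" "i < n" "s \<in> V'" "t \<in> V'" "s i = 0" for V' i s t
    proof -
      obtain V where V: "V \<in> \<beta>" "V' = pre V" using a(1) by auto
      obtain A where A: "A \<in> cover_join_over XT (shift_action G X) \<alpha> F" "V \<subseteq> A" using \<beta>(2) V(1) unfolding refines_cover_def by blast
      obtain U where U: "\<And>g. g \<in> F \<Longrightarrow> U g \<in> \<alpha>" "A = {x\<in>topspace XT. \<forall>g\<in>F. shift_action G X g x \<in> U g}"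
        using A(1) by (rule cover_join_over_memE) (assumption | rule that)+
      \<comment> \<open>Coordinate \<open>i\<close> of the large cube is coordinate
        \<open>i mod d\<close> of the block of that \<open>g\<close> for which
        \<open>idx g = i div d\<close>.\<close>
      have "i div d < card J" using a(2) d by (simp add: n_def less_mult_imp_div_less mult.commute)
      then have "i div d \<in> idx ` J" using bij_betw_imp_surj_on[OF idx] by simp
      then obtain g where g: "g \<in> J" "idx g = i div d" by auto
      have gF: "g \<in> F" "g \<in> carrier G" using g J by auto
      obtain U0 where U0: "U0 \<in> \<U>" "U g = {x\<in>X. x \<one> \<in> U0}" using U(1)[OF gF(1)] by (auto simp: \<alpha>_def)
      have in_U0: "e (block g r) \<in> U0" if r: "r \<in> V'" for r
      proof -
        have "q r \<in> A" using r V A(2) by (auto simp: pre_def)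
        then have "shift_action G X g (q r) \<in> U g" "q r \<in> X" using U(2) gF topXT by auto
        then have "shift_map G g (q r) \<one> \<in> U0" using U0(2) by (auto simp: shift_action_def)
        then show ?thesis using g gF by (simp add: shift_map_apply q_def)
      qed
      have bl: "block g r \<in> topspace (unit_cube d)" if "r \<in> V'" for r
        using that V continuous_map_image_subset_topspace[OF block[OF g(1)]] by (auto simp: pre_def)
      have ii: "block g r (i mod d) = r i" for r using d g(2) by (simp add: block_def)
      have "block g t (i mod d) \<noteq> 1"
        using \<U>[OF U0(1) _ bl[OF a(3)] bl[OF a(4)] in_U0[OF a(3)] in_U0[OF a(4)]] ii[of s] a(5) d by simp
      then show ?thesis using ii by simp
    qed
  qed (use that in blast)
  have "{V\<in>pre ` \<beta>. t \<in> V} \<subseteq> pre ` {V\<in>\<beta>. q t \<in> V}" by (auto simp: pre_def)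
  then have "card {V\<in>pre ` \<beta>. t \<in> V} \<le> card (pre ` {V\<in>\<beta>. q t \<in> V})" using f\<beta> by (intro card_mono) auto
  also have "\<dots> \<le> card {V\<in>\<beta>. q t \<in> V}" using f\<beta> by (intro card_image_le) auto
  finally have big: "Suc n \<le> card {V\<in>\<beta>. q t \<in> V}" using t(2) by simp
  have qt: "q t \<in> topspace XT" using continuous_map_image_subset_topspace[OF q] t(1) by blast
  show ?thesis
  proof (rule ccontr)
    assume "\<not> ?thesis"
    then have "cover_D XT (cover_join_over XT (shift_action G X) \<alpha> F) < int n" by (simp add: n_def)
    moreover have "0 \<le> cover_D XT (cover_join_over XT (shift_action G X) \<alpha> F)"
      using qt by (intro cover_D_nonneg[OF join]) auto
    ultimately have "0 < n" "cover_ord XT \<beta> \<le> int (n - 1)" using \<beta>(3) by auto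
    then have "card {V\<in>\<beta>. q t \<in> V} \<le> Suc (n - 1)" using cover_ord_le_iff[OF f\<beta>, of XT "n - 1"] qt by auto
    then show False using big \<open>0 < n\<close> by simp
  qed
qed

end

section \<open>The construction\<close>

text \<open>Each point of \<open>Q\<close> is kept in one chosen member and removed from the others,
  which stay open because points of \<open>Q\<close> are closed. Letters already written will thus
  have rank 0.\<close>

lemma cover_isolate_points:
  assumes \<gamma>: "finite_open_cover X \<gamma>" and Q: "finite Q" "\<And>a. a \<in> Q \<Longrightarrow> closedin X {a}"
  obtains \<beta> where "finite_open_cover X \<beta>" "refines_cover \<beta> \<gamma>"
    "\<And>x. card {U\<in>\<beta>. x \<in> U} \<le> card {U\<in>\<gamma>. x \<in> U}" "\<And>a. a \<in> Q \<Longrightarrow> card {U\<in>\<beta>. a \<in> U} \<le> 1"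
proof -
  have "\<exists>U\<in>\<gamma>. a \<in> U" if "a \<in> Q" for a
  proof -
    have "a \<in> topspace X" using closedin_subset[OF Q(2)[OF that]] by simp
    then have "a \<in> \<Union>\<gamma>" using \<gamma> by (simp add: finite_open_cover_def)
    then show ?thesis by blast
  qed
  then obtain c where c: "\<And>a. a \<in> Q \<Longrightarrow> c a \<in> \<gamma> \<and> a \<in> c a" by metis
  define h where "h U = U - {a\<in>Q. c a \<noteq> U}" for U
  have f\<gamma>: "finite \<gamma>" using \<gamma> by (simp add: finite_open_cover_def)
  have image_card: "card {V\<in>h ` \<gamma>. x \<in> V} \<le> card {U\<in>\<gamma>. x \<in> h U}" for x
  proof -
    have "{V\<in>h ` \<gamma>. x \<in> V} = h ` {U\<in>\<gamma>. x \<in> h U}" by auto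
    then show ?thesis using f\<gamma> by (simp add: card_image_le)
  qed
  show ?thesis
  proof (rule that[of "h ` \<gamma>"])
    show "refines_cover (h ` \<gamma>) \<gamma>" by (auto simp: refines_cover_def h_def)
    show "finite_open_cover X (h ` \<gamma>)" unfolding finite_open_cover_def
    proof (intro conjI ballI)
      show "finite (h ` \<gamma>)" using f\<gamma> by simp
      fix A assume "A \<in> h ` \<gamma>"
      then obtain U where U: "U \<in> \<gamma>" "A = h U" by auto
      have "closedin X (\<Union>a\<in>{a\<in>Q. c a \<noteq> U}. {a})" using Q by (intro closedin_Union) auto
      then have "closedin X {a\<in>Q. c a \<noteq> U}" by simp
      then show "openin X A" unfolding U(2) h_def using \<gamma> U(1) by (intro openin_diff) (auto simp: finite_open_cover_def)
    next
      have "x \<in> \<Union>(h ` \<gamma>)" if x: "x \<in> topspace X" for x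
      proof (cases "x \<in> Q")
        case True
        then have "x \<in> h (c x)" "c x \<in> \<gamma>" using c by (auto simp: h_def)
        then show ?thesis by blast
      next
        case False
        have "x \<in> \<Union>\<gamma>" using \<gamma> x by (simp add: finite_open_cover_def)
        then show ?thesis using False by (auto simp: h_def)
      qed
      moreover have "\<Union>(h ` \<gamma>) \<subseteq> \<Union>\<gamma>" by (auto simp: h_def)
      ultimately show "\<Union>(h ` \<gamma>) = topspace X" using \<gamma> by (auto simp: finite_open_cover_def)
    qed
    show "card {V\<in>h ` \<gamma>. x \<in> V} \<le> card {U\<in>\<gamma>. x \<in> U}" for x
    proof (rule order.trans[OF image_card])
      show "card {U\<in>\<gamma>. x \<in> h U} \<le> card {U\<in>\<gamma>. x \<in> U}" using f\<gamma> by (intro card_mono) (auto simp: h_def)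
    qed
    show "card {V\<in>h ` \<gamma>. a \<in> V} \<le> 1" if a: "a \<in> Q" for a
    proof (rule order.trans[OF image_card])
      have "{U\<in>\<gamma>. a \<in> h U} \<subseteq> {c a}" using a by (auto simp: h_def)
      then have "card {U\<in>\<gamma>. a \<in> h U} \<le> card {c a}" by (intro card_mono) auto
      then show "card {U\<in>\<gamma>. a \<in> h U} \<le> 1" by simp
    qed
  qed
qed

lemma fine_cover_exists:
  fixes P :: "'p::metric_space set"
  assumes P: "compact P" and d: "covering_dim_le (top_of_set P) d" and Q: "finite Q" "Q \<subseteq> P" and e: "0 < e"
  obtains \<beta> where "finite_open_cover (top_of_set P) \<beta>"
    "\<And>x. x \<in> P \<Longrightarrow> card {U\<in>\<beta>. x \<in> U} \<le> Suc d" "\<And>a. a \<in> Q \<Longrightarrow> card {U\<in>\<beta>. a \<in> U} \<le> 1"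
    "\<And>U x y. U \<in> \<beta> \<Longrightarrow> x \<in> U \<Longrightarrow> y \<in> U \<Longrightarrow> dist x y < e"
proof -
  have "P \<subseteq> (\<Union>p\<in>P. ball p (e/2))" using e by auto
  then obtain C where C: "C \<subseteq> P" "finite C" "P \<subseteq> (\<Union>p\<in>C. ball p (e/2))"
    using compactE_image[OF P, of P "\<lambda>p. ball p (e/2)"] by auto
  define \<alpha> where "\<alpha> = (\<lambda>p. P \<inter> ball p (e/2)) ` C"
  have \<alpha>: "finite_open_cover (top_of_set P) \<alpha>" using C by (auto simp: \<alpha>_def finite_open_cover_def)
  then have "cover_D (top_of_set P) \<alpha> \<le> int d" using d by (simp add: covering_dim_le_def)
  then obtain \<gamma> where \<gamma>: "finite_open_cover (top_of_set P) \<gamma>" "refines_cover \<gamma> \<alpha>"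
    "\<forall>x\<in>topspace (top_of_set P). card {U\<in>\<gamma>. x \<in> U} \<le> Suc d"
    unfolding cover_D_le_iff[OF \<alpha>] by blast
  have "closedin (top_of_set P) {a}" if "a \<in> Q" for a using that Q(2) by (auto intro: closed_subset)
  then obtain \<beta> where \<beta>: "finite_open_cover (top_of_set P) \<beta>" "refines_cover \<beta> \<gamma>"
    "\<And>x. card {U\<in>\<beta>. x \<in> U} \<le> card {U\<in>\<gamma>. x \<in> U}" "\<And>a. a \<in> Q \<Longrightarrow> card {U\<in>\<beta>. a \<in> U} \<le> 1"
    by (rule cover_isolate_points[OF \<gamma>(1) Q(1)]) (assumption | rule that)+
  show ?thesis
  proof (rule that[OF \<beta>(1)])
    show "card {U\<in>\<beta>. x \<in> U} \<le> Suc d" if "x \<in> P" for x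
    proof (rule order.trans[OF \<beta>(3)])
      show "card {U\<in>\<gamma>. x \<in> U} \<le> Suc d" using \<gamma>(3) that by simp
    qed
    show "card {U\<in>\<beta>. a \<in> U} \<le> 1" if "a \<in> Q" for a using \<beta>(4)[OF that] .
    fix U x y assume U: "U \<in> \<beta>" "x \<in> U" "y \<in> U"
    have "refines_cover \<beta> \<alpha>" using \<beta>(2) \<gamma>(2) by (rule refines_cover_trans)
    then obtain A where "A \<in> \<alpha>" "U \<subseteq> A" using U(1) unfolding refines_cover_def by blast
    then obtain p where "U \<subseteq> ball p (e/2)" by (auto simp: \<alpha>_def)
    then have "dist p x < e/2" "dist p y < e/2" using U by auto
    then show "dist x y < e" using dist_triangle3[of x y p] by linarith
  qed
qed

context group begin

lemma G_system_subshift: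
  fixes P :: "'p::metric_space set"
  assumes P: "compact P" and cnt: "countable (carrier G)" and X: "subshift G (top_of_set P) X" "X \<noteq> {}"
  shows "G_system G (subtopology (full_shift G (top_of_set P)) X) (shift_action G X)"
proof -
  let ?T = "full_shift G (top_of_set P)"
  have XT: "X \<subseteq> topspace ?T" using X(1) by (rule subshift_subset)
  have top: "topspace (subtopology ?T X) = X" using XT by auto
  have sX: "shift_map G g x \<in> X" if "g \<in> carrier G" "x \<in> X" for g x using subshift_shift[OF X(1) that] .
  have ext: "x \<in> extensional (carrier G)" if "x \<in> X" for x using that XT by (auto simp: topspace_full_shift PiE_iff)
  have inv: "shift_map G (inv g) (shift_map G g x) = x" "shift_map G g (shift_map G (inv g) x) = x"
    if "g \<in> carrier G" "x \<in> X" for g x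
    using that by (simp_all add: shift_map_shift_map shift_map_one[OF ext])
  have bij: "shift_action G X g \<in> Bij X" if g: "g \<in> carrier G" for g
  proof -
    have "bij_betw (shift_action G X g) X X"
    proof (rule bij_betw_byWitness[where f'="shift_map G (inv g)"])
      show "\<forall>x\<in>X. shift_map G (inv g) (shift_action G X g x) = x" using inv g by (simp add: shift_action_def)
      show "\<forall>x\<in>X. shift_action G X g (shift_map G (inv g) x) = x" using inv g sX by (simp add: shift_action_def)
      show "shift_action G X g ` X \<subseteq> X" using sX g by (auto simp: shift_action_def)
      show "shift_map G (inv g) ` X \<subseteq> X" using sX g by auto
    qed
    then show ?thesis by (auto simp: Bij_def shift_action_def)
  qed
  have "group_hom G (BijGroup X) (shift_action G X)"
  proof (rule group_hom.intro[OF is_group group_BijGroup], unfold_locales)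
    show "shift_action G X \<in> hom G (BijGroup X)"
    proof (rule homI)
      show "shift_action G X g \<in> carrier (BijGroup X)" if "g \<in> carrier G" for g
        using bij[OF that] by (simp add: BijGroup_def)
      show "shift_action G X (g \<otimes> h) = shift_action G X g \<otimes>\<^bsub>BijGroup X\<^esub> shift_action G X h"
        if "g \<in> carrier G" "h \<in> carrier G" for g h
        using that bij sX
        by (auto simp: BijGroup_def compose_def shift_action_def shift_map_shift_map fun_eq_iff)
    qed
  qed
  then have act: "group_action G X (shift_action G X)" by (rule group_action.intro)
  have cP: "compact_space (top_of_set P)" using P by (simp add: compact_space_subtopology)
  have "closedin ?T X" using X(1) by (simp add: subshift_def)
  then have "compact_space (subtopology ?T X)"
    using compact_space_full_shift[OF cP, of G] by (simp add: closedin_compact_space compact_space_subtopology)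
  moreover have "metrizable_space (subtopology ?T X)"
  proof (rule metrizable_space_subtopology)
    show "metrizable_space ?T" unfolding full_shift_def metrizable_space_product_topology
      using cnt by (auto simp: metrizable_space_subtopology metrizable_space_euclidean)
  qed
  moreover have "continuous_map (subtopology ?T X) (subtopology ?T X) (shift_action G X g)" if g: "g \<in> carrier G" for g
  proof -
    have "continuous_map (subtopology ?T X) (subtopology ?T X) (shift_map G g)"
      using sX[OF g] continuous_map_shift_map[OF g] top
      by (auto simp: continuous_map_in_subtopology intro: continuous_map_from_subtopology)
    then show ?thesis by (rule continuous_map_eq) (use top in \<open>auto simp: shift_action_def\<close>)
  qed
  ultimately show ?thesis unfolding G_system_def top using act X(2) by blast
qed

end

section \<open>The upper bound for mean dimension and the limit subshift\<close>

context infinite_folner_group begin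

text \<open>By the Lebesgue number for products, a point is located in the join of
  \<open>\<alpha>\<close> over \<open>F\<close> once its coordinates in \<open>E F\<close> are known
  up to \<open>e\<close>. A fine cover of \<open>P\<close> of order \<open>d\<close> that isolates
  the finitely many letters, pulled back along these coordinates, has rank at most \<open>d\<close>
  at free coordinates and 0 at letters. So the order is at most \<open>d\<close> times the number of
  free coordinates in \<open>E F\<close>, which is hardly larger than \<open>F\<close>.\<close>

lemma mean_cover_D_le_star_density:
  fixes P :: "'p::metric_space set"
  assumes P: "compact P" and cnt: "countable (carrier G)" and d: "covering_dim_le (top_of_set P) d"
    and W: "star_system D W" "D \<subseteq> P"
    and X: "subshift G (top_of_set P) X" "X \<noteq> {}"
    and XW: "\<And>x. x \<in> X \<Longrightarrow> \<exists>w\<in>W. \<forall>g\<in>carrier G. w g \<noteq> None \<longrightarrow> w g = Some (x g)"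
    and \<alpha>: "finite_open_cover (subtopology (full_shift G (top_of_set P)) X) \<alpha>"
  shows "mean_cover_D G (subtopology (full_shift G (top_of_set P)) X) (shift_action G X) \<alpha> \<le> real d * star_density W"
proof -
  let ?XT = "subtopology (full_shift G (top_of_set P)) X"
  have XT: "X \<subseteq> topspace (full_shift G (top_of_set P))" using X(1) by (rule subshift_subset)
  have top: "topspace ?XT = X" using XT by auto
  have S: "G_system G ?XT (shift_action G X)" using G_system_subshift[OF P cnt X] .
  note p = G_system_props[OF S]
  obtain A where A: "finite A" "A \<subseteq> insert None (Some ` D)" "minimal_subshift (discrete_topology A) W"
    using W(1) by (auto simp: star_system_def)
  \<comment> \<open>Where a compatible word is not free, the point takes one of these finitely many
    values.\<close>
  define Q where "Q = {a\<in>D. Some a \<in> A}"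
  have "Q \<subseteq> the ` A" by (force simp: Q_def)
  then have Q: "finite Q" "Q \<subseteq> P" using A(1) W(2) by (auto simp: Q_def intro: finite_subset)
  have WA: "w g \<in> A" if "w \<in> W" "g \<in> carrier G" for w g
    using that subshift_subset[of "discrete_topology A" W] A(3) by (auto simp: minimal_subshift_def topspace_full_shift PiE_iff)
  have xP: "x g \<in> P" if "x \<in> X" "g \<in> carrier G" for x g using that XT by (auto simp: topspace_full_shift PiE_iff)
  have cX: "compactin (product_topology (\<lambda>_. top_of_set P) (carrier G)) X"
    using X(1) compact_space_full_shift[of "top_of_set P" G] P
    by (auto simp: subshift_def full_shift_def compact_space_subtopology intro: closedin_compact_space)
  obtain E e where E: "finite E" "E \<subseteq> carrier G" "0 < e"
    "\<And>x. x \<in> X \<Longrightarrow> \<exists>V\<in>\<alpha>. \<forall>y\<in>X. (\<forall>i\<in>E. dist (x i) (y i) < e) \<longrightarrow> y \<in> V"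
  proof (rule product_Lebesgue_number[OF cX, of \<alpha>])
    show "openin (subtopology (product_topology (\<lambda>_. top_of_set P) (carrier G)) X) V" if "V \<in> \<alpha>" for V
      using \<alpha> that by (simp add: finite_open_cover_def full_shift_def)
    show "X \<subseteq> \<Union>\<alpha>" using \<alpha> top by (simp add: finite_open_cover_def)
  qed (use that in blast)
  obtain \<beta> where \<beta>: "finite_open_cover (top_of_set P) \<beta>"
    "\<And>x. x \<in> P \<Longrightarrow> card {U\<in>\<beta>. x \<in> U} \<le> Suc d" "\<And>a. a \<in> Q \<Longrightarrow> card {U\<in>\<beta>. a \<in> U} \<le> 1"
    "\<And>U x y. U \<in> \<beta> \<Longrightarrow> x \<in> U \<Longrightarrow> y \<in> U \<Longrightarrow> dist x y < e"
    by (rule fine_cover_exists[OF P d Q E(3)]) (assumption | rule that)+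
  define m where "m = star_density W"
  have m0: "0 \<le> m" unfolding m_def using star_system_nonempty[OF W(1)] by (rule star_density_nonneg)
  have bound: "mean_cover_D G ?XT (shift_action G X) \<alpha> \<le> real d * (m + 2 * \<epsilon>)" if \<epsilon>: "0 < \<epsilon>" for \<epsilon>
  proof -
    obtain K \<delta> where K: "finite K" "K \<subseteq> carrier G" "0 < \<delta>"
      "\<And>F w. invariant_set G K \<delta> F \<Longrightarrow> w \<in> W \<Longrightarrow> real (stars w F) \<le> (star_density W + \<epsilon>) * card F"
      by (rule star_density_upper[OF star_system_shift[OF W(1)] \<epsilon>]) (assumption | rule that)+
    have "\<forall>\<^sub>F n in sequentially. of_int (cover_D ?XT (cover_join_over ?XT (shift_action G X) \<alpha> (\<Phi> n))) / real (card (\<Phi> n)) \<le> real d * (m + 2 * \<epsilon>)"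
      using folner_eventually_invariant[OF folner K(1-3)] folner_eventually_invariant[OF folner E(1,2) \<epsilon>]
    proof eventually_elim
      fix n assume n: "invariant_set G K \<delta> (\<Phi> n)" "invariant_set G E \<epsilon> (\<Phi> n)"
      define F where "F = \<Phi> n"
      have F: "finite F" "F \<noteq> {}" "F \<subseteq> carrier G" using n(1) by (auto simp: F_def invariant_set_def)
      define I where "I = E <#> F"
      have I: "finite I" "I \<subseteq> carrier G" using E F by (auto simp: I_def finite_set_mult set_mult_def)
      define M where "M = nat \<lfloor>(m + 2 * \<epsilon>) * card F\<rfloor>"
      have starsI: "stars w I \<le> M" if w: "w \<in> W" for w
      proof -
        have "stars w I \<le> card ({g\<in>F. w g = None} \<union> (I - F))" unfolding stars_def using F I by (intro card_mono) auto
        also have "\<dots> \<le> stars w F + card (I - F)" unfolding stars_def by (rule card_Un_le)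
        finally have "real (stars w I) \<le> stars w F + real (card (I - F))" by linarith
        also have "\<dots> \<le> (m + \<epsilon>) * card F + \<epsilon> * card F"
          using K(4)[OF n(1) w] n(2) by (intro add_mono) (auto simp: m_def F_def I_def invariant_set_def)
        also have "\<dots> = (m + 2 * \<epsilon>) * card F" by (simp add: algebra_simps)
        finally show ?thesis unfolding M_def by (simp add: le_nat_floor)
      qed
      have "cover_D ?XT (cover_join_over ?XT (shift_action G X) \<alpha> F) \<le> int (d * M)"
      proof (rule cover_D_le_sum[OF p(1) _ I(1), where Y="top_of_set P" and \<phi>="\<lambda>h x. x h" and \<beta>="\<lambda>_. \<beta>"])
        show "finite_open_cover ?XT (cover_join_over ?XT (shift_action G X) \<alpha> F)"
          using F p(3) by (intro finite_open_cover_join_over[OF \<alpha>]) auto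
        show "continuous_map ?XT (top_of_set P) (\<lambda>x. x h)" if "h \<in> I" for h
          unfolding full_shift_def using that I by (intro continuous_map_from_subtopology continuous_map_product_projection) auto
        show "finite_open_cover (top_of_set P) \<beta>" by fact
        show "(\<Sum>h\<in>I. card {U\<in>\<beta>. x h \<in> U} - 1) \<le> d * M" if "x \<in> topspace ?XT" for x
        proof -
          have x: "x \<in> X" using that top by simp
          obtain w where w: "w \<in> W" "\<forall>g\<in>carrier G. w g \<noteq> None \<longrightarrow> w g = Some (x g)" using XW[OF x] by blast
          have "(\<Sum>h\<in>I. card {U\<in>\<beta>. x h \<in> U} - 1) \<le> (\<Sum>h\<in>I. if w h = None then d else 0)"
          proof (rule sum_mono)
            fix h assume "h \<in> I"
            then have h: "h \<in> carrier G" using I by auto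
            show "card {U\<in>\<beta>. x h \<in> U} - 1 \<le> (if w h = None then d else 0)"
            proof (cases "w h = None")
              case True
              then show ?thesis using \<beta>(2)[OF xP[OF x h]] by simp
            next
              case False
              then have "w h = Some (x h)" using w(2) h by blast
              then have "Some (x h) \<in> A" using WA[OF w(1) h] by simp
              then have "x h \<in> Q" using A(2) by (auto simp: Q_def)
              then show ?thesis using \<beta>(3)[of "x h"] False by simp
            qed
          qed
          also have "\<dots> = d * stars w I" using I(1) by (simp add: stars_def mult.commute flip: sum.inter_filter)
          also have "\<dots> \<le> d * M" using starsI[OF w(1)] by simp
          finally show ?thesis .
        qed
        fix U assume U: "\<And>i. i \<in> I \<Longrightarrow> U i \<in> \<beta>"
        show "\<exists>B\<in>cover_join_over ?XT (shift_action G X) \<alpha> F. {x\<in>topspace ?XT. \<forall>i\<in>I. x i \<in> U i} \<subseteq> B"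
        proof (cases "{x\<in>X. \<forall>i\<in>I. x i \<in> U i} = {}")
          \<comment> \<open>An empty cell lies in any member of the join, and the join has a member
            because \<open>X\<close> is nonempty.\<close>
          case True
          obtain x0 where "x0 \<in> X" using X(2) by auto
          moreover have "finite_open_cover ?XT (cover_join_over ?XT (shift_action G X) \<alpha> F)"
            using F p(3) by (intro finite_open_cover_join_over[OF \<alpha>]) auto
          ultimately have "x0 \<in> \<Union>(cover_join_over ?XT (shift_action G X) \<alpha> F)"
            unfolding finite_open_cover_def using top by simp
          then obtain B where "B \<in> cover_join_over ?XT (shift_action G X) \<alpha> F" by blast
          then show ?thesis using True top by (intro bexI[of _ B]) auto
        next
          case False
          then obtain x0 where x0: "x0 \<in> X" "\<forall>i\<in>I. x0 i \<in> U i" by auto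
          have "\<exists>V\<in>\<alpha>. \<forall>y\<in>X. (\<forall>i\<in>E. dist (shift_map G g x0 i) (y i) < e) \<longrightarrow> y \<in> V" if "g \<in> F" for g
            using E(4)[OF subshift_shift[OF X(1) _ x0(1)]] that F(3) by blast
          then obtain V where V: "\<And>g. g \<in> F \<Longrightarrow> V g \<in> \<alpha> \<and> (\<forall>y\<in>X. (\<forall>i\<in>E. dist (shift_map G g x0 i) (y i) < e) \<longrightarrow> y \<in> V g)"
            by metis
          have "{x\<in>topspace ?XT. \<forall>g\<in>F. shift_action G X g x \<in> V g} \<in> cover_join_over ?XT (shift_action G X) \<alpha> F"
            using V by (intro cover_join_over_memI) auto
          moreover have "{x\<in>topspace ?XT. \<forall>i\<in>I. x i \<in> U i} \<subseteq> {x\<in>topspace ?XT. \<forall>g\<in>F. shift_action G X g x \<in> V g}"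
          proof (intro subsetI CollectI conjI ballI)
            fix x assume x: "x \<in> {x\<in>topspace ?XT. \<forall>i\<in>I. x i \<in> U i}"
            then show "x \<in> topspace ?XT" by simp
            have xX: "x \<in> X" using x top by simp
            fix g assume g: "g \<in> F"
            have gc: "g \<in> carrier G" using g F by auto
            have "dist (shift_map G g x0 i) (shift_map G g x i) < e" if i: "i \<in> E" for i
            proof -
              have "i \<otimes> g \<in> I" using i g by (auto simp: I_def intro: set_multI)
              then have "dist (x0 (i \<otimes> g)) (x (i \<otimes> g)) < e" using x0(2) x U by (intro \<beta>(4)) auto
              moreover have "i \<in> carrier G" using i E by auto
              ultimately show ?thesis by (simp add: shift_map_apply)
            qed
            then show "shift_action G X g x \<in> V g"
              using V[OF g] subshift_shift[OF X(1) gc xX] xX by (simp add: shift_action_def)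
          qed
          ultimately show ?thesis by blast
        qed
      qed
      then have "real_of_int (cover_D ?XT (cover_join_over ?XT (shift_action G X) \<alpha> F)) \<le> real d * real M"
        by (metis of_int_le_iff of_int_of_nat_eq of_nat_mult)
      also have "\<dots> \<le> real d * ((m + 2 * \<epsilon>) * card F)"
      proof (rule mult_left_mono)
        have "0 \<le> (m + 2 * \<epsilon>) * card F" using m0 \<epsilon> by simp
        then show "real M \<le> (m + 2 * \<epsilon>) * card F" unfolding M_def by (rule of_nat_floor)
      qed simp
      finally show "of_int (cover_D ?XT (cover_join_over ?XT (shift_action G X) \<alpha> (\<Phi> n))) / real (card (\<Phi> n)) \<le> real d * (m + 2 * \<epsilon>)"
        using F by (simp add: F_def[symmetric] card_gt_0_iff pos_divide_le_eq mult.assoc)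
    qed
    then show ?thesis using mean_cover_D_tendsto[OF S \<alpha> folner] by (intro tendsto_upperbound) auto
  qed
  have "((\<lambda>\<epsilon>. real d * (m + 2 * \<epsilon>)) \<longlongrightarrow> real d * (m + 2 * 0)) (at_right 0)" by (intro tendsto_intros)
  moreover have "\<forall>\<^sub>F \<epsilon> in at_right 0. mean_cover_D G ?XT (shift_action G X) \<alpha> \<le> real d * (m + 2 * \<epsilon>)"
    using bound by (auto simp: eventually_at_right_field intro!: exI[of _ 1])
  ultimately have "mean_cover_D G ?XT (shift_action G X) \<alpha> \<le> real d * (m + 2 * 0)"
    by (intro tendsto_lowerbound) auto
  then show ?thesis by (simp add: m_def)
qed

definition compatible_points :: "'p set \<Rightarrow> ('a \<Rightarrow> 'p option) set \<Rightarrow> ('a \<Rightarrow> 'p) set" where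
  "compatible_points P W = {x\<in>carrier G \<rightarrow>\<^sub>E P. \<exists>w\<in>W. \<forall>g\<in>carrier G. w g \<noteq> None \<longrightarrow> w g = Some (x g)}"

text \<open>Compatible pairs of a point and a word form a closed set, and projection along the space
  of words, compact because \<open>A\<close> is finite, keeps it closed.\<close>

lemma closedin_compatible_points:
  fixes P :: "'p::metric_space set"
  assumes A: "finite A" and W: "closedin (full_shift G (discrete_topology A)) W"
  shows "closedin (full_shift G (top_of_set P)) (compatible_points P W)"
proof -
  let ?T = "full_shift G (top_of_set P)" and ?S = "full_shift G (discrete_topology A)"
  let ?Z = "prod_topology ?T ?S"
  have cS: "compact_space ?S" using A by (intro compact_space_full_shift) (simp add: compact_space_discrete_topology)
  have T: "topspace ?T = (carrier G \<rightarrow>\<^sub>E P)" by (simp add: topspace_full_shift)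
  define C where "C g = (\<Union>a\<in>A. {z\<in>topspace ?Z. snd z g \<in> {a}} \<inter> {z\<in>topspace ?Z. fst z g \<in> {b\<in>P. a \<noteq> None \<longrightarrow> a = Some b}})" for g
  have C: "closedin ?Z (C g)" if g: "g \<in> carrier G" for g
  proof -
    have s: "continuous_map ?Z (discrete_topology A) (\<lambda>z. snd z g)"
      using continuous_map_compose[OF continuous_map_snd[of ?T ?S] continuous_map_product_projection[of g "carrier G" "\<lambda>_. discrete_topology A", folded full_shift_def]] g
      by (simp add: o_def)
    have f: "continuous_map ?Z (top_of_set P) (\<lambda>z. fst z g)"
      using continuous_map_compose[OF continuous_map_fst[of ?T ?S] continuous_map_product_projection[of g "carrier G" "\<lambda>_. top_of_set P", folded full_shift_def]] g
      by (simp add: o_def)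
    have "closedin ?Z {z\<in>topspace ?Z. snd z g \<in> {a}}" if "a \<in> A" for a
      by (rule closedin_continuous_map_preimage[OF s]) (use that in auto)
    moreover have "closedin (top_of_set P) {b\<in>P. a \<noteq> None \<longrightarrow> a = Some b}" for a
    proof (cases a)
      case None
      then show ?thesis using closedin_topspace[of "top_of_set P"] by simp
    next
      case (Some c)
      then have "{b\<in>P. a \<noteq> None \<longrightarrow> a = Some b} = {c} \<inter> P" by auto
      then show ?thesis by (simp add: closedin_closed_Int Int_commute)
    qed
    then have "closedin ?Z {z\<in>topspace ?Z. fst z g \<in> {b\<in>P. a \<noteq> None \<longrightarrow> a = Some b}}" for a
      by (rule closedin_continuous_map_preimage[OF f])
    ultimately show ?thesis unfolding C_def using A by (intro closedin_Union) auto
  qed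
  have "W \<subseteq> topspace ?S" using W by (rule closedin_subset)
  then have WA: "w g \<in> A" if "w \<in> W" "g \<in> carrier G" for w g using that by (auto simp: topspace_full_shift PiE_iff)
  have Cmem: "z \<in> C g \<longleftrightarrow> (snd z g \<noteq> None \<longrightarrow> snd z g = Some (fst z g))"
    if "z \<in> topspace ?T \<times> W" "g \<in> carrier G" for z g
    using that WA \<open>W \<subseteq> topspace ?S\<close> by (auto simp: C_def T PiE_iff mem_Times_iff)
  define D where "D = (topspace ?T \<times> W) \<inter> (topspace ?Z \<inter> (\<Inter>g\<in>carrier G. C g))"
  have "closedin ?Z D" unfolding D_def
  proof (intro closedin_Int)
    show "closedin ?Z (topspace ?T \<times> W)" using W by (simp add: closedin_prod_Times_iff)
    show "closedin ?Z (\<Inter>g\<in>carrier G. C g)" using C one_closed by (intro closedin_Inter) auto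
  qed (rule closedin_topspace)
  then have "closedin ?T (fst ` D)"
    using Abstract_Topological_Spaces.closed_map_fst[OF cS, of ?T] by (simp add: closed_map_def)
  moreover have "fst ` D = compatible_points P W"
  proof (intro equalityI subsetI)
    fix x assume "x \<in> fst ` D"
    then obtain w where w: "(x, w) \<in> D" by auto
    then have xw: "(x, w) \<in> topspace ?T \<times> W" "\<forall>g\<in>carrier G. (x, w) \<in> C g" by (auto simp: D_def)
    then have "\<forall>g\<in>carrier G. w g \<noteq> None \<longrightarrow> w g = Some (x g)" using Cmem[OF xw(1)] by auto
    then show "x \<in> compatible_points P W" using xw(1) T unfolding compatible_points_def by blast
  next
    fix x assume "x \<in> compatible_points P W"
    then obtain w where w: "x \<in> topspace ?T" "w \<in> W" "\<forall>g\<in>carrier G. w g \<noteq> None \<longrightarrow> w g = Some (x g)"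
      by (auto simp: compatible_points_def T)
    then have "(x, w) \<in> topspace ?T \<times> W" by simp
    moreover have "(x, w) \<in> C g" if "g \<in> carrier G" for g using Cmem[OF calculation that] w(3) that by simp
    moreover have "(x, w) \<in> topspace ?Z" using w \<open>W \<subseteq> topspace ?S\<close> by auto
    ultimately have "(x, w) \<in> D" by (simp add: D_def)
    then show "x \<in> fst ` D" by force
  qed
  ultimately show ?thesis by simp
qed

lemma subshift_compatible_points:
  fixes P :: "'p::metric_space set"
  assumes W: "star_system D W"
  shows "subshift G (top_of_set P) (compatible_points P W)"
  unfolding subshift_def
proof (intro conjI ballI subsetI)
  obtain A where A: "finite A" "minimal_subshift (discrete_topology A) W" using W by (auto simp: star_system_def)
  then show "closedin (full_shift G (top_of_set P)) (compatible_points P W)"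
    by (intro closedin_compatible_points) (auto simp: minimal_subshift_def subshift_def)
  fix g y assume g: "g \<in> carrier G" and y: "y \<in> shift_map G g ` compatible_points P W"
  then obtain x w where x: "y = shift_map G g x" "x \<in> carrier G \<rightarrow>\<^sub>E P" "w \<in> W"
    "\<forall>g\<in>carrier G. w g \<noteq> None \<longrightarrow> w g = Some (x g)" by (auto simp: compatible_points_def)
  have "shift_map G g w \<in> W" using star_system_shift[OF W g x(3)] .
  moreover have "\<forall>h\<in>carrier G. shift_map G g w h \<noteq> None \<longrightarrow> shift_map G g w h = Some (y h)"
    using x g by (simp add: shift_map_apply)
  moreover have "y \<in> carrier G \<rightarrow>\<^sub>E P" using x(1,2) g by (auto simp: shift_map_def PiE_iff)
  ultimately show "y \<in> compatible_points P W" unfolding compatible_points_def by blast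
qed

lemma star_system_values: "star_system D W \<Longrightarrow> w \<in> W \<Longrightarrow> g \<in> carrier G \<Longrightarrow> w g = Some a \<Longrightarrow> a \<in> D"
proof -
  assume a: "star_system D W" "w \<in> W" "g \<in> carrier G" "w g = Some a"
  then obtain A where A: "A \<subseteq> insert None (Some ` D)" "minimal_subshift (discrete_topology A) W" by (auto simp: star_system_def)
  then have "w \<in> carrier G \<rightarrow>\<^sub>E A" using subshift_subset[of "discrete_topology A" W] a(2)
    by (auto simp: minimal_subshift_def topspace_full_shift)
  then have "w g \<in> A" using a(3) by auto
  then show "a \<in> D" using A(1) a(4) by auto
qed

lemma finite_partial_maps_enumeration:
  assumes "countable (carrier G)" "countable (D :: 'p set)"
  obtains \<tau> :: "nat \<Rightarrow> 'a \<Rightarrow> 'p option" where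
    "range \<tau> = {\<mu>. finite (dom \<mu>) \<and> dom \<mu> \<subseteq> carrier G \<and> ran \<mu> \<subseteq> D}"
proof -
  let ?M = "{\<mu> :: 'a \<Rightarrow> 'p option. finite (dom \<mu>) \<and> dom \<mu> \<subseteq> carrier G \<and> ran \<mu> \<subseteq> D}"
  have "countable (carrier G \<times> D)" using assms by (rule countable_SIGMA)
  then have "countable {S. finite S \<and> S \<subseteq> carrier G \<times> D}" by (simp add: countable_Collect_finite_subset conj_commute)
  moreover have "Map.graph ` ?M \<subseteq> {S. finite S \<and> S \<subseteq> carrier G \<times> D}"
  proof
    fix S assume "S \<in> Map.graph ` ?M"
    then obtain \<mu> where \<mu>: "S = Map.graph \<mu>" "finite (dom \<mu>)" "dom \<mu> \<subseteq> carrier G" "ran \<mu> \<subseteq> D" by auto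
    have "Map.graph \<mu> = (\<lambda>x. (x, the (\<mu> x))) ` dom \<mu>" by (auto simp: Map.graph_def image_iff)
    then have "finite S" using \<mu> by simp
    then show "S \<in> {S. finite S \<and> S \<subseteq> carrier G \<times> D}" using \<mu> by (auto simp: Map.graph_def ran_def dom_def)
  qed
  ultimately have "countable (Map.graph ` ?M)" by (rule countable_subset[rotated])
  moreover have "inj_on Map.graph ?M"
  proof (rule inj_onI)
    fix \<mu> \<nu> :: "'a \<Rightarrow> 'p option" assume "Map.graph \<mu> = Map.graph \<nu>"
    then have "\<mu> x = Some a \<longleftrightarrow> \<nu> x = Some a" for x a by (auto simp: Map.graph_def set_eq_iff)
    then show "\<mu> = \<nu>" by (metis ext option.exhaust)
  qed
  ultimately have "countable ?M" by (rule countable_image_inj_on)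
  moreover have "Map.empty \<in> ?M" by simp
  ultimately show ?thesis using that[of "from_nat_into ?M"] by (metis (no_types, lifting) empty_iff range_from_nat_into)
qed

text \<open>\<open>X\<close> is the intersection of the decreasing compatible subshifts. Given
  \<open>x\<close>, \<open>y\<close> and a window, the pattern to be found in \<open>y\<close>
  copies \<open>x\<close> at letters and approximates it by points of \<open>D\<close> at free
  coordinates. It is some \<open>\<tau> i\<close>, hence was written into all words of the next
  stage, provided some word of stage \<open>i\<close> admits it; a word of a later stage compatible
  with \<open>x\<close> supplies such a word. The cubes arise by compactness from backgrounds at the
  single stages.\<close>

theorem minimal_cube_subshift_exists:
  fixes P :: "'p::{metric_space, second_countable_topology} set"
  assumes P: "compact P" "P \<noteq> {}" and cnt: "countable (carrier G)" and c: "0 \<le> c" "c < 1"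
  obtains X D W where "subshift G (top_of_set P) X" "X \<noteq> {}" "D \<subseteq> P"
    "\<And>x y F e. x \<in> X \<Longrightarrow> y \<in> X \<Longrightarrow> finite F \<Longrightarrow> F \<subseteq> carrier G \<Longrightarrow> 0 < e \<Longrightarrow>
       \<exists>g\<in>carrier G. \<forall>f\<in>F. dist (y (f \<otimes> g)) (x f) < e"
    "\<And>k. star_system D (W k)" "(\<lambda>k. star_density (W k)) \<longlonglongrightarrow> c"
    "\<And>k. X \<subseteq> compatible_points P (W k)"
    "\<And>F. finite F \<Longrightarrow> F \<noteq> {} \<Longrightarrow> F \<subseteq> carrier G \<Longrightarrow>
       \<exists>J\<subseteq>F. c * card F \<le> card J \<and> (\<exists>y\<in>carrier G \<rightarrow>\<^sub>E P. \<forall>t. (\<forall>g\<in>J. t g \<in> P) \<longrightarrow> (\<lambda>g\<in>carrier G. if g \<in> J then t g else y g) \<in> X)"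
proof -
  let ?T = "full_shift G (top_of_set P)"
  have topT: "topspace ?T = carrier G \<rightarrow>\<^sub>E P" by (simp add: topspace_full_shift)
  have cT: "compact_space ?T" using P(1) by (intro compact_space_full_shift) (simp add: compact_space_subtopology)
  obtain D where D: "countable D" "D \<subseteq> P" "P \<subseteq> closure D" using separable[of P] by metis
  then obtain p where p: "p \<in> D" using P(2) by fastforce
  have pP: "p \<in> P" using p D by auto
  obtain \<tau> :: "nat \<Rightarrow> 'a \<Rightarrow> 'p option" where
    \<tau>: "range \<tau> = {\<mu>. finite (dom \<mu>) \<and> dom \<mu> \<subseteq> carrier G \<and> ran \<mu> \<subseteq> D}"
    using finite_partial_maps_enumeration[OF cnt D(1)] .
  then have \<tau>': "finite (dom (\<tau> k)) \<and> dom (\<tau> k) \<subseteq> carrier G \<and> ran (\<tau> k) \<subseteq> D" for k by blast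
  obtain W where W: "\<And>k. star_system D (W k)" "\<And>k. refines_stars (W (Suc k)) (W k)"
    "\<And>k. c < star_density (W k)" "(\<lambda>k. star_density (W k)) \<longlonglongrightarrow> c"
    "\<And>k v w'. v \<in> W k \<Longrightarrow> \<forall>f\<in>dom (\<tau> k). v f \<noteq> None \<longrightarrow> \<tau> k f = v f \<Longrightarrow> w' \<in> W (Suc k) \<Longrightarrow>
       \<exists>g\<in>carrier G. \<forall>f\<in>dom (\<tau> k). w' (f \<otimes> g) = \<tau> k f"
    by (rule star_system_sequence[where \<tau>=\<tau>, OF p c \<tau>']) (assumption | rule that)+
  have ref: "refines_stars (W j) (W i)" if "i \<le> j" for i j
    using that by (induction j rule: dec_induct) (auto intro: refines_stars_refl refines_stars_trans W(2))
  define Xk where "Xk k = compatible_points P (W k)" for k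
  have sub: "subshift G (top_of_set P) (Xk k)" for k unfolding Xk_def by (rule subshift_compatible_points[OF W(1)])
  have mono: "Xk j \<subseteq> Xk i" if ij: "i \<le> j" for i j
  proof
    fix x assume "x \<in> Xk j"
    then obtain w where w: "x \<in> carrier G \<rightarrow>\<^sub>E P" "w \<in> W j" "\<forall>g\<in>carrier G. w g \<noteq> None \<longrightarrow> w g = Some (x g)"
      by (auto simp: Xk_def compatible_points_def)
    obtain v where v: "v \<in> W i" "\<forall>g\<in>carrier G. v g \<noteq> None \<longrightarrow> w g = v g"
      using ref[OF ij] w(2) unfolding refines_stars_def by blast
    have "\<forall>g\<in>carrier G. v g \<noteq> None \<longrightarrow> v g = Some (x g)" using v(2) w(3) by metis
    then show "x \<in> Xk i" using w(1) v(1) unfolding Xk_def compatible_points_def by blast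
  qed
  define fillp where "fillp w = (\<lambda>g\<in>carrier G. case w g of None \<Rightarrow> p | Some a \<Rightarrow> a)" for w :: "'a \<Rightarrow> 'p option"
  have fill: "(\<lambda>g\<in>carrier G. if g \<in> J then t g else fillp w g) \<in> Xk k"
    if w: "w \<in> W k" "\<And>g. g \<in> J \<Longrightarrow> w g = None" and t: "\<And>g. g \<in> J \<Longrightarrow> t g \<in> P" for J t w k
  proof -
    let ?x = "\<lambda>g\<in>carrier G. if g \<in> J then t g else fillp w g"
    have "fillp w g \<in> P" if "g \<in> carrier G" for g
      using star_system_values[OF W(1) w(1) that] D(2) pP that by (auto simp: fillp_def split: option.split)
    then have "?x \<in> carrier G \<rightarrow>\<^sub>E P" using t by auto
    moreover have "\<forall>g\<in>carrier G. w g \<noteq> None \<longrightarrow> w g = Some (?x g)"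
      using w(2) by (auto simp: fillp_def)
    ultimately show ?thesis using w(1) unfolding Xk_def compatible_points_def by blast
  qed
  have cl: "closedin ?T (Xk k)" for k using sub by (simp add: subshift_def)
  define X where "X = (\<Inter>k. Xk k)"
  have "Xk k \<noteq> {}" for k
  proof -
    obtain w where "w \<in> W k" using star_system_nonempty[OF W(1)] by blast
    from fill[OF this, of "{}"] show ?thesis by auto
  qed
  then have Xne: "X \<noteq> {}" unfolding X_def
    using mono by (intro compact_space_imp_nest[OF cT cl]) (auto simp: decseq_def)
  have Xsub: "subshift G (top_of_set P) X" unfolding subshift_def
  proof (intro conjI ballI)
    show "closedin ?T X" unfolding X_def using cl by (intro closedin_Inter) auto
    show "shift_map G g ` X \<subseteq> X" if "g \<in> carrier G" for g
      using subshift_shift[OF sub that] by (auto simp: X_def)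
  qed
  have minimal: "\<exists>g\<in>carrier G. \<forall>f\<in>F. dist (y (f \<otimes> g)) (x f) < e"
    if xy: "x \<in> X" "y \<in> X" and F: "finite F" "F \<subseteq> carrier G" and e: "0 < e" for x y F e
  proof -
    have "\<exists>w\<in>W k. \<forall>g\<in>carrier G. w g \<noteq> None \<longrightarrow> w g = Some (x g)" for k
      using xy(1) by (auto simp: X_def Xk_def compatible_points_def)
    then obtain w where w: "\<And>k. w k \<in> W k" "\<And>k. \<forall>g\<in>carrier G. w k g \<noteq> None \<longrightarrow> w k g = Some (x g)" by metis
    define Jk where "Jk k = {f\<in>F. w k f = None}" for k
    have "finite (range Jk)" by (rule finite_subset[of _ "Pow F"]) (use F in \<open>auto simp: Jk_def\<close>)
    \<comment> \<open>The index \<open>i\<close> of the pattern is known only after its free set is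
      fixed; a free set that recurs at infinitely many stages also occurs at some stage from
      \<open>i\<close> on.\<close>
    then obtain k0 where k0: "infinite {k. Jk k = Jk k0}" using pigeonhole_infinite[of UNIV Jk] by auto
    define J where "J = Jk k0"
    have "\<exists>a\<in>D. dist a (x f) < e" if "f \<in> F" for f
    proof -
      have "x f \<in> P" using xy(1) subshift_subset[OF Xsub] that F by (auto simp: topT PiE_iff)
      then have "x f \<in> closure D" using D(3) by auto
      then show ?thesis using e unfolding closure_approachable by blast
    qed
    then obtain a where a: "\<And>f. f \<in> F \<Longrightarrow> a f \<in> D \<and> dist (a f) (x f) < e" by metis
    define \<mu> where "\<mu> f = (if f \<in> F then Some (if f \<in> J then a f else x f) else None)" for f
    have xD: "x f \<in> D" if "f \<in> F" "f \<notin> J" for f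
    proof -
      have fc: "f \<in> carrier G" using that F by auto
      have "w k0 f \<noteq> None" using that by (auto simp: J_def Jk_def)
      then have "w k0 f = Some (x f)" using w(2) fc by blast
      then show ?thesis using star_system_values[OF W(1) w(1) fc] by blast
    qed
    have dom: "dom \<mu> = F" by (auto simp: \<mu>_def dom_def)
    moreover have "ran \<mu> \<subseteq> D" using a xD by (auto simp: \<mu>_def ran_def split: if_splits)
    ultimately have "\<mu> \<in> range \<tau>" unfolding \<tau> using F by auto
    then obtain i where i: "\<mu> = \<tau> i" by auto
    obtain k where k: "i \<le> k" "Jk k = J"
      using k0 unfolding J_def infinite_nat_iff_unbounded_le by blast
    obtain v where v: "v \<in> W i" "\<forall>g\<in>carrier G. v g \<noteq> None \<longrightarrow> w k g = v g"
      using ref[OF k(1)] w(1) unfolding refines_stars_def by blast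
    \<comment> \<open>A letter of \<open>v\<close> persists in \<open>w k\<close>, so it lies off
      \<open>J\<close>, where \<open>\<mu>\<close> copies \<open>x\<close>.\<close>
    have vc: "\<tau> i f = v f" if f: "f \<in> dom (\<tau> i)" "v f \<noteq> None" for f
    proof -
      have fF: "f \<in> F" "f \<in> carrier G" using f(1) dom i F by auto
      have wv: "w k f = v f" using v(2) fF f(2) by blast
      then have "f \<notin> J" using f(2) k(2) by (auto simp: Jk_def)
      moreover have "w k f = Some (x f)" using w(2) fF wv f(2) by metis
      ultimately show ?thesis using wv fF i[symmetric] by (simp add: \<mu>_def)
    qed
    have "y \<in> Xk (Suc i)" using xy(2) by (auto simp: X_def)
    then obtain w' where w': "w' \<in> W (Suc i)" "\<forall>g\<in>carrier G. w' g \<noteq> None \<longrightarrow> w' g = Some (y g)"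
      by (auto simp: Xk_def compatible_points_def)
    obtain g where g: "g \<in> carrier G" "\<forall>f\<in>dom (\<tau> i). w' (f \<otimes> g) = \<tau> i f" using W(5)[OF v(1) _ w'(1)] vc by blast
    have "dist (y (f \<otimes> g)) (x f) < e" if f: "f \<in> F" for f
    proof -
      have "f \<otimes> g \<in> carrier G" using f F g by auto
      moreover have "w' (f \<otimes> g) = Some (if f \<in> J then a f else x f)" using g(2) f dom i[symmetric] by (simp add: \<mu>_def)
      ultimately have "y (f \<otimes> g) = (if f \<in> J then a f else x f)" using w'(2) by force
      then show ?thesis using a[OF f] e by auto
    qed
    then show ?thesis using g(1) by blast
  qed
  have cubes: "\<exists>J\<subseteq>F. c * card F \<le> card J \<and> (\<exists>y\<in>carrier G \<rightarrow>\<^sub>E P. \<forall>t. (\<forall>g\<in>J. t g \<in> P) \<longrightarrow> (\<lambda>g\<in>carrier G. if g \<in> J then t g else y g) \<in> X)"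
    if F: "finite F" "F \<noteq> {}" "F \<subseteq> carrier G" for F
  proof -
    have "\<exists>w\<in>W k. c * card F < stars w F" for k
      using star_density_less[OF star_system_nonempty[OF W(1)] W(3) F] by metis
    then obtain w where w: "\<And>k. w k \<in> W k" "\<And>k. c * card F < stars (w k) F" by metis
    define Jk where "Jk k = {f\<in>F. w k f = None}" for k
    have "finite (range Jk)" by (rule finite_subset[of _ "Pow F"]) (use F in \<open>auto simp: Jk_def\<close>)
    then obtain k0 where k0: "infinite {k. Jk k = Jk k0}" using pigeonhole_infinite[of UNIV Jk] by auto
    define J where "J = Jk k0"
    have JF: "J \<subseteq> F" by (auto simp: J_def Jk_def)
    have cJ: "c * card F \<le> card J" using w(2)[of k0] by (simp add: J_def Jk_def stars_def)
    define \<Psi> where "\<Psi> t y = (\<lambda>g\<in>carrier G. if g \<in> J then t g else y g)" for t y :: "'a \<Rightarrow> 'p"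
    \<comment> \<open>Backgrounds that admit every choice of values on \<open>J\<close> at stage
      \<open>k\<close>. These sets are closed and decreasing, and later stages with free set
      \<open>J\<close> show that they are nonempty.\<close>
    define Z where "Z k = topspace ?T \<inter> (\<Inter>t\<in>{t. \<forall>g\<in>J. t g \<in> P}. {y\<in>topspace ?T. \<Psi> t y \<in> Xk k})" for k
    have cont: "continuous_map ?T ?T (\<Psi> t)" if t: "\<forall>g\<in>J. t g \<in> P" for t
      unfolding full_shift_def continuous_map_componentwise
    proof (intro conjI ballI)
      show "\<Psi> t ` topspace (product_topology (\<lambda>_. top_of_set P) (carrier G)) \<subseteq> extensional (carrier G)"
        by (auto simp: \<Psi>_def)
      fix k assume k: "k \<in> carrier G"
      show "continuous_map (product_topology (\<lambda>_. top_of_set P) (carrier G)) (top_of_set P) (\<lambda>y. \<Psi> t y k)"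
      proof (cases "k \<in> J")
        case True
        then show ?thesis using t k by (simp add: \<Psi>_def)
      next
        case False
        then show ?thesis using k continuous_map_product_projection[OF k, of "\<lambda>_. top_of_set P"] by (simp add: \<Psi>_def)
      qed
    qed
    have "(\<Inter>k. Z k) \<noteq> {}"
    proof (rule compact_space_imp_nest[OF cT])
      show "closedin ?T (Z k)" for k
      proof -
        have "{t. \<forall>g\<in>J. t g \<in> P} \<noteq> {}" using pP by auto
        then show ?thesis unfolding Z_def
          using cont cl by (intro closedin_Int closedin_topspace closedin_Inter) (auto intro!: closedin_continuous_map_preimage)
      qed
      show "decseq Z" unfolding decseq_def Z_def using mono by fastforce
      show "Z k \<noteq> {}" for k
      proof -
        obtain j where j: "k \<le> j" "Jk j = J" using k0 unfolding J_def infinite_nat_iff_unbounded_le by blast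
        have Jn: "w j g = None" if "g \<in> J" for g using that j(2) by (auto simp: Jk_def)
        have "\<Psi> t (fillp (w j)) \<in> Xk k" if "\<forall>g\<in>J. t g \<in> P" for t
        proof -
          have "\<Psi> t (fillp (w j)) \<in> Xk j" unfolding \<Psi>_def
            by (rule fill[OF w(1)]) (use Jn that in auto)
          then show ?thesis using mono[OF j(1)] by blast
        qed
        moreover have "fillp (w j) \<in> topspace ?T"
        proof -
          have "(\<lambda>g\<in>carrier G. if g \<in> {} then p else fillp (w j) g) \<in> Xk j"
            by (rule fill[OF w(1)]) auto
          moreover have "(\<lambda>g\<in>carrier G. if g \<in> {} then p else fillp (w j) g) = fillp (w j)" by (auto simp: fillp_def fun_eq_iff)
          ultimately show ?thesis using subshift_subset[OF sub] by auto
        qed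
        ultimately have "fillp (w j) \<in> Z k" by (auto simp: Z_def)
        then show ?thesis by blast
      qed
    qed
    then obtain y where y: "\<And>k. y \<in> Z k" by blast
    have "\<Psi> t y \<in> X" if "\<forall>g\<in>J. t g \<in> P" for t using y that by (auto simp: Z_def X_def)
    moreover have "y \<in> carrier G \<rightarrow>\<^sub>E P" using y[of 0] by (auto simp: Z_def topT)
    ultimately show ?thesis using JF cJ unfolding \<Psi>_def by blast
  qed
  have XW: "X \<subseteq> compatible_points P (W k)" for k by (auto simp: X_def Xk_def)
  show ?thesis
    by (rule that[OF Xsub Xne D(2) minimal W(1) W(4) XW cubes])
qed

end

theorem mainTheorem1:
  fixes G :: "('g, 'm) monoid_scheme"
    and P :: "'a::euclidean_space set"
    and r :: real
  assumes "group G" and "countable (carrier G)" and "infinite (carrier G)"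
    and "amenable_group G"
    and "simplicial_polyhedron P"
    and "0 < covering_dim (top_of_set P)" and "covering_dim (top_of_set P) < \<infinity>"
    and "0 \<le> r" and "ereal r < covering_dim (top_of_set P)"
  shows "\<exists>X. subshift G (top_of_set P) X \<and> X \<noteq> {} \<and>
           minimal_system G (subtopology (full_shift G (top_of_set P)) X) (shift_action G X) \<and>
           mdim G (subtopology (full_shift G (top_of_set P)) X) (shift_action G X) = ereal r"
proof -
  interpret group G by fact
  obtain \<Phi> where \<Phi>: "folner_sequence G \<Phi>" using assms(4) by (auto simp: amenable_group_def)
  interpret infinite_folner_group G \<Phi> by unfold_locales (use \<Phi> assms(3) in auto)
  obtain d where d: "0 < d" "covering_dim (top_of_set P) = ereal (real d)" "covering_dim_le (top_of_set P) d"
    using covering_dim_natE[OF assms(6,7)] by metis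
  obtain e where e: "continuous_map (unit_cube d) (top_of_set P) e" "inj_on e (topspace (unit_cube d))"
    using polyhedron_cube_embedding[OF assms(5) d(1,2)] by metis
  have HP: "Hausdorff_space (top_of_set P)" by (simp add: Hausdorff_space_subtopology)
  obtain \<U> where \<U>: "finite_open_cover (top_of_set P) \<U>"
    "\<And>U i s t. U \<in> \<U> \<Longrightarrow> i < d \<Longrightarrow> s \<in> topspace (unit_cube d) \<Longrightarrow> t \<in> topspace (unit_cube d) \<Longrightarrow>
       e s \<in> U \<Longrightarrow> e t \<in> U \<Longrightarrow> s i = 0 \<Longrightarrow> t i \<noteq> 1"
    by (rule face_separating_cover[OF HP e]) (assumption | rule that)+
  have P: "compact P" using assms(5)
    by (auto simp: simplicial_polyhedron_def simplicial_complex_def simplex intro!: compact_Union finite_imp_compact_convex_hull)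
  have "(\<lambda>i\<in>{..<d}. 0) \<in> topspace (unit_cube d)" by (auto simp: topspace_unit_cube)
  then have Pne: "P \<noteq> {}" using continuous_map_image_subset_topspace[OF e(1)] by auto
  \<comment> \<open>With \<open>d\<close> dimensions for each free coordinate, density
    \<open>c\<close> gives mean dimension \<open>d * c = r\<close>.\<close>
  define c where "c = r / d"
  have c: "0 \<le> c" "c < 1" "real d * c = r" using assms(8,9) d by (auto simp: c_def)
  obtain X D W where X: "subshift G (top_of_set P) X" "X \<noteq> {}" "D \<subseteq> P"
    and minimal: "\<And>x y F e. x \<in> X \<Longrightarrow> y \<in> X \<Longrightarrow> finite F \<Longrightarrow> F \<subseteq> carrier G \<Longrightarrow> 0 < e \<Longrightarrow>
       \<exists>g\<in>carrier G. \<forall>f\<in>F. dist (y (f \<otimes>\<^bsub>G\<^esub> g)) (x f) < e"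
    and W: "\<And>k. star_system D (W k)" "(\<lambda>k. star_density (W k)) \<longlonglongrightarrow> c"
    and XW: "\<And>k. X \<subseteq> compatible_points P (W k)"
    and cubes: "\<And>F. finite F \<Longrightarrow> F \<noteq> {} \<Longrightarrow> F \<subseteq> carrier G \<Longrightarrow>
       \<exists>J\<subseteq>F. c * card F \<le> card J \<and> (\<exists>y\<in>carrier G \<rightarrow>\<^sub>E P. \<forall>t. (\<forall>g\<in>J. t g \<in> P) \<longrightarrow> (\<lambda>g\<in>carrier G. if g \<in> J then t g else y g) \<in> X)"
    by (rule minimal_cube_subshift_exists[OF P Pne assms(2) c(1,2)]) (assumption | rule that)+
  let ?T = "full_shift G (top_of_set P)"
  let ?XT = "subtopology ?T X" and ?\<phi> = "shift_action G X"
  have XT: "X \<subseteq> topspace ?T" using X(1) by (rule subshift_subset)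
  have top: "topspace ?XT = X" using XT by auto
  have S: "G_system G ?XT ?\<phi>" by (rule G_system_subshift[OF P assms(2) X(1,2)])
  note p = G_system_props[OF S]
  have "minimal_system G ?XT ?\<phi>" unfolding minimal_system_def
  proof (intro conjI S ballI)
    fix y assume "y \<in> topspace ?XT"
    then have y: "y \<in> X" using top by simp
    show "?XT closure_of orbit G ?\<phi> y = topspace ?XT"
    proof (intro equalityI closure_of_subset_topspace subsetI)
      fix x assume "x \<in> topspace ?XT"
      then have x: "x \<in> X" using top by simp
      show "x \<in> ?XT closure_of orbit G ?\<phi> y" unfolding in_closure_of
      proof (intro conjI allI impI)
        show "x \<in> topspace ?XT" by fact
        fix U assume U: "x \<in> U \<and> openin ?XT U"
        have "compactin (product_topology (\<lambda>_. top_of_set P) (carrier G)) X"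
          using X(1) compact_space_full_shift[of "top_of_set P" G] P
          by (auto simp: subshift_def full_shift_def compact_space_subtopology intro: closedin_compact_space)
        moreover have "Hausdorff_space ?XT" using Hausdorff_space_full_shift[OF HP] by (intro Hausdorff_space_subtopology)
        then have "closedin ?XT {x}" using x top by (simp add: closedin_Hausdorff_singleton)
        then have "openin ?XT (X - {x})" using top by (metis openin_diff openin_topspace)
        then have "openin (subtopology (product_topology (\<lambda>_. top_of_set P) (carrier G)) X) V" if "V \<in> {U, X - {x}}" for V
          using that U by (auto simp: full_shift_def)
        moreover have "X \<subseteq> \<Union>{U, X - {x}}" using U by auto
        \<comment> \<open>For the cover by \<open>U\<close> and \<open>X - {x}\<close> the Lebesgue
          number describes a basic neighbourhood of \<open>x\<close> inside \<open>U\<close>, since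
          only \<open>U\<close> contains \<open>x\<close>.\<close>
        ultimately obtain E \<epsilon> where E: "finite E" "E \<subseteq> carrier G" "0 < \<epsilon>"
          "\<And>x'. x' \<in> X \<Longrightarrow> \<exists>V\<in>{U, X - {x}}. \<forall>y\<in>X. (\<forall>i\<in>E. dist (x' i) (y i) < \<epsilon>) \<longrightarrow> y \<in> V"
          by (rule product_Lebesgue_number) (assumption | rule that)+
        obtain V where V: "V \<in> {U, X - {x}}" "\<forall>y\<in>X. (\<forall>i\<in>E. dist (x i) (y i) < \<epsilon>) \<longrightarrow> y \<in> V" using E(4)[OF x] by blast
        then have "x \<in> V" using x E(3) by simp
        then have VU: "V = U" using V(1) by auto
        obtain g where g: "g \<in> carrier G" "\<forall>f\<in>E. dist (y (f \<otimes>\<^bsub>G\<^esub> g)) (x f) < \<epsilon>" using minimal[OF x y E(1-3)] by blast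
        have "shift_map G g y \<in> U" unfolding VU[symmetric]
        proof (rule V(2)[rule_format])
          show "shift_map G g y \<in> X" by (rule subshift_shift[OF X(1) g(1) y])
          show "dist (x i) (shift_map G g y i) < \<epsilon>" if "i \<in> E" for i
          proof -
            have "i \<in> carrier G" using that E(2) by auto
            then show ?thesis using g(2) that by (simp add: shift_map_apply dist_commute)
          qed
        qed
        moreover have "shift_map G g y \<in> orbit G ?\<phi> y" using g(1) y by (auto simp: orbit_def shift_action_def)
        ultimately show "\<exists>z. z \<in> orbit G ?\<phi> y \<and> z \<in> U" by blast
      qed
    qed
  qed
  moreover have "mdim G ?XT ?\<phi> = ereal r" unfolding mdim_def
  proof (rule antisym)
    show "(SUP \<alpha>\<in>{\<alpha>. finite_open_cover ?XT \<alpha>}. ereal (mean_cover_D G ?XT ?\<phi> \<alpha>)) \<le> ereal r"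
    proof (rule SUP_least)
      fix \<alpha> assume "\<alpha> \<in> {\<alpha>. finite_open_cover ?XT \<alpha>}"
      then have \<alpha>: "finite_open_cover ?XT \<alpha>" by simp
      have "mean_cover_D G ?XT ?\<phi> \<alpha> \<le> real d * star_density (W k)" for k
      proof (rule mean_cover_D_le_star_density[OF P assms(2) d(3) W(1) X(3,1,2) _ \<alpha>])
        show "\<exists>w\<in>W k. \<forall>g\<in>carrier G. w g \<noteq> None \<longrightarrow> w g = Some (x g)" if "x \<in> X" for x
          using XW that by (auto simp: compatible_points_def)
      qed
      moreover have "(\<lambda>k. real d * star_density (W k)) \<longlonglongrightarrow> real d * c" by (intro tendsto_intros W(2))
      ultimately have "mean_cover_D G ?XT ?\<phi> \<alpha> \<le> real d * c" by (intro LIMSEQ_le_const) auto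
      then show "ereal (mean_cover_D G ?XT ?\<phi> \<alpha>) \<le> ereal r" using c(3) by simp
    qed
    \<comment> \<open>The cover that detects the cubes reads only the coordinate at the identity;
      its join over \<open>\<Phi> n\<close> reads the coordinates in
      \<open>\<Phi> n\<close>.\<close>
    define \<alpha> where "\<alpha> = (\<lambda>U. {x\<in>X. x \<one>\<^bsub>G\<^esub> \<in> U}) ` \<U>"
    have \<alpha>: "finite_open_cover ?XT \<alpha>" unfolding finite_open_cover_def
    proof (intro conjI ballI)
      show "finite \<alpha>" using \<U>(1) by (simp add: \<alpha>_def finite_open_cover_def)
      have proj: "continuous_map ?XT (top_of_set P) (\<lambda>x. x \<one>\<^bsub>G\<^esub>)" unfolding full_shift_def
        by (intro continuous_map_from_subtopology continuous_map_product_projection) simp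
      show "openin ?XT A" if A: "A \<in> \<alpha>" for A
      proof -
        obtain U where U: "U \<in> \<U>" "A = {x\<in>X. x \<one>\<^bsub>G\<^esub> \<in> U}" using A by (auto simp: \<alpha>_def)
        then have "openin (top_of_set P) U" using \<U>(1) by (simp add: finite_open_cover_def)
        from openin_continuous_map_preimage[OF proj this] show ?thesis unfolding U(2) top .
      qed
      have "x \<in> \<Union>\<alpha>" if "x \<in> X" for x
      proof -
        have "x \<one>\<^bsub>G\<^esub> \<in> \<Union>\<U>" using that XT \<U>(1) by (auto simp: topspace_full_shift PiE_iff finite_open_cover_def)
        then show ?thesis using that by (auto simp: \<alpha>_def)
      qed
      moreover have "\<Union>\<alpha> \<subseteq> X" by (auto simp: \<alpha>_def)
      ultimately show "\<Union>\<alpha> = topspace ?XT" using top by auto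
    qed
    have "r \<le> of_int (cover_D ?XT (cover_join_over ?XT ?\<phi> \<alpha> (\<Phi> n))) / real (card (\<Phi> n))" for n
    proof -
      have F: "finite (\<Phi> n)" "\<Phi> n \<noteq> {}" "\<Phi> n \<subseteq> carrier G" using \<Phi> by (auto simp: folner_sequence_def)
      obtain J y where J: "J \<subseteq> \<Phi> n" "c * card (\<Phi> n) \<le> card J" and y: "y \<in> carrier G \<rightarrow>\<^sub>E P"
        "\<And>t. \<forall>g\<in>J. t g \<in> P \<Longrightarrow> (\<lambda>g\<in>carrier G. if g \<in> J then t g else y g) \<in> X"
        using cubes[OF F] by blast
      have "int (d * card J) \<le> cover_D ?XT (cover_join_over ?XT ?\<phi> \<alpha> (\<Phi> n))" unfolding \<alpha>_def
      proof (rule cover_D_cube_lower[where e=e and \<U>=\<U> and y=y and J=J and T="top_of_set P" and X=X and F="\<Phi> n", OF e(1) d(1) _ J(1) F(3,1) _ XT])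
        show "t i \<noteq> 1" if "U \<in> \<U>" "i < d" "s \<in> topspace (unit_cube d)" "t \<in> topspace (unit_cube d)"
          "e s \<in> U" "e t \<in> U" "s i = 0" for U i s t
          by (rule \<U>(2)[OF that])
        show "y \<in> topspace ?T" using y(1) by (simp add: topspace_full_shift)
        show "(\<lambda>g\<in>carrier G. if g \<in> J then t g else y g) \<in> X" if "\<And>g. g \<in> J \<Longrightarrow> t g \<in> topspace (top_of_set P)" for t
          using y(2)[of t] that by simp
        show "finite_open_cover ?XT (cover_join_over ?XT ?\<phi> ((\<lambda>U. {x\<in>X. x \<one>\<^bsub>G\<^esub> \<in> U}) ` \<U>) (\<Phi> n))"
          unfolding \<alpha>_def[symmetric] using F p(3) by (intro finite_open_cover_join_over[OF \<alpha>]) auto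
      qed
      then have "real (d * card J) \<le> of_int (cover_D ?XT (cover_join_over ?XT ?\<phi> \<alpha> (\<Phi> n)))" by linarith
      moreover have "real d * (c * card (\<Phi> n)) \<le> real d * card J" using J(2) by (intro mult_left_mono) auto
      ultimately have "r * card (\<Phi> n) \<le> of_int (cover_D ?XT (cover_join_over ?XT ?\<phi> \<alpha> (\<Phi> n)))"
        using c(3) by (simp add: mult.assoc[symmetric])
      then show ?thesis using F by (simp add: pos_le_divide_eq card_gt_0_iff)
    qed
    then have "r \<le> mean_cover_D G ?XT ?\<phi> \<alpha>"
      by (intro LIMSEQ_le_const[OF mean_cover_D_tendsto[OF S \<alpha> \<Phi>]]) auto
    then have "ereal r \<le> ereal (mean_cover_D G ?XT ?\<phi> \<alpha>)" by simp
    also have "\<dots> \<le> (SUP \<alpha>\<in>{\<alpha>. finite_open_cover ?XT \<alpha>}. ereal (mean_cover_D G ?XT ?\<phi> \<alpha>))"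
      using \<alpha> by (intro SUP_upper) auto
    finally show "ereal r \<le> (SUP \<alpha>\<in>{\<alpha>. finite_open_cover ?XT \<alpha>}. ereal (mean_cover_D G ?XT ?\<phi> \<alpha>))" .
  qed
  ultimately show ?thesis using X(1,2) by blast
qed

end
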